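(* Let $\Phi$ be a field with $\frac12\in\Phi$ (that is, of characteristic other than $2$) and with no square root of $-1$, and let $L_\Phi$ be the Lorentz type algebra over $\Phi$. Then the affine group scheme $\mathbf{Aut}(L_\Phi)$ is isomorphic to $\mathbf{PGL}_2(\bar\Phi)\rtimes\mathbf Z_2$. In particular, the automorphism group of the (real) Lorentz algebra $L_{\mathbb R}=\mathfrak o(1,3)$ is $\mathrm{PGL}_2(\mathbb C)\rtimes\mu_2(\mathbb R)$, where $\mu_2(\mathbb R)=\{x\in\mathbb R^\times: x^2=1\}$.
   Context: For a commutative unital ring $R$, the Lorentz type algebra $L_R$ is the Lie $R$-algebra which is free as an $R$-module with basis $b_1,\dots,b_6$ and whose (alternating) bracket is given by $[b_1,b_2]=b_4$, $[b_1,b_3]=b_5$, $[b_1,b_4]=b_2$, $[b_1,b_5]=b_3$, $[b_1,b_6]=0$, $[b_2,b_3]=b_6$, $[b_2,b_4]=-b_1$, $[b_2,b_5]=0$, $[b_2,b_6]=b_3$, $[b_3,b_4]=0$, $[b_3,b_5]=-b_1$, $[b_3,b_6]=-b_2$, $[b_4,b_5]=-b_6$, $[b_4,b_6]=b_5$, $[b_5,b_6]=-b_4$. For a commutative unital ring $R$, $\bar R:=R\times R$ with componentwise addition and product $(x,y)(u,v)=(xu-yv,xv+yu)$, an $R$-algebra via $r\mapsto(r,0)$ (so $\bar{\mathbb R}=\mathbb C$). Affine group schemes over $\Phi$ are regarded as functors from commutative associative unital $\Phi$-algebras to groups. $\mathbf{Aut}(L_\Phi)$ is $R\mapsto\mathrm{Aut}_R(L_R)$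 (automorphisms of the Lie $R$-algebra $L_R$). For a commutative unital ring $S$, $\mathrm{PGL}_2(S):=\mathrm{GL}_2(S)/S^\times$, and $\mathbf{PGL}_2(\bar\Phi)$ denotes the affine group scheme over $\Phi$ given by $R\mapsto\mathrm{PGL}_2(\bar R)=\mathrm{GL}_2(\bar R)/(\bar R)^\times$. $\mathbf Z_2$ is the finite constant group scheme represented by the Hopf algebra $\Phi\times\Phi$ (componentwise product); since $\tfrac12\in\Phi$ it is isomorphic to $R\mapsto\mu_2(R)=\{x\in R^\times:x^2=1\}$ and to $R\mapsto\mathrm{Aut}_R(\bar R)$ ($b\in\mu_2(R)$ corresponding to the $R$-automorphism of $\bar R$ with $(0,1)\mapsto(0,b)$). In the semidirect products, $\mathrm{Aut}_R(\bar R)$ acts on $\mathrm{PGL}_2(\bar R)$ by acting on matrix entries.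
   Formalization: PGL_2 of Φ-bar is taken as the Zariski sheaf associated with R ↦ GL_2(R-bar)/(R-bar)^×, since the literal quotient functor is not a sheaf (e.g. R = Φ[x,y]/(y²−x³+x)) and so is no affine group scheme; over the reals PGL_2(C) is the literal quotient. *)

theory Defs
  imports
    "HOL-Algebra.Algebra"
    "HOL-Algebra.Algebraic_Closure_Type"
    "HOL-Analysis.Finite_Cartesian_Product"
begin

section \<open>Functors from commutative algebras to groups\<close>

text \<open>
  A commutative \<open>\<Phi>\<close>-algebra is a module record \<open>R\<close> with \<^term>\<open>algebra \<Phi> R\<close>.  A functor from
  commutative \<open>\<Phi>\<close>-algebras to groups is given on the algebras whose carrier lies in a type
  \<open>'r\<close>; this type is a variable, hence arbitrary, and plays the role of the universe.
\<close>

definition alg_hom ::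
    "('k, 'm) ring_scheme \<Rightarrow> ('k, 'r) module \<Rightarrow> ('k, 's) module \<Rightarrow> ('r \<Rightarrow> 's) set" where
  "alg_hom \<Phi> R R' =
     {\<phi> \<in> ring_hom R R'. \<forall>c\<in>carrier \<Phi>. \<forall>x\<in>carrier R. \<phi> (c \<odot>\<^bsub>R\<^esub> x) = c \<odot>\<^bsub>R'\<^esub> \<phi> x}"

record ('k, 'r, 'g) grp_functor =
  obj :: "('k, 'r) module \<Rightarrow> 'g monoid"
  mor :: "('k, 'r) module \<Rightarrow> ('k, 'r) module \<Rightarrow> ('r \<Rightarrow> 'r) \<Rightarrow> 'g \<Rightarrow> 'g"

definition is_grp_functor ::
    "('k, 'm) ring_scheme \<Rightarrow> ('k, 'r, 'g) grp_functor \<Rightarrow> bool" where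
  "is_grp_functor \<Phi> F \<longleftrightarrow>
     (\<forall>R. algebra \<Phi> R \<longrightarrow> group (obj F R)) \<and>
     (\<forall>R R' \<phi>. algebra \<Phi> R \<and> algebra \<Phi> R' \<and> \<phi> \<in> alg_hom \<Phi> R R' \<longrightarrow>
        mor F R R' \<phi> \<in> hom (obj F R) (obj F R')) \<and>
     (\<forall>R. algebra \<Phi> R \<longrightarrow> (\<forall>x\<in>carrier (obj F R). mor F R R (\<lambda>r. r) x = x)) \<and>
     (\<forall>R R' R'' \<phi> \<psi>. algebra \<Phi> R \<and> algebra \<Phi> R' \<and> algebra \<Phi> R'' \<and>
        \<phi> \<in> alg_hom \<Phi> R R' \<and> \<psi> \<in> alg_hom \<Phi> R' R'' \<longrightarrow>
        (\<forall>x\<in>carrier (obj F R).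
           mor F R R'' (\<lambda>r. \<psi> (\<phi> r)) x = mor F R' R'' \<psi> (mor F R R' \<phi> x)))"

definition grp_functors_isomorphic ::
    "('k, 'm) ring_scheme \<Rightarrow> ('k, 'r, 'g) grp_functor \<Rightarrow> ('k, 'r, 'h) grp_functor \<Rightarrow> bool" where
  "grp_functors_isomorphic \<Phi> F G \<longleftrightarrow>
     is_grp_functor \<Phi> F \<and> is_grp_functor \<Phi> G \<and>
     (\<exists>\<eta>. (\<forall>R. algebra \<Phi> R \<longrightarrow> \<eta> R \<in> iso (obj F R) (obj G R)) \<and>
          (\<forall>R R' \<phi>. algebra \<Phi> R \<and> algebra \<Phi> R' \<and> \<phi> \<in> alg_hom \<Phi> R R' \<longrightarrow>
             (\<forall>x\<in>carrier (obj F R). \<eta> R' (mor F R R' \<phi> x) = mor G R R' \<phi> (\<eta> R x))))"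


section \<open>Lie algebras and the Lorentz type algebra\<close>

text \<open>
  A Lie algebra over \<open>R\<close> is stored in a module record whose \<^const>\<open>monoid.mult\<close> field is the bracket;
  the \<^const>\<open>monoid.one\<close> field carries no information.
\<close>

definition lie_iso ::
    "('r, 'm) ring_scheme \<Rightarrow> ('r, 'l) module \<Rightarrow> ('r, 'n) module \<Rightarrow> ('l \<Rightarrow> 'n) set" where
  "lie_iso R L M =
     {f. bij_betw f (carrier L) (carrier M) \<and>
         (\<forall>x\<in>carrier L. \<forall>y\<in>carrier L. f (x \<oplus>\<^bsub>L\<^esub> y) = f x \<oplus>\<^bsub>M\<^esub> f y) \<and>
         (\<forall>r\<in>carrier R. \<forall>x\<in>carrier L. f (r \<odot>\<^bsub>L\<^esub> x) = r \<odot>\<^bsub>M\<^esub> f x) \<and>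
         (\<forall>x\<in>carrier L. \<forall>y\<in>carrier L. f (x \<otimes>\<^bsub>L\<^esub> y) = f x \<otimes>\<^bsub>M\<^esub> f y)}"

definition lie_aut ::
    "('r, 'm) ring_scheme \<Rightarrow> ('r, 'l) module \<Rightarrow> ('l \<Rightarrow> 'l) monoid" where
  "lie_aut R L = (BijGroup (carrier L))\<lparr>carrier := Bij (carrier L) \<inter> lie_iso R L L\<rparr>"

text \<open>
  An element \<open>x\<close> of the free module is its coordinate function on \<open>{1..6}\<close>.  With
  \<open>m i j\<close> the minor \<open>x\<^sub>i y\<^sub>j - x\<^sub>j y\<^sub>i\<close>, the coefficient of \<open>b\<^sub>k\<close> in \<open>[x, y]\<close> is the sum of
  \<open>\<plusminus> m i j\<close> over the pairs \<open>i < j\<close> with \<open>[b\<^sub>i, b\<^sub>j] = \<plusminus> b\<^sub>k\<close>.  The brackets of the basis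
  vectors are listed in \<open>lorentz_bracket_basis\<close> below.
\<close>

definition lorentz_bracket ::
    "('r, 'm) ring_scheme \<Rightarrow> (nat \<Rightarrow> 'r) \<Rightarrow> (nat \<Rightarrow> 'r) \<Rightarrow> (nat \<Rightarrow> 'r)" where
  "lorentz_bracket R x y =
     (let m = (\<lambda>i j. (x i \<otimes>\<^bsub>R\<^esub> y j) \<ominus>\<^bsub>R\<^esub> (x j \<otimes>\<^bsub>R\<^esub> y i)) in
      (\<lambda>k\<in>{1..6}.
         if k = 1 then (\<ominus>\<^bsub>R\<^esub> m 2 4) \<ominus>\<^bsub>R\<^esub> m 3 5
         else if k = 2 then m 1 4 \<ominus>\<^bsub>R\<^esub> m 3 6
         else if k = 3 then m 1 5 \<oplus>\<^bsub>R\<^esub> m 2 6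
         else if k = 4 then m 1 2 \<ominus>\<^bsub>R\<^esub> m 5 6
         else if k = 5 then m 1 3 \<oplus>\<^bsub>R\<^esub> m 4 6
         else m 2 3 \<ominus>\<^bsub>R\<^esub> m 4 5))"

definition lorentz :: "('r, 'm) ring_scheme \<Rightarrow> ('r, nat \<Rightarrow> 'r) module" where
  "lorentz R =
     \<lparr>carrier = {1..6} \<rightarrow>\<^sub>E carrier R,
      monoid.mult = lorentz_bracket R,
      one = undefined,
      ring.zero = (\<lambda>i\<in>{1..6}. \<zero>\<^bsub>R\<^esub>),
      add = (\<lambda>x y. \<lambda>i\<in>{1..6}. x i \<oplus>\<^bsub>R\<^esub> y i),
      module.smult = (\<lambda>r x. \<lambda>i\<in>{1..6}. r \<otimes>\<^bsub>R\<^esub> x i)\<rparr>"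

definition lorentz_basis :: "('r, 'm) ring_scheme \<Rightarrow> nat \<Rightarrow> (nat \<Rightarrow> 'r)" where
  "lorentz_basis R j = (\<lambda>i\<in>{1..6}. if i = j then \<one>\<^bsub>R\<^esub> else \<zero>\<^bsub>R\<^esub>)"

lemma lorentz_bracket_basis:
  fixes R :: "('r, 'm) ring_scheme"
  assumes "cring R"
  defines "b \<equiv> lorentz_basis R" and "brk \<equiv> lorentz_bracket R"
    and "neg \<equiv> (\<lambda>v. \<lambda>i\<in>{1..6::nat}. \<ominus>\<^bsub>R\<^esub> v i)"
  shows "brk (b 1) (b 2) = b 4" "brk (b 1) (b 3) = b 5" "brk (b 1) (b 4) = b 2"
    "brk (b 1) (b 5) = b 3" "brk (b 1) (b 6) = \<zero>\<^bsub>lorentz R\<^esub>" "brk (b 2) (b 3) = b 6"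
    "brk (b 2) (b 4) = neg (b 1)" "brk (b 2) (b 5) = \<zero>\<^bsub>lorentz R\<^esub>" "brk (b 2) (b 6) = b 3"
    "brk (b 3) (b 4) = \<zero>\<^bsub>lorentz R\<^esub>" "brk (b 3) (b 5) = neg (b 1)"
    "brk (b 3) (b 6) = neg (b 2)" "brk (b 4) (b 5) = neg (b 6)" "brk (b 4) (b 6) = b 5"
    "brk (b 5) (b 6) = neg (b 4)"
proof -
  interpret cring R by fact
  show "brk (b 1) (b 2) = b 4" "brk (b 1) (b 3) = b 5" "brk (b 1) (b 4) = b 2"
    "brk (b 1) (b 5) = b 3" "brk (b 1) (b 6) = \<zero>\<^bsub>lorentz R\<^esub>" "brk (b 2) (b 3) = b 6"
    "brk (b 2) (b 4) = neg (b 1)" "brk (b 2) (b 5) = \<zero>\<^bsub>lorentz R\<^esub>" "brk (b 2) (b 6) = b 3"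
    "brk (b 3) (b 4) = \<zero>\<^bsub>lorentz R\<^esub>" "brk (b 3) (b 5) = neg (b 1)"
    "brk (b 3) (b 6) = neg (b 2)" "brk (b 4) (b 5) = neg (b 6)" "brk (b 4) (b 6) = b 5"
    "brk (b 5) (b 6) = neg (b 4)"
    unfolding b_def brk_def neg_def
    by (auto simp: fun_eq_iff a_minus_def lorentz_bracket_def lorentz_basis_def lorentz_def)
qed

text \<open>
  \<open>L\<^sub>R\<^sub>'\<close> is \<open>L\<^sub>R \<otimes>\<^sub>R R'\<close>, and an automorphism is sent to the \<open>R'\<close>-linear map whose matrix is
  the image under \<open>\<phi>\<close> of its own.
\<close>

definition Aut_lorentz ::
    "('k, 'r, (nat \<Rightarrow> 'r) \<Rightarrow> (nat \<Rightarrow> 'r)) grp_functor" where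
  "Aut_lorentz =
     \<lparr>obj = (\<lambda>R. lie_aut R (lorentz R)),
      mor = (\<lambda>R R' \<phi> \<alpha>. \<lambda>y\<in>carrier (lorentz R'). \<lambda>i\<in>{1..6}.
               \<Oplus>\<^bsub>R'\<^esub>j\<in>{1..6}. y j \<otimes>\<^bsub>R'\<^esub> \<phi> (\<alpha> (lorentz_basis R j) i))\<rparr>"


section \<open>The algebra of pairs with \<open>(0,1)\<^sup>2 = -1\<close>\<close>

definition bar :: "('r, 'm) ring_scheme \<Rightarrow> ('r, 'r \<times> 'r) module" where
  "bar R =
     \<lparr>carrier = carrier R \<times> carrier R,
      monoid.mult = (\<lambda>(x, y) (u, v).
        ((x \<otimes>\<^bsub>R\<^esub> u) \<ominus>\<^bsub>R\<^esub> (y \<otimes>\<^bsub>R\<^esub> v), (x \<otimes>\<^bsub>R\<^esub> v) \<oplus>\<^bsub>R\<^esub> (y \<otimes>\<^bsub>R\<^esub> u))),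
      one = (\<one>\<^bsub>R\<^esub>, \<zero>\<^bsub>R\<^esub>),
      ring.zero = (\<zero>\<^bsub>R\<^esub>, \<zero>\<^bsub>R\<^esub>),
      add = (\<lambda>(x, y) (u, v). (x \<oplus>\<^bsub>R\<^esub> u, y \<oplus>\<^bsub>R\<^esub> v)),
      module.smult = (\<lambda>r (x, y). (r \<otimes>\<^bsub>R\<^esub> x, r \<otimes>\<^bsub>R\<^esub> y))\<rparr>"

definition bar_aut :: "('r, 'm) ring_scheme \<Rightarrow> 'r \<Rightarrow> 'r \<times> 'r \<Rightarrow> 'r \<times> 'r" where
  "bar_aut R b = (\<lambda>(x, y). (x, b \<otimes>\<^bsub>R\<^esub> y))"


section \<open>\<open>2 \<times> 2\<close> matrices and \<open>PGL\<^sub>2\<close>\<close>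

text \<open>The quadruple \<open>(a, b, c, d)\<close> is the matrix with rows \<open>(a, b)\<close> and \<open>(c, d)\<close>.\<close>

type_synonym 's mat2 = "'s \<times> 's \<times> 's \<times> 's"

definition Mat2 :: "('s, 'm) ring_scheme \<Rightarrow> ('s, 's mat2) module" where
  "Mat2 S =
     \<lparr>carrier = carrier S \<times> carrier S \<times> carrier S \<times> carrier S,
      monoid.mult = (\<lambda>(a, b, c, d) (a', b', c', d').
        ((a \<otimes>\<^bsub>S\<^esub> a') \<oplus>\<^bsub>S\<^esub> (b \<otimes>\<^bsub>S\<^esub> c'), (a \<otimes>\<^bsub>S\<^esub> b') \<oplus>\<^bsub>S\<^esub> (b \<otimes>\<^bsub>S\<^esub> d'),
         (c \<otimes>\<^bsub>S\<^esub> a') \<oplus>\<^bsub>S\<^esub> (d \<otimes>\<^bsub>S\<^esub> c'), (c \<otimes>\<^bsub>S\<^esub> b') \<oplus>\<^bsub>S\<^esub> (d \<otimes>\<^bsub>S\<^esub> d'))),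
      one = (\<one>\<^bsub>S\<^esub>, \<zero>\<^bsub>S\<^esub>, \<zero>\<^bsub>S\<^esub>, \<one>\<^bsub>S\<^esub>),
      ring.zero = (\<zero>\<^bsub>S\<^esub>, \<zero>\<^bsub>S\<^esub>, \<zero>\<^bsub>S\<^esub>, \<zero>\<^bsub>S\<^esub>),
      add = (\<lambda>(a, b, c, d) (a', b', c', d').
        (a \<oplus>\<^bsub>S\<^esub> a', b \<oplus>\<^bsub>S\<^esub> b', c \<oplus>\<^bsub>S\<^esub> c', d \<oplus>\<^bsub>S\<^esub> d')),
      module.smult = (\<lambda>s (a, b, c, d). (s \<otimes>\<^bsub>S\<^esub> a, s \<otimes>\<^bsub>S\<^esub> b, s \<otimes>\<^bsub>S\<^esub> c, s \<otimes>\<^bsub>S\<^esub> d))\<rparr>"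

definition det2 :: "('s, 'm) ring_scheme \<Rightarrow> 's mat2 \<Rightarrow> 's" where
  "det2 S = (\<lambda>(a, b, c, d). (a \<otimes>\<^bsub>S\<^esub> d) \<ominus>\<^bsub>S\<^esub> (b \<otimes>\<^bsub>S\<^esub> c))"

definition map_mat2 :: "('s \<Rightarrow> 't) \<Rightarrow> 's mat2 \<Rightarrow> 't mat2" where
  "map_mat2 f = (\<lambda>(a, b, c, d). (f a, f b, f c, f d))"

abbreviation GL2 :: "('s, 'm) ring_scheme \<Rightarrow> 's mat2 monoid" where
  "GL2 S \<equiv> units_of (Mat2 S)"

definition scalars2 :: "('s, 'm) ring_scheme \<Rightarrow> 's mat2 set" where
  "scalars2 S = (\<lambda>c. c \<odot>\<^bsub>Mat2 S\<^esub> \<one>\<^bsub>Mat2 S\<^esub>) ` Units S"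

definition PGL2 :: "('s, 'm) ring_scheme \<Rightarrow> 's mat2 set monoid" where
  "PGL2 S = GL2 S Mod scalars2 S"

text \<open>
  The functor \<open>S \<mapsto> PGL2 S\<close> is not a Zariski sheaf: a nontrivial invertible module \<open>I\<close> with
  \<open>I \<oplus> I\<close> free of rank two gives local sections that agree on overlaps but do not glue.  So this
  functor is not representable, and the affine group scheme \<open>GL\<^sub>2 / G\<^sub>m\<close> is the Zariski sheaf
  associated with it.  The points of this sheaf have a description without
  glueing data: a coset \<open>g S\<^sup>\<times>\<close> is determined by, and determines, the submodule \<open>S g\<close> of
  the matrices, and submodules do glue.  Hence an \<open>S\<close>-point is a submodule of the matrices
  which is Zariski locally of the form \<open>S g\<close> with \<open>g\<close> invertible, and the product of cosets
  becomes the product of submodules.  See \<open>PGL2_embeds\<close> and \<open>PGL2_iso_local_ring\<close> below for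
  the comparison with \<^const>\<open>PGL2\<close>.

  Localisation at \<open>f\<close> is spelt out by multiplying with powers of \<open>f\<close>: a generator over \<open>S\<^sub>f\<close> can
  be scaled to lie in the submodule, it is invertible over \<open>S\<^sub>f\<close> iff its determinant divides
  a power of \<open>f\<close>, and it generates over \<open>S\<^sub>f\<close> iff every \<open>h\<close> in the submodule has a
  multiple \<open>f\<^sup>n h\<close> that is a multiple of it.
\<close>

definition generated_over_localisation ::
    "('s, 'm) ring_scheme \<Rightarrow> 's mat2 set \<Rightarrow> 's \<Rightarrow> 's mat2 \<Rightarrow> bool" where
  "generated_over_localisation S L f g \<longleftrightarrow>
     (\<exists>n::nat. det2 S g divides\<^bsub>S\<^esub> f [^]\<^bsub>S\<^esub> n) \<and>
     (\<forall>h\<in>L. \<exists>n::nat. \<exists>s\<in>carrier S. (f [^]\<^bsub>S\<^esub> n) \<odot>\<^bsub>Mat2 S\<^esub> h = s \<odot>\<^bsub>Mat2 S\<^esub> g)"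

definition PGL2_points :: "('s, 'm) ring_scheme \<Rightarrow> 's mat2 set set" where
  "PGL2_points S =
     {L. submodule L S (Mat2 S) \<and>
         (\<exists>F. finite F \<and> F \<subseteq> carrier S \<and> genideal S F = carrier S \<and>
              (\<forall>f\<in>F. \<exists>g\<in>L. generated_over_localisation S L f g))}"

definition span2 :: "('s, 'm) ring_scheme \<Rightarrow> 's mat2 set \<Rightarrow> 's mat2 set" where
  "span2 S A = \<Inter> {N. submodule N S (Mat2 S) \<and> A \<subseteq> N}"

definition PGL2_sheaf :: "('s, 'm) ring_scheme \<Rightarrow> 's mat2 set monoid" where
  "PGL2_sheaf S =
     \<lparr>carrier = PGL2_points S,
      monoid.mult = (\<lambda>L L'. span2 S (set_mult (Mat2 S) L L')),
      one = span2 S {\<one>\<^bsub>Mat2 S\<^esub>}\<rparr>"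

context cring
begin

lemma Mat2_ring: "ring (Mat2 R)"
proof (rule ringI)
  show "abelian_group (Mat2 R)"
    by (rule abelian_groupI) (auto simp: Mat2_def a_ac)
  show "Group.monoid (Mat2 R)"
    by (rule monoidI) (auto simp: Mat2_def l_distr r_distr m_assoc a_ac)
qed (auto simp: Mat2_def l_distr r_distr a_ac)

lemma Mat2_module: "module R (Mat2 R)"
  by (rule moduleI)
    (auto simp: Mat2_def l_distr r_distr m_assoc is_cring 
      intro: ring.is_abelian_group[OF Mat2_ring, unfolded Mat2_def])

lemma Mat2_smult:
  assumes "c \<in> carrier R" "g \<in> carrier (Mat2 R)" "h \<in> carrier (Mat2 R)"
  shows "(c \<odot>\<^bsub>Mat2 R\<^esub> g) \<otimes>\<^bsub>Mat2 R\<^esub> h = c \<odot>\<^bsub>Mat2 R\<^esub> (g \<otimes>\<^bsub>Mat2 R\<^esub> h)"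
    and "g \<otimes>\<^bsub>Mat2 R\<^esub> (c \<odot>\<^bsub>Mat2 R\<^esub> h) = c \<odot>\<^bsub>Mat2 R\<^esub> (g \<otimes>\<^bsub>Mat2 R\<^esub> h)"
  using assms by (auto simp: Mat2_def r_distr m_ac)

lemma det2_mult:
  assumes "g \<in> carrier (Mat2 R)" "h \<in> carrier (Mat2 R)"
  shows "det2 R (g \<otimes>\<^bsub>Mat2 R\<^esub> h) = det2 R g \<otimes> det2 R h"
  using assms
  apply (auto simp: Mat2_def det2_def)
  apply algebra
  done

lemma det2_closed: "g \<in> carrier (Mat2 R) \<Longrightarrow> det2 R g \<in> carrier R"
  by (auto simp: Mat2_def det2_def)

lemma Mat2_Units_iff: "g \<in> Units (Mat2 R) \<longleftrightarrow> g \<in> carrier (Mat2 R) \<and> det2 R g \<in> Units R"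
proof
  assume g: "g \<in> Units (Mat2 R)"
  then obtain h where gh: "g \<in> carrier (Mat2 R)" "h \<in> carrier (Mat2 R)"
    "g \<otimes>\<^bsub>Mat2 R\<^esub> h = \<one>\<^bsub>Mat2 R\<^esub>" unfolding Units_def by blast
  have "det2 R g \<otimes> det2 R h = \<one>"
    using det2_mult[OF gh(1,2)] gh(3) by (auto simp: det2_def Mat2_def a_minus_def)
  with gh show "g \<in> carrier (Mat2 R) \<and> det2 R g \<in> Units R"
    by (metis det2_closed Units_one_closed unit_factor)
next
  assume "g \<in> carrier (Mat2 R) \<and> det2 R g \<in> Units R"
  then obtain a b c d where g: "g = (a, b, c, d)" "a \<in> carrier R" "b \<in> carrier R"
    "c \<in> carrier R" "d \<in> carrier R" and u: "a \<otimes> d \<ominus> b \<otimes> c \<in> Units R"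
    by (auto simp: Mat2_def det2_def)
  define e where "e = inv (a \<otimes> d \<ominus> b \<otimes> c)"
  have e: "e \<in> carrier R" "e \<otimes> (a \<otimes> d \<ominus> b \<otimes> c) = \<one>"
    using u by (auto simp: e_def)
  define h where "h = (e \<otimes> d, \<ominus> (e \<otimes> b), \<ominus> (e \<otimes> c), e \<otimes> a)"
  have 1: "h \<in> carrier (Mat2 R)" using g e by (auto simp: h_def Mat2_def)
  have "a \<otimes> (e \<otimes> d) \<oplus> b \<otimes> \<ominus> (e \<otimes> c) = e \<otimes> (a \<otimes> d \<ominus> b \<otimes> c)"
    "a \<otimes> \<ominus> (e \<otimes> b) \<oplus> b \<otimes> (e \<otimes> a) = \<zero>"
    "c \<otimes> (e \<otimes> d) \<oplus> d \<otimes> \<ominus> (e \<otimes> c) = \<zero>"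
    "c \<otimes> \<ominus> (e \<otimes> b) \<oplus> d \<otimes> (e \<otimes> a) = e \<otimes> (a \<otimes> d \<ominus> b \<otimes> c)"
    "e \<otimes> d \<otimes> a \<oplus> \<ominus> (e \<otimes> b) \<otimes> c = e \<otimes> (a \<otimes> d \<ominus> b \<otimes> c)"
    "e \<otimes> d \<otimes> b \<oplus> \<ominus> (e \<otimes> b) \<otimes> d = \<zero>"
    "\<ominus> (e \<otimes> c) \<otimes> a \<oplus> e \<otimes> a \<otimes> c = \<zero>"
    "\<ominus> (e \<otimes> c) \<otimes> b \<oplus> e \<otimes> a \<otimes> d = e \<otimes> (a \<otimes> d \<ominus> b \<otimes> c)"
    using g(2-5) e(1) by algebra+
  then have "g \<otimes>\<^bsub>Mat2 R\<^esub> h = \<one>\<^bsub>Mat2 R\<^esub>" "h \<otimes>\<^bsub>Mat2 R\<^esub> g = \<one>\<^bsub>Mat2 R\<^esub>"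
    using e(2) by (auto simp: Mat2_def g(1) h_def)
  with 1 g show "g \<in> Units (Mat2 R)" unfolding Units_def by (auto simp: Mat2_def)
qed

lemma span2_single:
  assumes "g \<in> carrier (Mat2 R)"
  shows "span2 R {g} = (\<lambda>s. s \<odot>\<^bsub>Mat2 R\<^esub> g) ` carrier R"
    and "submodule ((\<lambda>s. s \<odot>\<^bsub>Mat2 R\<^esub> g) ` carrier R) R (Mat2 R)"
proof -
  interpret M: module R "Mat2 R" by (rule Mat2_module)
  show sub: "submodule ((\<lambda>s. s \<odot>\<^bsub>Mat2 R\<^esub> g) ` carrier R) R (Mat2 R)"
  proof (rule M.submoduleI)
    let ?I = "(\<lambda>s. s \<odot>\<^bsub>Mat2 R\<^esub> g) ` carrier R"
    show "\<zero>\<^bsub>Mat2 R\<^esub> \<in> ?I"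
      using assms by (intro image_eqI[of _ _ \<zero>]) auto
    show "\<ominus>\<^bsub>Mat2 R\<^esub> x \<in> ?I" if "x \<in> ?I" for x
    proof -
      from that obtain s where "s \<in> carrier R" "x = s \<odot>\<^bsub>Mat2 R\<^esub> g" by blast
      with assms show ?thesis
        by (intro image_eqI[of _ _ "\<ominus> s"]) (auto simp: M.smult_l_minus)
    qed
    show "x \<oplus>\<^bsub>Mat2 R\<^esub> y \<in> ?I" if "x \<in> ?I" "y \<in> ?I" for x y
    proof -
      from that obtain s t where "s \<in> carrier R" "x = s \<odot>\<^bsub>Mat2 R\<^esub> g"
        "t \<in> carrier R" "y = t \<odot>\<^bsub>Mat2 R\<^esub> g" by blast
      with assms show ?thesis
        by (intro image_eqI[of _ _ "s \<oplus> t"]) (auto simp: M.smult_l_distr)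
    qed
    show "r \<odot>\<^bsub>Mat2 R\<^esub> x \<in> ?I" if "r \<in> carrier R" "x \<in> ?I" for r x
    proof -
      from that obtain s where "s \<in> carrier R" "x = s \<odot>\<^bsub>Mat2 R\<^esub> g" by blast
      with that(1) assms show ?thesis
        by (intro image_eqI[of _ _ "r \<otimes> s"]) (auto simp: M.smult_assoc1)
    qed
  qed (use assms in auto)
  have "g \<in> (\<lambda>s. s \<odot>\<^bsub>Mat2 R\<^esub> g) ` carrier R"
    using assms by (intro image_eqI[of _ _ \<one>]) auto
  with sub show "span2 R {g} = (\<lambda>s. s \<odot>\<^bsub>Mat2 R\<^esub> g) ` carrier R"
    unfolding span2_def by (blast intro: submodule.smult_closed)
qed


lemma Mat2_Units_smult:
  assumes "c \<in> Units R" "g \<in> Units (Mat2 R)"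
  shows "c \<odot>\<^bsub>Mat2 R\<^esub> g \<in> Units (Mat2 R)"
proof -
  obtain x y z w where g: "g = (x, y, z, w)" "x \<in> carrier R" "y \<in> carrier R"
    "z \<in> carrier R" "w \<in> carrier R" and u: "x \<otimes> w \<ominus> y \<otimes> z \<in> Units R"
    using assms(2) unfolding Mat2_Units_iff by (auto simp: Mat2_def det2_def)
  have c: "c \<in> carrier R" using assms(1) by auto
  have "c \<otimes> x \<otimes> (c \<otimes> w) \<ominus> c \<otimes> y \<otimes> (c \<otimes> z) = c \<otimes> c \<otimes> (x \<otimes> w \<ominus> y \<otimes> z)"
    using g(2-5) c by algebra
  also have "\<dots> \<in> Units R" using assms(1) u by auto
  finally show ?thesis
    unfolding Mat2_Units_iff using g c by (auto simp: Mat2_def det2_def)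
qed

lemma scalars2_coset:
  assumes "g \<in> Units (Mat2 R)"
  shows "scalars2 R #>\<^bsub>GL2 R\<^esub> g = (\<lambda>c. c \<odot>\<^bsub>Mat2 R\<^esub> g) ` Units R"
proof -
  interpret Mt: ring "Mat2 R" by (rule Mat2_ring)
  have g: "g \<in> carrier (Mat2 R)" using assms by auto
  have "(c \<odot>\<^bsub>Mat2 R\<^esub> \<one>\<^bsub>Mat2 R\<^esub>) \<otimes>\<^bsub>Mat2 R\<^esub> g = c \<odot>\<^bsub>Mat2 R\<^esub> g" if "c \<in> Units R" for c
    using that g Mat2_smult(1)[of c "\<one>\<^bsub>Mat2 R\<^esub>" g] by auto
  then show ?thesis
    by (force simp: r_coset_def scalars2_def units_of_mult)
qed

lemma scalars2_normal: "scalars2 R \<lhd> GL2 R"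
proof -
  interpret Mt: ring "Mat2 R" by (rule Mat2_ring)
  interpret M: module R "Mat2 R" by (rule Mat2_module)
  interpret G: group "GL2 R" by (rule Mt.units_group)
  have inv1: "inv\<^bsub>GL2 R\<^esub> (c \<odot>\<^bsub>Mat2 R\<^esub> \<one>\<^bsub>Mat2 R\<^esub>) = (inv c) \<odot>\<^bsub>Mat2 R\<^esub> \<one>\<^bsub>Mat2 R\<^esub>"
    if c: "c \<in> Units R" for c
  proof (rule G.inv_equality)
    show "(inv c \<odot>\<^bsub>Mat2 R\<^esub> \<one>\<^bsub>Mat2 R\<^esub>) \<otimes>\<^bsub>GL2 R\<^esub> (c \<odot>\<^bsub>Mat2 R\<^esub> \<one>\<^bsub>Mat2 R\<^esub>) = \<one>\<^bsub>GL2 R\<^esub>"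
      using c Mat2_smult(1)[of "inv c" "\<one>\<^bsub>Mat2 R\<^esub>" "c \<odot>\<^bsub>Mat2 R\<^esub> \<one>\<^bsub>Mat2 R\<^esub>"]
        M.smult_assoc1[of "inv c" c "\<one>\<^bsub>Mat2 R\<^esub>"]
      by (simp add: units_of_mult units_of_one Units_closed)
  qed (use c Mat2_Units_smult in \<open>auto simp: units_of_carrier\<close>)
  have "subgroup (scalars2 R) (GL2 R)"
  proof (rule G.subgroupI)
    show "scalars2 R \<subseteq> carrier (GL2 R)"
      using Mat2_Units_smult[OF _ Mt.Units_one_closed] unfolding scalars2_def units_of_carrier
      by blast
    show "scalars2 R \<noteq> {}" by (auto simp: scalars2_def)
    show "inv\<^bsub>GL2 R\<^esub> x \<in> scalars2 R" if "x \<in> scalars2 R" for x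
      using that inv1 by (auto simp: scalars2_def)
    show "x \<otimes>\<^bsub>GL2 R\<^esub> y \<in> scalars2 R" if xy: "x \<in> scalars2 R" "y \<in> scalars2 R" for x y
    proof -
      from xy obtain c d where cd: "c \<in> Units R" "d \<in> Units R" "x = c \<odot>\<^bsub>Mat2 R\<^esub> \<one>\<^bsub>Mat2 R\<^esub>"
        "y = d \<odot>\<^bsub>Mat2 R\<^esub> \<one>\<^bsub>Mat2 R\<^esub>" by (auto simp: scalars2_def)
      then have "x \<otimes>\<^bsub>GL2 R\<^esub> y = (c \<otimes> d) \<odot>\<^bsub>Mat2 R\<^esub> \<one>\<^bsub>Mat2 R\<^esub>"
        by (simp add: units_of_mult Mat2_smult(1) Units_closed M.smult_assoc1)
      with cd show ?thesis by (auto simp: scalars2_def)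
    qed
  qed
  moreover have "x \<otimes>\<^bsub>GL2 R\<^esub> h \<otimes>\<^bsub>GL2 R\<^esub> inv\<^bsub>GL2 R\<^esub> x \<in> scalars2 R"
    if x: "x \<in> carrier (GL2 R)" and h: "h \<in> scalars2 R" for x h
  proof -
    from h obtain c where c: "c \<in> Units R" "h = c \<odot>\<^bsub>Mat2 R\<^esub> \<one>\<^bsub>Mat2 R\<^esub>"
      by (auto simp: scalars2_def)
    have xc: "x \<in> carrier (Mat2 R)" using x by (auto simp: units_of_carrier)
    have "x \<otimes>\<^bsub>GL2 R\<^esub> h = h \<otimes>\<^bsub>GL2 R\<^esub> x"
      using c xc by (simp add: units_of_mult Mat2_smult Units_closed)
    moreover have "h \<in> carrier (GL2 R)"
      using c Mat2_Units_smult by (auto simp: units_of_carrier)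
    ultimately show ?thesis using x h by (simp add: G.m_assoc)
  qed
  ultimately show ?thesis by (auto simp: G.normal_inv_iff)
qed

lemma span2_scalars2_coset:
  assumes "g \<in> Units (Mat2 R)"
  shows "span2 R (scalars2 R #>\<^bsub>GL2 R\<^esub> g) = span2 R {g}"
proof -
  interpret Mt: ring "Mat2 R" by (rule Mat2_ring)
  interpret M: module R "Mat2 R" by (rule Mat2_module)
  have g: "g \<in> carrier (Mat2 R)" using assms by auto
  have "scalars2 R #>\<^bsub>GL2 R\<^esub> g \<subseteq> N \<longleftrightarrow> {g} \<subseteq> N" if N: "submodule N R (Mat2 R)" for N
  proof
    assume *: "scalars2 R #>\<^bsub>GL2 R\<^esub> g \<subseteq> N"
    have "\<one> \<odot>\<^bsub>Mat2 R\<^esub> g \<in> N" using * by (auto simp: scalars2_coset[OF assms])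
    with g show "{g} \<subseteq> N" by simp
  next
    assume "{g} \<subseteq> N"
    then show "scalars2 R #>\<^bsub>GL2 R\<^esub> g \<subseteq> N"
      using submodule.smult_closed[OF N] unfolding scalars2_coset[OF assms]
      by (blast dest: Units_closed)
  qed
  then show ?thesis unfolding span2_def by (metis (no_types, lifting))
qed

lemma span2_mult:
  assumes "g \<in> carrier (Mat2 R)" "h \<in> carrier (Mat2 R)"
  shows "span2 R (set_mult (Mat2 R) (span2 R {g}) (span2 R {h})) = span2 R {g \<otimes>\<^bsub>Mat2 R\<^esub> h}"
proof -
  interpret Mt: ring "Mat2 R" by (rule Mat2_ring)
  interpret M: module R "Mat2 R" by (rule Mat2_module)
  let ?P = "set_mult (Mat2 R) (span2 R {g}) (span2 R {h})"
  have sp: "(s \<odot>\<^bsub>Mat2 R\<^esub> g) \<otimes>\<^bsub>Mat2 R\<^esub> (t \<odot>\<^bsub>Mat2 R\<^esub> h) =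
      (s \<otimes> t) \<odot>\<^bsub>Mat2 R\<^esub> (g \<otimes>\<^bsub>Mat2 R\<^esub> h)" if "s \<in> carrier R" "t \<in> carrier R" for s t
    using that assms Mat2_smult(1)[of s g "t \<odot>\<^bsub>Mat2 R\<^esub> h"] Mat2_smult(2)[of t g h]
      M.smult_assoc1[of s t] by simp
  have gh: "g \<in> span2 R {g}" "h \<in> span2 R {h}" by (auto simp: span2_def)
  have "?P \<subseteq> N \<longleftrightarrow> {g \<otimes>\<^bsub>Mat2 R\<^esub> h} \<subseteq> N" if N: "submodule N R (Mat2 R)" for N
  proof
    assume "?P \<subseteq> N" with gh show "{g \<otimes>\<^bsub>Mat2 R\<^esub> h} \<subseteq> N" by (auto simp: set_mult_def)
  next
    assume "{g \<otimes>\<^bsub>Mat2 R\<^esub> h} \<subseteq> N"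
    moreover have "\<exists>r\<in>carrier R. z = r \<odot>\<^bsub>Mat2 R\<^esub> (g \<otimes>\<^bsub>Mat2 R\<^esub> h)" if "z \<in> ?P" for z
      using that sp m_closed unfolding set_mult_def span2_single(1)[OF assms(1)]
        span2_single(1)[OF assms(2)] by blast
    ultimately show "?P \<subseteq> N"
      using submodule.smult_closed[OF N] by blast
  qed
  then show ?thesis unfolding span2_def by (metis (no_types, lifting))
qed

lemma span2_single_eqD:
  assumes g: "g \<in> Units (Mat2 R)" and h: "h \<in> Units (Mat2 R)" and eq: "span2 R {g} = span2 R {h}"
  shows "\<exists>c\<in>Units R. g = c \<odot>\<^bsub>Mat2 R\<^esub> h"
proof -
  interpret Mt: ring "Mat2 R" by (rule Mat2_ring)
  interpret M: module R "Mat2 R" by (rule Mat2_module)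
  have gh: "g \<in> carrier (Mat2 R)" "h \<in> carrier (Mat2 R)" using g h by auto
  have "x \<in> span2 R {x}" for x by (auto simp: span2_def)
  then have "g \<in> span2 R {h}" "h \<in> span2 R {g}" using eq by blast+
  then obtain s t where st: "s \<in> carrier R" "t \<in> carrier R" "g = s \<odot>\<^bsub>Mat2 R\<^esub> h"
    "h = t \<odot>\<^bsub>Mat2 R\<^esub> g"
    unfolding span2_single(1)[OF gh(1)] span2_single(1)[OF gh(2)] by blast
  have "(s \<otimes> t) \<odot>\<^bsub>Mat2 R\<^esub> g = s \<odot>\<^bsub>Mat2 R\<^esub> (t \<odot>\<^bsub>Mat2 R\<^esub> g)"
    using st(1,2) gh(1) by (rule M.smult_assoc1)
  also have "\<dots> = g" by (subst st(4)[symmetric]) (rule st(3)[symmetric])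
  finally have "(s \<otimes> t) \<odot>\<^bsub>Mat2 R\<^esub> g = g" .
  then have "((s \<otimes> t) \<odot>\<^bsub>Mat2 R\<^esub> g) \<otimes>\<^bsub>Mat2 R\<^esub> inv\<^bsub>Mat2 R\<^esub> g = \<one>\<^bsub>Mat2 R\<^esub>" using g by simp
  then have "(s \<otimes> t) \<odot>\<^bsub>Mat2 R\<^esub> \<one>\<^bsub>Mat2 R\<^esub> = \<one>\<^bsub>Mat2 R\<^esub>"
    using g gh(1) st(1,2) by (simp add: Mat2_smult)
  then have "s \<otimes> t = \<one>" using st(1,2) by (simp add: Mat2_def)
  then have "s \<in> Units R" using st(1,2) Units_one_closed unit_factor by metis
  with st(3) show ?thesis by blast
qed

lemma span2_in_points:
  assumes "g \<in> Units (Mat2 R)"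
  shows "span2 R {g} \<in> PGL2_points R"
proof -
  interpret Mt: ring "Mat2 R" by (rule Mat2_ring)
  interpret M: module R "Mat2 R" by (rule Mat2_module)
  have g: "g \<in> carrier (Mat2 R)" using assms by auto
  have "det2 R g \<in> Units R" using assms by (simp add: Mat2_Units_iff)
  then have "det2 R g divides\<^bsub>R\<^esub> \<one> [^] (0::nat)"
    by (auto simp: factor_def intro!: bexI[of _ "inv (det2 R g)"])
  moreover have "\<forall>h\<in>span2 R {g}. \<exists>n::nat. \<exists>s\<in>carrier R.
      (\<one> [^] n) \<odot>\<^bsub>Mat2 R\<^esub> h = s \<odot>\<^bsub>Mat2 R\<^esub> g"
    using g by (auto simp: span2_single)
  ultimately have "generated_over_localisation R (span2 R {g}) \<one> g"
    unfolding generated_over_localisation_def by blast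
  moreover have "g \<in> span2 R {g}" by (auto simp: span2_def)
  ultimately have "\<forall>f\<in>{\<one>}. \<exists>g'\<in>span2 R {g}. generated_over_localisation R (span2 R {g}) f g'"
    by blast
  moreover have "submodule (span2 R {g}) R (Mat2 R)" using span2_single[OF g] by simp
  moreover have "finite {\<one>}" "{\<one>} \<subseteq> carrier R" by auto
  ultimately show ?thesis
    using genideal_one unfolding PGL2_points_def by blast
qed

lemma PGL2_embeds:
  shows "span2 R \<in> hom (PGL2 R) (PGL2_sheaf R)"
    and "inj_on (span2 R) (carrier (PGL2 R))"
    and "span2 R ` carrier (PGL2 R) = {span2 R {g} | g. g \<in> Units (Mat2 R)}"
proof -
  interpret Mt: ring "Mat2 R" by (rule Mat2_ring)
  interpret M: module R "Mat2 R" by (rule Mat2_module)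
  interpret G: group "GL2 R" by (rule Mt.units_group)
  interpret N: normal "scalars2 R" "GL2 R" by (rule scalars2_normal)
  have car: "carrier (PGL2 R) = {scalars2 R #>\<^bsub>GL2 R\<^esub> g | g. g \<in> Units (Mat2 R)}"
    by (auto simp: PGL2_def FactGroup_def RCOSETS_def units_of_carrier)
  show "span2 R ` carrier (PGL2 R) = {span2 R {g} | g. g \<in> Units (Mat2 R)}"
    unfolding car using span2_scalars2_coset by (auto simp: image_def) metis+
  show "inj_on (span2 R) (carrier (PGL2 R))"
  proof (rule inj_onI)
    fix C D assume "C \<in> carrier (PGL2 R)" "D \<in> carrier (PGL2 R)" and eq: "span2 R C = span2 R D"
    then obtain g h where gh: "g \<in> Units (Mat2 R)" "C = scalars2 R #>\<^bsub>GL2 R\<^esub> g"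
      "h \<in> Units (Mat2 R)" "D = scalars2 R #>\<^bsub>GL2 R\<^esub> h"
      unfolding car by blast
    with eq have "span2 R {g} = span2 R {h}" by (simp add: span2_scalars2_coset)
    from span2_single_eqD[OF gh(1,3) this] have "g \<in> D"
      using gh by (auto simp: scalars2_coset)
    then have "D = C"
      unfolding gh(2,4)
      by (rule G.repr_independence) (use gh N.subgroup_axioms in \<open>auto simp: units_of_carrier\<close>)
    then show "C = D" by simp
  qed
  show "span2 R \<in> hom (PGL2 R) (PGL2_sheaf R)"
  proof (rule homI)
    show "span2 R C \<in> carrier (PGL2_sheaf R)" if "C \<in> carrier (PGL2 R)" for C
      using that span2_in_points span2_scalars2_coset unfolding car
      by (auto simp: PGL2_sheaf_def)
    fix C D assume "C \<in> carrier (PGL2 R)" "D \<in> carrier (PGL2 R)"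
    then obtain g h where gh: "g \<in> Units (Mat2 R)" "C = scalars2 R #>\<^bsub>GL2 R\<^esub> g"
      "h \<in> Units (Mat2 R)" "D = scalars2 R #>\<^bsub>GL2 R\<^esub> h"
      unfolding car by blast
    have "C \<otimes>\<^bsub>PGL2 R\<^esub> D = scalars2 R #>\<^bsub>GL2 R\<^esub> (g \<otimes>\<^bsub>Mat2 R\<^esub> h)"
      using gh N.rcos_sum[of g h] by (simp add: PGL2_def FactGroup_def units_of_carrier units_of_mult)
    then show "span2 R (C \<otimes>\<^bsub>PGL2 R\<^esub> D) = span2 R C \<otimes>\<^bsub>PGL2_sheaf R\<^esub> span2 R D"
      using gh by (simp add: span2_scalars2_coset span2_mult PGL2_sheaf_def Mt.Units_closed)
  qed
qed

lemma PGL2_iso_local_ring: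
  assumes loc: "ideal (carrier R - Units R) R"
  shows "span2 R \<in> iso (PGL2 R) (PGL2_sheaf R)"
proof -
  interpret M: module R "Mat2 R" by (rule Mat2_module)
  have "L \<in> {span2 R {g} | g. g \<in> Units (Mat2 R)}" if L: "L \<in> PGL2_points R" for L
  proof -
    from L obtain F where sub: "submodule L R (Mat2 R)" and F: "F \<subseteq> carrier R"
      "genideal R F = carrier R" "\<forall>f\<in>F. \<exists>g\<in>L. generated_over_localisation R L f g"
      unfolding PGL2_points_def by blast
    have "\<not> F \<subseteq> carrier R - Units R"
    proof
      assume "F \<subseteq> carrier R - Units R"
      then have "genideal R F \<subseteq> carrier R - Units R" by (rule genideal_minimal[OF loc])
      with F(2) have "\<one> \<notin> Units R" by auto
      then show False by simp
    qed
    with F obtain f g where f: "f \<in> Units R" and g: "g \<in> L"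
      and gen: "generated_over_localisation R L f g" by blast
    have Lc: "L \<subseteq> carrier (Mat2 R)" using M.submoduleE(1)[OF sub] .
    with g have gc: "g \<in> carrier (Mat2 R)" by blast
    from gen obtain n :: nat and c where c: "c \<in> carrier R" "f [^] n = det2 R g \<otimes> c"
      unfolding generated_over_localisation_def factor_def by blast
    have "f [^] n \<in> Units R" for n :: nat using f by (induction n) auto
    note fn = this
    have "det2 R g \<in> Units R" using unit_factor fn[of n] c gc det2_closed by metis
    then have gu: "g \<in> Units (Mat2 R)" using gc by (simp add: Mat2_Units_iff)
    have "L = (\<lambda>s. s \<odot>\<^bsub>Mat2 R\<^esub> g) ` carrier R"
    proof
      show "(\<lambda>s. s \<odot>\<^bsub>Mat2 R\<^esub> g) ` carrier R \<subseteq> L"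
        using submodule.smult_closed[OF sub] g by blast
      show "L \<subseteq> (\<lambda>s. s \<odot>\<^bsub>Mat2 R\<^esub> g) ` carrier R"
      proof
        fix h assume h: "h \<in> L"
        then obtain n :: nat and s where s: "s \<in> carrier R"
          "(f [^] n) \<odot>\<^bsub>Mat2 R\<^esub> h = s \<odot>\<^bsub>Mat2 R\<^esub> g"
          using gen unfolding generated_over_localisation_def by blast
        have hc: "h \<in> carrier (Mat2 R)" using h Lc by blast
        have "h = (inv (f [^] n) \<otimes> f [^] n) \<odot>\<^bsub>Mat2 R\<^esub> h" using fn[of n] hc by simp
        also have "\<dots> = inv (f [^] n) \<odot>\<^bsub>Mat2 R\<^esub> ((f [^] n) \<odot>\<^bsub>Mat2 R\<^esub> h)"
          by (intro M.smult_assoc1) (use fn[of n] hc in auto)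
        also have "\<dots> = (inv (f [^] n) \<otimes> s) \<odot>\<^bsub>Mat2 R\<^esub> g"
          unfolding s(2) by (intro M.smult_assoc1[symmetric]) (use fn[of n] gc s in auto)
        finally show "h \<in> (\<lambda>s. s \<odot>\<^bsub>Mat2 R\<^esub> g) ` carrier R"
          using fn[of n] s by blast
      qed
    qed
    with gu gc show ?thesis using span2_single(1) by blast
  qed
  then have "carrier (PGL2_sheaf R) = span2 R ` carrier (PGL2 R)"
    using PGL2_embeds span2_in_points by (auto simp: PGL2_sheaf_def)
  then show ?thesis
    using PGL2_embeds(1,2) by (auto simp: iso_def bij_betw_def)
qed

end


section \<open>The constant group scheme of order two\<close>

text \<open>
  The algebra of functions on the group of order two, with idempotents \<open>(1,0)\<close> (identity)
  and \<open>(0,1)\<close>.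
\<close>

definition Z2_alg :: "('k, 'm) ring_scheme \<Rightarrow> ('k, 'k \<times> 'k) module" where
  "Z2_alg \<Phi> =
     \<lparr>carrier = carrier \<Phi> \<times> carrier \<Phi>,
      monoid.mult = (\<lambda>(x, y) (u, v). (x \<otimes>\<^bsub>\<Phi>\<^esub> u, y \<otimes>\<^bsub>\<Phi>\<^esub> v)),
      one = (\<one>\<^bsub>\<Phi>\<^esub>, \<one>\<^bsub>\<Phi>\<^esub>),
      ring.zero = (\<zero>\<^bsub>\<Phi>\<^esub>, \<zero>\<^bsub>\<Phi>\<^esub>),
      add = (\<lambda>(x, y) (u, v). (x \<oplus>\<^bsub>\<Phi>\<^esub> u, y \<oplus>\<^bsub>\<Phi>\<^esub> v)),
      module.smult = (\<lambda>c (x, y). (c \<otimes>\<^bsub>\<Phi>\<^esub> x, c \<otimes>\<^bsub>\<Phi>\<^esub> y))\<rparr>"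

text \<open>
  The product is convolution with respect to the comultiplication
  \<open>e\<^sub>0 \<mapsto> e\<^sub>0 \<otimes> e\<^sub>0 + e\<^sub>1 \<otimes> e\<^sub>1\<close>, \<open>e\<^sub>1 \<mapsto> e\<^sub>0 \<otimes> e\<^sub>1 + e\<^sub>1 \<otimes> e\<^sub>0\<close>,
  and the unit is the counit \<open>e\<^sub>0 \<mapsto> 1\<close>, \<open>e\<^sub>1 \<mapsto> 0\<close>, where \<open>e\<^sub>0 = (1,0)\<close> and \<open>e\<^sub>1 = (0,1)\<close>.
\<close>

definition Z2_points ::
    "('k, 'm) ring_scheme \<Rightarrow> ('k, 'r) module \<Rightarrow> ('k \<times> 'k \<Rightarrow> 'r) monoid" where
  "Z2_points \<Phi> R =
     (let e0 = (\<one>\<^bsub>\<Phi>\<^esub>, \<zero>\<^bsub>\<Phi>\<^esub>); e1 = (\<zero>\<^bsub>\<Phi>\<^esub>, \<one>\<^bsub>\<Phi>\<^esub>) in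
      \<lparr>carrier = alg_hom \<Phi> (Z2_alg \<Phi>) R \<inter> extensional (carrier (Z2_alg \<Phi>)),
       monoid.mult = (\<lambda>p q. \<lambda>z\<in>carrier (Z2_alg \<Phi>).
         (fst z \<odot>\<^bsub>R\<^esub> ((p e0 \<otimes>\<^bsub>R\<^esub> q e0) \<oplus>\<^bsub>R\<^esub> (p e1 \<otimes>\<^bsub>R\<^esub> q e1))) \<oplus>\<^bsub>R\<^esub>
         (snd z \<odot>\<^bsub>R\<^esub> ((p e0 \<otimes>\<^bsub>R\<^esub> q e1) \<oplus>\<^bsub>R\<^esub> (p e1 \<otimes>\<^bsub>R\<^esub> q e0)))),
       one = (\<lambda>z\<in>carrier (Z2_alg \<Phi>). fst z \<odot>\<^bsub>R\<^esub> \<one>\<^bsub>R\<^esub>)\<rparr>)"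

definition mu2 :: "('r, 'm) ring_scheme \<Rightarrow> 'r monoid" where
  "mu2 R = (units_of R)\<lparr>carrier := {x \<in> Units R. x \<otimes>\<^bsub>R\<^esub> x = \<one>\<^bsub>R\<^esub>}\<rparr>"

text \<open>The isomorphism from the points of the constant group scheme to \<^const>\<open>mu2\<close>.\<close>

definition Z2_sign ::
    "('k, 'm) ring_scheme \<Rightarrow> ('k, 'r) module \<Rightarrow> ('k \<times> 'k \<Rightarrow> 'r) \<Rightarrow> 'r" where
  "Z2_sign \<Phi> R p = p (\<one>\<^bsub>\<Phi>\<^esub>, \<zero>\<^bsub>\<Phi>\<^esub>) \<ominus>\<^bsub>R\<^esub> p (\<zero>\<^bsub>\<Phi>\<^esub>, \<one>\<^bsub>\<Phi>\<^esub>)"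


section \<open>Semidirect products\<close>

definition semidirect ::
    "('n, 'a) monoid_scheme \<Rightarrow> ('h, 'b) monoid_scheme \<Rightarrow> ('h \<Rightarrow> 'n \<Rightarrow> 'n) \<Rightarrow> ('n \<times> 'h) monoid" where
  "semidirect N H act =
     \<lparr>carrier = carrier N \<times> carrier H,
      monoid.mult = (\<lambda>(n, h) (n', h'). (n \<otimes>\<^bsub>N\<^esub> act h n', h \<otimes>\<^bsub>H\<^esub> h')),
      one = (\<one>\<^bsub>N\<^esub>, \<one>\<^bsub>H\<^esub>)\<rparr>"

definition PGL2_bar_Z2 ::
    "('k, 'm) ring_scheme \<Rightarrow> ('k, 'r, ('r \<times> 'r) mat2 set \<times> ('k \<times> 'k \<Rightarrow> 'r)) grp_functor" where
  "PGL2_bar_Z2 \<Phi> =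
     \<lparr>obj = (\<lambda>R. semidirect (PGL2_sheaf (bar R)) (Z2_points \<Phi> R)
               (\<lambda>p L. map_mat2 (bar_aut R (Z2_sign \<Phi> R p)) ` L)),
      mor = (\<lambda>R R' \<phi> (L, p).
               (span2 (bar R') (map_mat2 (map_prod \<phi> \<phi>) ` L),
                \<lambda>z\<in>carrier (Z2_alg \<Phi>). \<phi> (p z)))\<rparr>"


section \<open>The real case\<close>

definition minkowski :: "real^4^4" where
  "minkowski = (\<chi> i j. if i \<noteq> j then 0 else if i = 1 then 1 else - 1)"

definition o13 :: "(real, real^4^4) module" where
  "o13 =
     \<lparr>carrier = {A. transpose A ** minkowski + minkowski ** A = 0},
      monoid.mult = (\<lambda>A B. A ** B - B ** A),
      one = undefined,
      ring.zero = 0,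
      add = (+),
      module.smult = (*\<^sub>R)\<rparr>"

definition PGL2_complex_mu2_real :: "(complex mat2 set \<times> real) monoid" where
  "PGL2_complex_mu2_real =
     semidirect (PGL2 (ring_of_type_algebra :: complex ring)) (mu2 (ring_of_type_algebra :: real ring))
       (\<lambda>b C. map_mat2 (\<lambda>z. Complex (Re z) (b * Im z)) ` C)"

end

theory Submission
  imports Defs "HOL-Analysis.Cartesian_Space"
begin

text \<open>
  Put \<open>i = (0,1)\<close> and \<open>S = bar R\<close>.  Since \<open>i b\<^sub>1 = b\<^sub>6\<close>, \<open>i b\<^sub>2 = -b\<^sub>5\<close>, \<open>i b\<^sub>3 = b\<^sub>4\<close> makes the bracket
  \<open>S\<close>-bilinear, \<open>L\<^sub>R\<close> is the Lie algebra \<open>sl\<^sub>2(S)\<close> regarded over \<open>R\<close>.  An \<open>R\<close>-automorphism \<open>A\<close> of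
  \<open>sl\<^sub>2(S)\<close> acts on the centroid \<open>S\<close> by an \<open>R\<close>-automorphism \<open>\<tau>\<close>, that is \<open>i \<mapsto> b i\<close> with \<open>b\<^sup>2 = 1\<close>.
  The matrices \<open>g\<close> with \<open>A(V) g = g \<tau>(V)\<close> for all \<open>V\<close> form a submodule, and \<open>A\<close> corresponds to this
  submodule together with \<open>b\<close>.

  With \<open>e = A(E)\<close> and \<open>f = A(F)\<close> the Lie relations force \<open>e\<^sup>2 = f\<^sup>2 = 0\<close> and \<open>e f + f e = 1\<close>.  Hence
  \<open>e f m E F + f m E\<close> is an intertwiner for every matrix \<open>m\<close>; for \<open>m = 1\<close> and \<open>m = F\<close> the determinants
  are entries of \<open>f\<close> that generate the unit ideal.  Since \<open>adj(g) h\<close> is scalar for two intertwiners,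
  \<open>g\<close> generates the submodule where \<open>det g\<close> is invertible.  Conversely \<open>V \<mapsto> g V g\<^sup>-\<^sup>1\<close> is glued
  without localising: the scalars \<open>r\<close> for which some \<open>W\<close> satisfies \<open>W g = r g V\<close> for all \<open>g\<close> of a given
  point form an ideal, which contains every \<open>det g\<close>.
\<close>

section \<open>Traceless matrices\<close>

text \<open>A point need not have a global generator, so no conjugating matrix can be chosen. The
  substitute for localisation is one pattern: the scalars that make a claim true after
  multiplication form an ideal, adjugates put each determinant into it, and
  \<open>dets_generate\<close> yields 1. Its main consequence is the maximality criterion
  \<open>submodule_eq_intertwiners\<close>, which settles surjectivity, the identity, products and
  base change alike. If V V = q and V W + W V = p, then [V,[V,W]] = 4 q W - 2 p V. For V = e, W = f
  the left side is -2 e, and e, f are independent; hence q = 0 and p = 1. By the resulting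
  relations, e f and f are the matrix units e_11 and e_21 of a full system, and the intertwiner
  built from m is the averaging sum of e_i1 m E_1i, as in the proof of the Skolem-Noether theorem.
  Placing \<tau> to the right of \<open>g\<close> makes intertwiners multiply as g \<tau>(h), the
  rule of the semidirect product. Group and functor laws on the matrix side are transported along
  the bijection instead of being verified on spans of submodules.\<close>

abbreviation mat2_mult (infixl "\<boxtimes>\<index>" 70) where
  "g \<boxtimes>\<^bsub>S\<^esub> h \<equiv> g \<otimes>\<^bsub>Mat2 S\<^esub> h"

abbreviation mat2_add (infixl "\<boxplus>\<index>" 65) where
  "g \<boxplus>\<^bsub>S\<^esub> h \<equiv> g \<oplus>\<^bsub>Mat2 S\<^esub> h"

abbreviation mat2_smult (infixl "\<boxdot>\<index>" 70) where
  "g \<boxdot>\<^bsub>S\<^esub> h \<equiv> g \<odot>\<^bsub>Mat2 S\<^esub> h"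

abbreviation mat2_uminus ("\<boxminus>\<index> _" [81] 80) where
  "\<boxminus>\<^bsub>S\<^esub> g \<equiv> \<ominus>\<^bsub>Mat2 S\<^esub> g"

definition sl2 :: "('s, 'm) ring_scheme \<Rightarrow> 's mat2 set" where
  "sl2 S = {(a, b, c, \<ominus>\<^bsub>S\<^esub> a) | a b c. a \<in> carrier S \<and> b \<in> carrier S \<and> c \<in> carrier S}"

definition comm2 :: "('s, 'm) ring_scheme \<Rightarrow> 's mat2 \<Rightarrow> 's mat2 \<Rightarrow> 's mat2" where
  "comm2 S U V = (U \<boxtimes>\<^bsub>S\<^esub> V) \<ominus>\<^bsub>Mat2 S\<^esub> (V \<boxtimes>\<^bsub>S\<^esub> U)"

definition adj2 :: "('s, 'm) ring_scheme \<Rightarrow> 's mat2 \<Rightarrow> 's mat2" where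
  "adj2 S = (\<lambda>(a, b, c, d). (d, \<ominus>\<^bsub>S\<^esub> b, \<ominus>\<^bsub>S\<^esub> c, a))"

definition matE :: "('s, 'm) ring_scheme \<Rightarrow> 's mat2" where
  "matE S = (\<zero>\<^bsub>S\<^esub>, \<one>\<^bsub>S\<^esub>, \<zero>\<^bsub>S\<^esub>, \<zero>\<^bsub>S\<^esub>)"

definition matF :: "('s, 'm) ring_scheme \<Rightarrow> 's mat2" where
  "matF S = (\<zero>\<^bsub>S\<^esub>, \<zero>\<^bsub>S\<^esub>, \<one>\<^bsub>S\<^esub>, \<zero>\<^bsub>S\<^esub>)"

definition matH :: "('s, 'm) ring_scheme \<Rightarrow> 's mat2" where
  "matH S = (\<one>\<^bsub>S\<^esub>, \<zero>\<^bsub>S\<^esub>, \<zero>\<^bsub>S\<^esub>, \<ominus>\<^bsub>S\<^esub> \<one>\<^bsub>S\<^esub>)"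

text \<open>\<tau> records the action on the centroid. With semilinearity explicit, the Lie algebra
  can be handled over \<open>S\<close> itself, and the smaller ring over which an automorphism was
  linear disappears from the argument.\<close>

definition sl2_semi :: "('s, 'm) ring_scheme \<Rightarrow> ('s \<Rightarrow> 's) \<Rightarrow> ('s mat2 \<Rightarrow> 's mat2) \<Rightarrow> bool" where
  "sl2_semi S \<tau> A \<longleftrightarrow>
     bij_betw A (sl2 S) (sl2 S) \<and>
     (\<forall>U\<in>sl2 S. \<forall>V\<in>sl2 S. A (U \<boxplus>\<^bsub>S\<^esub> V) = A U \<boxplus>\<^bsub>S\<^esub> A V) \<and>
     (\<forall>s\<in>carrier S. \<forall>U\<in>sl2 S. A (s \<boxdot>\<^bsub>S\<^esub> U) = \<tau> s \<boxdot>\<^bsub>S\<^esub> A U) \<and>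
     (\<forall>U\<in>sl2 S. \<forall>V\<in>sl2 S. A (comm2 S U V) = comm2 S (A U) (A V))"

text \<open>The twist makes both sides \<tau>-semilinear in \<open>U\<close>, so the condition
  respects scalars. If a unit \<open>g\<close> satisfies it, then A(U) = g \<tau>(U) g^-1, and for
  semilinear automorphisms the whole set is \<open>S g\<close>.\<close>

definition intertwiners ::
    "('s, 'm) ring_scheme \<Rightarrow> ('s \<Rightarrow> 's) \<Rightarrow> ('s mat2 \<Rightarrow> 's mat2) \<Rightarrow> 's mat2 set" where
  "intertwiners S \<tau> A =
     {g \<in> carrier (Mat2 S). \<forall>U\<in>sl2 S. A U \<boxtimes>\<^bsub>S\<^esub> g = g \<boxtimes>\<^bsub>S\<^esub> map_mat2 \<tau> U}"

text \<open>Says that the determinants generate the unit ideal. It is phrased as a test against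
  ideals because each use exhibits an ideal containing all determinants and concludes that it
  contains 1.\<close>

definition dets_generate :: "('s, 'm) ring_scheme \<Rightarrow> 's mat2 set \<Rightarrow> bool" where
  "dets_generate S L \<longleftrightarrow> (\<forall>I. ideal I S \<longrightarrow> det2 S ` L \<subseteq> I \<longrightarrow> I = carrier S)"

section \<open>Commutative rings in which 2 is invertible\<close>

locale half_cring = cring R for R (structure) +
  assumes two_unit: "\<one> \<oplus> \<one> \<in> Units R"

sublocale half_cring \<subseteq> Mt: ring "Mat2 R"
  by (rule Mat2_ring)

sublocale half_cring \<subseteq> Md: module R "Mat2 R"
  by (rule Mat2_module)

context half_cring
begin

definition half where "half = inv (\<one> \<oplus> \<one>)"

lemma half_closed [simp, intro]: "half \<in> carrier R"
  using two_unit by (simp add: half_def)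

lemma half_sum: "half \<oplus> half = \<one>"
proof -
  have "half \<oplus> half = half \<otimes> (\<one> \<oplus> \<one>)" by (simp add: r_distr)
  then show ?thesis using two_unit by (simp add: half_def)
qed

lemma half_double: "x \<in> carrier R \<Longrightarrow> half \<otimes> (x \<oplus> x) = x"
  by (simp add: r_distr l_distr[symmetric] half_sum)

lemma double_eq_iff: "x \<in> carrier R \<Longrightarrow> y \<in> carrier R \<Longrightarrow> x \<oplus> x = y \<oplus> y \<longleftrightarrow> x = y"
  by (metis half_double)

lemma double_zero: "x \<in> carrier R \<Longrightarrow> x \<oplus> x = \<zero> \<longleftrightarrow> x = \<zero>"
  using double_eq_iff[of x \<zero>] by simp

end

section \<open>Entrywise rules, commutators and adjugates of 2 x 2 matrices\<close>

context cring
begin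

lemma Mat2_mult_simp [simp]: "(a, b, c, d) \<boxtimes> (a', b', c', d') =
   ((a \<otimes> a') \<oplus> (b \<otimes> c'), (a \<otimes> b') \<oplus> (b \<otimes> d'), (c \<otimes> a') \<oplus> (d \<otimes> c'), (c \<otimes> b') \<oplus> (d \<otimes> d'))"
  by (simp add: Mat2_def)

lemma Mat2_add_simp [simp]: "(a, b, c, d) \<boxplus> (a', b', c', d') =
   (a \<oplus> a', b \<oplus> b', c \<oplus> c', d \<oplus> d')"
  by (simp add: Mat2_def)

lemma Mat2_smult_simp [simp]: "s \<boxdot> (a, b, c, d) = (s \<otimes> a, s \<otimes> b, s \<otimes> c, s \<otimes> d)"
  by (simp add: Mat2_def)

lemma Mat2_carrier_simp [simp]: "(a, b, c, d) \<in> carrier (Mat2 R) \<longleftrightarrow>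
   a \<in> carrier R \<and> b \<in> carrier R \<and> c \<in> carrier R \<and> d \<in> carrier R"
  by (simp add: Mat2_def)

lemma Mat2_one: "\<one>\<^bsub>Mat2 R\<^esub> = (\<one>, \<zero>, \<zero>, \<one>)"
  by (simp add: Mat2_def)

lemma Mat2_zero: "\<zero>\<^bsub>Mat2 R\<^esub> = (\<zero>, \<zero>, \<zero>, \<zero>)"
  by (simp add: Mat2_def)

lemma Mat2_cases:
  assumes "g \<in> carrier (Mat2 R)"
  obtains a b c d where "g = (a, b, c, d)" "a \<in> carrier R" "b \<in> carrier R" "c \<in> carrier R" "d \<in> carrier R"
  using assms by (cases g) auto

lemma Mat2_uminus_simp [simp]:
  assumes "a \<in> carrier R" "b \<in> carrier R" "c \<in> carrier R" "d \<in> carrier R"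
  shows "\<boxminus> (a, b, c, d) = (\<ominus> a, \<ominus> b, \<ominus> c, \<ominus> d)"
proof -
  interpret Mt: ring "Mat2 R" by (rule Mat2_ring)
  show ?thesis
    by (rule Mt.minus_equality) (use assms in \<open>auto simp: Mat2_zero l_neg\<close>)
qed

lemma sl2_cases:
  assumes "U \<in> sl2 R"
  obtains a b c where "U = (a, b, c, \<ominus> a)" "a \<in> carrier R" "b \<in> carrier R" "c \<in> carrier R"
  using assms by (auto simp: sl2_def)

lemma sl2_simp [simp]: "(a, b, c, d) \<in> sl2 R \<longleftrightarrow>
   a \<in> carrier R \<and> b \<in> carrier R \<and> c \<in> carrier R \<and> d = \<ominus> a"
  by (auto simp: sl2_def)

lemma sl2_carrier: "U \<in> sl2 R \<Longrightarrow> U \<in> carrier (Mat2 R)"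
  by (auto simp: sl2_def)

lemma matEFH [simp, intro]: "matE R \<in> sl2 R" "matF R \<in> sl2 R" "matH R \<in> sl2 R"
  by (auto simp: matE_def matF_def matH_def)

lemma sl2_smult [simp, intro]: "s \<in> carrier R \<Longrightarrow> U \<in> sl2 R \<Longrightarrow> s \<boxdot> U \<in> sl2 R"
  by (auto simp: sl2_def r_minus)

lemma sl2_add [simp, intro]: "U \<in> sl2 R \<Longrightarrow> V \<in> sl2 R \<Longrightarrow> U \<boxplus> V \<in> sl2 R"
  by (auto simp: sl2_def minus_add)

lemma comm2_simp:
  assumes "a \<in> carrier R" "b \<in> carrier R" "c \<in> carrier R" "d \<in> carrier R"
    "a' \<in> carrier R" "b' \<in> carrier R" "c' \<in> carrier R" "d' \<in> carrier R"
  shows "comm2 R (a, b, c, d) (a', b', c', d') =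
    ((b \<otimes> c') \<ominus> (b' \<otimes> c), ((a \<otimes> b') \<oplus> (b \<otimes> d')) \<ominus> ((a' \<otimes> b) \<oplus> (b' \<otimes> d)),
     ((c \<otimes> a') \<oplus> (d \<otimes> c')) \<ominus> ((c' \<otimes> a) \<oplus> (d' \<otimes> c)), (c \<otimes> b') \<ominus> (c' \<otimes> b))"
  using assms unfolding comm2_def a_minus_def[of "Mat2 R"] by (simp; intro conjI; algebra)

lemma comm2_closed: "U \<in> sl2 R \<Longrightarrow> V \<in> sl2 R \<Longrightarrow> comm2 R U V \<in> sl2 R"
  by (elim sl2_cases) (simp add: comm2_simp, algebra)

lemma comm2_EFH:
  "comm2 R (matE R) (matF R) = matH R"
  "comm2 R (matE R) (matH R) = \<boxminus> (matE R \<boxplus> matE R)"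
  "comm2 R (matF R) (matH R) = matF R \<boxplus> matF R"
  "comm2 R (matH R) (matF R) = \<boxminus> (matF R \<boxplus> matF R)"
  "comm2 R (matH R) (matE R) = matE R \<boxplus> matE R"
  "comm2 R (matF R) (matE R) = \<boxminus> (matH R)"
  unfolding matE_def matF_def matH_def by (simp_all add: comm2_simp a_minus_def minus_add l_minus r_minus)

lemma sl2_expand:
  assumes "a \<in> carrier R" "b \<in> carrier R" "c \<in> carrier R"
  shows "(a, b, c, \<ominus> a) = (a \<boxdot> matH R) \<boxplus> ((b \<boxdot> matE R) \<boxplus> (c \<boxdot> matF R))"
  using assms by (simp add: matH_def matE_def matF_def r_minus)

lemma adj2_closed [simp, intro]: "g \<in> carrier (Mat2 R) \<Longrightarrow> adj2 R g \<in> carrier (Mat2 R)"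
  by (auto simp: adj2_def elim!: Mat2_cases)

lemma adj2_adj2: "g \<in> carrier (Mat2 R) \<Longrightarrow> adj2 R (adj2 R g) = g"
  by (auto simp: adj2_def elim!: Mat2_cases)

lemma adj2_left: "g \<in> carrier (Mat2 R) \<Longrightarrow> adj2 R g \<boxtimes> g = det2 R g \<boxdot> \<one>\<^bsub>Mat2 R\<^esub>"
  by (elim Mat2_cases) (simp add: adj2_def det2_def Mat2_one, intro conjI; algebra)

lemma adj2_right: "g \<in> carrier (Mat2 R) \<Longrightarrow> g \<boxtimes> adj2 R g = det2 R g \<boxdot> \<one>\<^bsub>Mat2 R\<^esub>"
  by (elim Mat2_cases) (simp add: adj2_def det2_def Mat2_one, intro conjI; algebra)

lemma adj2_mult: "g \<in> carrier (Mat2 R) \<Longrightarrow> h \<in> carrier (Mat2 R) \<Longrightarrow>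
   adj2 R (g \<boxtimes> h) = adj2 R h \<boxtimes> adj2 R g"
  by (elim Mat2_cases) (simp add: adj2_def, intro conjI; algebra)

lemma adj2_smult: "s \<in> carrier R \<Longrightarrow> g \<in> carrier (Mat2 R) \<Longrightarrow>
   adj2 R (s \<boxdot> g) = s \<boxdot> adj2 R g"
  by (elim Mat2_cases) (simp add: adj2_def r_minus)

lemma det2_adj2: "g \<in> carrier (Mat2 R) \<Longrightarrow> det2 R (adj2 R g) = det2 R g"
  by (elim Mat2_cases) (simp add: adj2_def det2_def, algebra)

text \<open>Trace zero turns the anti-automorphism \<open>adj2\<close> into a sign; relations
  involving traceless matrices therefore survive passing to adjugates.\<close>

lemma adj2_sl2: "U \<in> sl2 R \<Longrightarrow> adj2 R U = \<boxminus> U"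
  by (elim sl2_cases) (simp add: adj2_def)

text \<open>Conjugation with its denominator cleared: \<open>adj2\<close> stands in for the inverse,
  so singular \<open>g\<close> are allowed.\<close>

lemma conj_sl2:
  assumes "g \<in> carrier (Mat2 R)" "U \<in> sl2 R"
  shows "g \<boxtimes> U \<boxtimes> adj2 R g \<in> sl2 R"
  using assms by (elim Mat2_cases sl2_cases) (simp add: adj2_def, algebra)

end


section \<open>Ideals and determinants\<close>

context cring
begin

lemma cring_idealI:
  assumes "I \<subseteq> carrier R" "\<zero> \<in> I" "\<And>x y. x \<in> I \<Longrightarrow> y \<in> I \<Longrightarrow> x \<oplus> y \<in> I"
    "\<And>r x. r \<in> carrier R \<Longrightarrow> x \<in> I \<Longrightarrow> r \<otimes> x \<in> I"
  shows "ideal I R"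
proof (rule idealI)
  show "ring R" by (rule ring_axioms)
  show "subgroup I (add_monoid R)"
  proof (rule add.subgroupI)
    show "\<ominus> x \<in> I" if "x \<in> I" for x
      using assms(4)[of "\<ominus> \<one>" x] that assms(1) by (auto simp: l_minus)
  qed (use assms in auto)
  show "x \<otimes> a \<in> I" "a \<otimes> x \<in> I" if "a \<in> I" "x \<in> carrier R" for a x
    using assms(4)[OF that(2,1)] that assms(1) by (auto simp: m_comm)
qed

text \<open>Serves to split products of determinants: once the second factors are known to generate
  the unit ideal, the first factor \<open>a\<close> itself lies in \<open>I\<close>.\<close>

lemma cring_ideal_colon:
  assumes "ideal I R" "a \<in> carrier R"
  shows "ideal {x \<in> carrier R. a \<otimes> x \<in> I} R"
proof -
  interpret I: ideal I R by fact
  show ?thesis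
    by (rule cring_idealI) (use assms(2) I.I_l_closed in \<open>auto simp: r_distr m_lcomm\<close>)
qed

lemma ideal_adjoin:
  assumes "ideal I R" "a \<in> carrier R"
  shows "ideal {i \<oplus> r \<otimes> a | i r. i \<in> I \<and> r \<in> carrier R} R" (is "ideal ?J R")
proof -
  interpret I: ideal I R by fact
  show ?thesis
  proof (rule cring_idealI)
    show "?J \<subseteq> carrier R" using assms(2) I.Icarr by auto
    show "\<zero> \<in> ?J" using assms(2) I.zero_closed by (force intro: exI[of _ "\<zero>"])
  next
    fix x y assume "x \<in> ?J" "y \<in> ?J"
    then obtain i r j s where x: "x = i \<oplus> r \<otimes> a" "i \<in> I" "r \<in> carrier R"
      and y: "y = j \<oplus> s \<otimes> a" "j \<in> I" "s \<in> carrier R" by blast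
    have "x \<oplus> y = (i \<oplus> j) \<oplus> (r \<oplus> s) \<otimes> a"
      unfolding x(1) y(1) using x(3) y(3) I.Icarr[OF x(2)] I.Icarr[OF y(2)] assms(2) by algebra
    then show "x \<oplus> y \<in> ?J" using x y I.a_closed by blast
  next
    fix q x assume q: "q \<in> carrier R" and "x \<in> ?J"
    then obtain i r where x: "x = i \<oplus> r \<otimes> a" "i \<in> I" "r \<in> carrier R" by blast
    have "q \<otimes> x = q \<otimes> i \<oplus> (q \<otimes> r) \<otimes> a"
      unfolding x(1) using x(3) I.Icarr[OF x(2)] q assms(2) by algebra
    then show "q \<otimes> x \<in> ?J" using x q I.I_l_closed by blast
  qed
qed

text \<open>Modulo \<open>I\<close> the element \<open>x\<close> equals 1, hence so does each of its
  powers.\<close>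

lemma one_minus_pow_mem:
  assumes "ideal I R" "x \<in> carrier R" "\<one> \<ominus> x \<in> I"
  shows "\<one> \<ominus> x [^] (n::nat) \<in> I"
proof -
  interpret I: ideal I R by fact
  show ?thesis
  proof (induction n)
    case 0
    then show ?case using I.zero_closed by (simp add: a_minus_def r_neg)
  next
    case (Suc n)
    have xn: "x [^] n \<in> carrier R" using assms(2) by simp
    have "\<one> \<ominus> y \<otimes> x = (\<one> \<ominus> y) \<oplus> y \<otimes> (\<one> \<ominus> x)" if "y \<in> carrier R" for y
      using that assms(2) by algebra
    from this[OF xn] have "\<one> \<ominus> x [^] Suc n = (\<one> \<ominus> x [^] n) \<oplus> x [^] n \<otimes> (\<one> \<ominus> x)" by simp
    then show ?case using Suc xn I.I_l_closed[OF assms(3)] I.a_closed by simp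
  qed
qed

text \<open>Elements nilpotent modulo \<open>I\<close> cannot enlarge a proper \<open>I\<close> to
  the unit ideal. The last hypothesis speaks of \<open>I\<close> together with \<open>F\<close>, not
  of \<open>F\<close> alone, so that the induction can absorb the elements of \<open>F\<close> into
  the ideal one at a time.\<close>

lemma ideal_eq_carrier_of_powers:
  assumes "finite F" "F \<subseteq> carrier R" "ideal I R" "\<And>f. f \<in> F \<Longrightarrow> \<exists>n::nat. f [^] n \<in> I"
    "\<And>J. ideal J R \<Longrightarrow> I \<subseteq> J \<Longrightarrow> F \<subseteq> J \<Longrightarrow> J = carrier R"
  shows "I = carrier R"
  using assms
proof (induction F arbitrary: I rule: finite_induct)
  case empty
  then show ?case by auto
next
  case (insert f F)
  interpret I: ideal I R by fact
  have f: "f \<in> carrier R" using insert.prems by auto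
  define J where "J = {i \<oplus> r \<otimes> f | i r. i \<in> I \<and> r \<in> carrier R}"
  have J: "ideal J R" unfolding J_def by (rule ideal_adjoin) fact+
  have IJ: "I \<subseteq> J"
  proof
    fix i assume "i \<in> I"
    then have "i = i \<oplus> \<zero> \<otimes> f" using f I.Icarr by simp
    then show "i \<in> J" unfolding J_def using \<open>i \<in> I\<close> by blast
  qed
  have fJ: "f \<in> J"
  proof -
    have "f = \<zero> \<oplus> \<one> \<otimes> f" using f by simp
    then show ?thesis unfolding J_def using I.zero_closed by blast
  qed
  have "J = carrier R"
  proof (rule insert.IH[OF _ J])
    show "F \<subseteq> carrier R" using insert.prems by auto
    show "\<exists>n::nat. g [^] n \<in> J" if "g \<in> F" for g using insert.prems(3)[of g] that IJ by blast
    show "K = carrier R" if "ideal K R" "J \<subseteq> K" "F \<subseteq> K" for K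
      using insert.prems(4)[of K] that IJ fJ by blast
  qed
  then have "\<one> \<in> J" by simp
  then obtain i r where ir: "\<one> = i \<oplus> r \<otimes> f" "i \<in> I" "r \<in> carrier R" unfolding J_def by blast
  \<comment> \<open>Since 1 = i + r f, the element r f is 1 modulo \<open>I\<close>, and so are its
    powers; but one of these powers also lies in \<open>I\<close>.\<close>
  have "\<one> \<ominus> r \<otimes> f = i" unfolding ir(1) using ir f I.Icarr by algebra
  then have rf: "\<one> \<ominus> (r \<otimes> f) [^] (n::nat) \<in> I" for n
    using one_minus_pow_mem[OF insert.prems(2)] ir f by simp
  obtain n :: nat where n: "f [^] n \<in> I" using insert.prems(3)[of f] by blast
  have "(r \<otimes> f) [^] n = r [^] n \<otimes> f [^] n" by (rule nat_pow_distrib) (use ir f in auto)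
  then have *: "(r \<otimes> f) [^] n \<in> I" using n ir I.I_l_closed by simp
  then have "(\<one> \<ominus> (r \<otimes> f) [^] n) \<oplus> (r \<otimes> f) [^] n \<in> I" using rf I.a_closed by blast
  moreover have "(\<one> \<ominus> y) \<oplus> y = \<one>" if "y \<in> carrier R" for y
    using that by algebra
  note this[OF I.Icarr[OF *]]
  ultimately show ?case by (intro I.one_imp_carrier) simp
qed

lemma ideal_eq_carrier_of_generating_powers:
  assumes "finite F" "F \<subseteq> carrier R" "genideal R F = carrier R" "ideal I R"
    "\<And>f. f \<in> F \<Longrightarrow> \<exists>n::nat. f [^] n \<in> I"
  shows "I = carrier R"
proof (rule ideal_eq_carrier_of_powers[OF assms(1,2,4,5)])
  show "J = carrier R" if "ideal J R" "F \<subseteq> J" for J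
    using genideal_minimal[OF that] assms(3) ideal.Icarr[OF that(1)] by blast
qed

end

text \<open>The device behind the local-to-global steps: \<open>h\<close> lies in \<open>N\<close>
  as soon as this ideal contains 1.\<close>

lemma (in module) submodule_colon_ideal:
  assumes "submodule N R M" "h \<in> carrier M"
  shows "ideal {x \<in> carrier R. x \<odot>\<^bsub>M\<^esub> h \<in> N} R"
proof -
  interpret N: submodule N R M by fact
  have "\<zero>\<^bsub>M\<^esub> \<in> N" using N.one_closed by simp
  then show ?thesis
    by (intro R.cring_idealI)
      (use assms submoduleE(5)[OF assms(1)] in \<open>auto simp: smult_l_distr smult_assoc1\<close>)
qed

context half_cring
begin

lemma zero_submodule: "submodule {\<zero>\<^bsub>Mat2 R\<^esub>} R (Mat2 R)"
  by (rule Md.submoduleI) auto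

text \<open>E and F generate the full matrix ring, so commuting with these two already means being
  central.\<close>

lemma scalar_of_commutes:
  assumes "Z \<in> carrier (Mat2 R)" "matE R \<boxtimes> Z = Z \<boxtimes> matE R" "matF R \<boxtimes> Z = Z \<boxtimes> matF R"
  shows "\<exists>s\<in>carrier R. Z = s \<boxdot> \<one>\<^bsub>Mat2 R\<^esub>"
proof -
  obtain a b c d where Z: "Z = (a, b, c, d)" "a \<in> carrier R" "b \<in> carrier R" "c \<in> carrier R" "d \<in> carrier R"
    using assms(1) by (rule Mat2_cases)
  have "matE R \<boxtimes> Z = (c, d, \<zero>, \<zero>)" "Z \<boxtimes> matE R = (\<zero>, a, \<zero>, c)"
    "matF R \<boxtimes> Z = (\<zero>, \<zero>, a, b)" "Z \<boxtimes> matF R = (b, \<zero>, d, \<zero>)"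
    using Z(2-) unfolding Z(1) matE_def matF_def by simp_all
  with assms(2,3) have "c = \<zero>" "d = a" "b = \<zero>" by (metis prod.inject)+
  then have "Z = a \<boxdot> \<one>\<^bsub>Mat2 R\<^esub>" using Z by (simp add: Mat2_one)
  with Z(2) show ?thesis by blast
qed

text \<open>Multiply the last hypothesis by \<open>g\<close> from the left and use that g adj(g) is
  the determinant.\<close>

lemma det_smult_eq:
  assumes "g \<in> carrier (Mat2 R)" "h \<in> carrier (Mat2 R)" "s \<in> carrier R"
    "adj2 R g \<boxtimes> h = s \<boxdot> \<one>\<^bsub>Mat2 R\<^esub>"
  shows "det2 R g \<boxdot> h = s \<boxdot> g"
proof -
  have "det2 R g \<boxdot> h = (g \<boxtimes> adj2 R g) \<boxtimes> h"
    using assms by (simp add: adj2_right det2_closed Mat2_smult)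
  also have "\<dots> = g \<boxtimes> (adj2 R g \<boxtimes> h)" using assms by (simp add: Mt.m_assoc)
  also have "\<dots> = s \<boxdot> g" using assms by (simp add: Mat2_smult)
  finally show ?thesis .
qed

text \<open>Multiplying (V - Z) g = 0 by adj(g) shows that each determinant annihilates V - Z, and
  annihilators are ideals. This replaces the cancellation of an invertible \<open>g\<close>.\<close>

lemma dets_faithful:
  assumes L: "dets_generate R L" "L \<subseteq> carrier (Mat2 R)"
    and YZ: "V \<in> carrier (Mat2 R)" "Z \<in> carrier (Mat2 R)" "\<And>g. g \<in> L \<Longrightarrow> V \<boxtimes> g = Z \<boxtimes> g"
  shows "V = Z"
proof -
  define D where "D = V \<boxplus> (\<boxminus> Z)"
  have D: "D \<in> carrier (Mat2 R)" using YZ by (simp add: D_def)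
  have "ideal {x \<in> carrier R. x \<boxdot> D \<in> {\<zero>\<^bsub>Mat2 R\<^esub>}} R"
    by (rule Md.submodule_colon_ideal[OF zero_submodule D])
  moreover have "det2 R g \<in> {x \<in> carrier R. x \<boxdot> D \<in> {\<zero>\<^bsub>Mat2 R\<^esub>}}" if g: "g \<in> L" for g
  proof -
    have gc: "g \<in> carrier (Mat2 R)" using g L by blast
    have "det2 R g \<boxdot> D = D \<boxtimes> (g \<boxtimes> adj2 R g)"
      using gc D by (simp add: adj2_right det2_closed Mat2_smult)
    also have "\<dots> = (D \<boxtimes> g) \<boxtimes> adj2 R g" using gc D by (simp add: Mt.m_assoc)
    also have "D \<boxtimes> g = \<zero>\<^bsub>Mat2 R\<^esub>" unfolding D_def using YZ gc g
      by (simp add: Mt.l_distr Mt.l_minus Mt.r_neg)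
    finally show ?thesis using gc det2_closed by simp
  qed
  ultimately have "{x \<in> carrier R. x \<boxdot> D \<in> {\<zero>\<^bsub>Mat2 R\<^esub>}} = carrier R"
    using L(1) unfolding dets_generate_def by blast
  then have "\<one> \<boxdot> D = \<zero>\<^bsub>Mat2 R\<^esub>" by blast
  then have "D = \<zero>\<^bsub>Mat2 R\<^esub>" using D by simp
  then show ?thesis unfolding D_def using YZ
    by (metis Mt.add.inv_closed Mt.minus_minus Mt.minus_equality Mt.add.inv_comm)
qed

end


section \<open>Intertwiners of a semilinear automorphism\<close>

context ring_hom_cring
begin

lemma map_mat2_simp [simp]: "map_mat2 h (a, b, c, d) = (h a, h b, h c, h d)"
  by (simp add: map_mat2_def)

lemma map_mat2_closed [simp, intro]:
  "g \<in> carrier (Mat2 R) \<Longrightarrow> map_mat2 h g \<in> carrier (Mat2 S)"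
  by (elim R.Mat2_cases) simp

lemma map_mat2_sl2 [simp, intro]: "V \<in> sl2 R \<Longrightarrow> map_mat2 h V \<in> sl2 S"
  by (elim R.sl2_cases) simp

lemma map_mat2_mult:
  "g \<in> carrier (Mat2 R) \<Longrightarrow> g' \<in> carrier (Mat2 R) \<Longrightarrow>
   map_mat2 h (g \<boxtimes> g') = map_mat2 h g \<boxtimes>\<^bsub>S\<^esub> map_mat2 h g'"
  by (elim R.Mat2_cases) simp

lemma map_mat2_add:
  "g \<in> carrier (Mat2 R) \<Longrightarrow> g' \<in> carrier (Mat2 R) \<Longrightarrow>
   map_mat2 h (g \<boxplus> g') = map_mat2 h g \<boxplus>\<^bsub>S\<^esub> map_mat2 h g'"
  by (elim R.Mat2_cases) simp

lemma map_mat2_smult: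
  "s \<in> carrier R \<Longrightarrow> g \<in> carrier (Mat2 R) \<Longrightarrow>
   map_mat2 h (s \<boxdot> g) = h s \<boxdot>\<^bsub>S\<^esub> map_mat2 h g"
  by (elim R.Mat2_cases) simp

lemma map_mat2_det2:
  "g \<in> carrier (Mat2 R) \<Longrightarrow> det2 S (map_mat2 h g) = h (det2 R g)"
  by (elim R.Mat2_cases) (simp add: det2_def a_minus_def)

lemma map_mat2_EFH:
  "map_mat2 h (matE R) = matE S" "map_mat2 h (matF R) = matF S" "map_mat2 h (matH R) = matH S"
  by (simp_all add: matE_def matF_def matH_def)

lemma map_mat2_comm2:
  "V \<in> sl2 R \<Longrightarrow> W \<in> sl2 R \<Longrightarrow> map_mat2 h (comm2 R V W) = comm2 S (map_mat2 h V) (map_mat2 h W)"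
  by (elim R.sl2_cases) (simp add: R.comm2_simp S.comm2_simp a_minus_def)

end

text \<open>An abstract form of the sign automorphisms of \<open>bar R\<close>. The involution law
  makes \<tau> bijective with itself as inverse, which is how scalars are moved through semilinear
  maps.\<close>

locale half_cring_invol = half_cring R for R (structure) +
  fixes \<tau>
  assumes tau_hom: "\<tau> \<in> ring_hom R R"
    and tau_tau: "s \<in> carrier R \<Longrightarrow> \<tau> (\<tau> s) = s"

sublocale half_cring_invol \<subseteq> T: ring_hom_cring R R \<tau>
  by unfold_locales (rule tau_hom)

context half_cring_invol
begin

lemma map_tau_tau: "g \<in> carrier (Mat2 R) \<Longrightarrow> map_mat2 \<tau> (map_mat2 \<tau> g) = g"
  by (elim Mat2_cases) (simp add: tau_tau)

lemma tau_zero_iff: "s \<in> carrier R \<Longrightarrow> \<tau> s = \<zero> \<longleftrightarrow> s = \<zero>"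
  using tau_tau[of s] by auto

end

lemma sl2_semiD:
  assumes "sl2_semi S \<tau> A"
  shows "bij_betw A (sl2 S) (sl2 S)"
    "V \<in> sl2 S \<Longrightarrow> A V \<in> sl2 S"
    "V \<in> sl2 S \<Longrightarrow> W \<in> sl2 S \<Longrightarrow> A V = A W \<Longrightarrow> V = W"
    "V \<in> sl2 S \<Longrightarrow> W \<in> sl2 S \<Longrightarrow> A (V \<boxplus>\<^bsub>S\<^esub> W) = A V \<boxplus>\<^bsub>S\<^esub> A W"
    "s \<in> carrier S \<Longrightarrow> V \<in> sl2 S \<Longrightarrow> A (s \<boxdot>\<^bsub>S\<^esub> V) = \<tau> s \<boxdot>\<^bsub>S\<^esub> A V"
    "V \<in> sl2 S \<Longrightarrow> W \<in> sl2 S \<Longrightarrow> A (comm2 S V W) = comm2 S (A V) (A W)"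
  using assms unfolding sl2_semi_def by (auto dest: bij_betwE inj_onD[OF bij_betw_imp_inj_on])

section \<open>Quadratic identities for traceless matrices and averaging over matrix units\<close>

context half_cring
begin

text \<open>\<open>q\<close> and \<open>p\<close> are given by Cayley-Hamilton for trace zero and by
  its polarisation. The double commutator expands to V V W + W V V - 2 V W V, and V W V = p V - q W
  eliminates the last product.\<close>

lemma sl2_form:
  assumes "V \<in> sl2 R" "W \<in> sl2 R"
  obtains q p where "q \<in> carrier R" "p \<in> carrier R"
    "V \<boxtimes> V = q \<boxdot> \<one>\<^bsub>Mat2 R\<^esub>" "(V \<boxtimes> W) \<boxplus> (W \<boxtimes> V) = p \<boxdot> \<one>\<^bsub>Mat2 R\<^esub>"
    "comm2 R V (comm2 R V W) \<boxplus> ((p \<oplus> p) \<boxdot> V) = (q \<oplus> q \<oplus> (q \<oplus> q)) \<boxdot> W"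
proof -
  obtain a b c where V: "V = (a, b, c, \<ominus> a)" "a \<in> carrier R" "b \<in> carrier R" "c \<in> carrier R"
    using assms(1) by (rule sl2_cases)
  obtain x y z where W: "W = (x, y, z, \<ominus> x)" "x \<in> carrier R" "y \<in> carrier R" "z \<in> carrier R"
    using assms(2) by (rule sl2_cases)
  note cl = V(2-) W(2-)
  define q where "q = a \<otimes> a \<oplus> b \<otimes> c"
  define p where "p = (a \<otimes> x \<oplus> a \<otimes> x) \<oplus> (b \<otimes> z \<oplus> c \<otimes> y)"
  have qp: "q \<in> carrier R" "p \<in> carrier R" unfolding q_def p_def using cl by auto
  have c: "V \<in> carrier (Mat2 R)" "W \<in> carrier (Mat2 R)" using assms sl2_carrier by auto
  have VV: "V \<boxtimes> V = q \<boxdot> \<one>\<^bsub>Mat2 R\<^esub>"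
    unfolding V(1) q_def Mat2_one Mat2_mult_simp Mat2_smult_simp prod.inject using cl by (intro conjI; algebra)
  have VW: "(V \<boxtimes> W) \<boxplus> (W \<boxtimes> V) = p \<boxdot> \<one>\<^bsub>Mat2 R\<^esub>"
    unfolding V(1) W(1) p_def Mat2_one Mat2_mult_simp Mat2_add_simp Mat2_smult_simp prod.inject
    using cl by (intro conjI; algebra)
  define T where "T = V \<boxtimes> (W \<boxtimes> V)"
  have T: "T \<in> carrier (Mat2 R)" using c by (simp add: T_def)
  \<comment> \<open>Multiplying V W + W V = p by \<open>V\<close> on the right expresses V W V
    through \<open>V\<close> and \<open>W\<close>.\<close>
  have "((V \<boxtimes> W) \<boxplus> (W \<boxtimes> V)) \<boxtimes> V = T \<boxplus> (q \<boxdot> W)"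
    using c qp(1) unfolding Mt.l_distr[OF Mt.m_closed[OF c] Mt.m_closed[OF c(2,1)] c(1)]
    by (simp add: Mt.m_assoc VV Mat2_smult T_def)
  then have Tq: "T \<boxplus> (q \<boxdot> W) = p \<boxdot> V" using VW c qp by (simp add: Mat2_smult)
  have "comm2 R V (comm2 R V W) = ((V \<boxtimes> V) \<boxtimes> W) \<boxplus> (W \<boxtimes> (V \<boxtimes> V)) \<boxplus> (\<boxminus> T) \<boxplus> (\<boxminus> T)"
    using c unfolding comm2_def a_minus_def T_def
    by (simp add: Mt.l_distr Mt.r_distr Mt.l_minus Mt.r_minus Mt.minus_add Mt.m_assoc Mt.a_ac)
  also have "\<dots> = ((q \<oplus> q) \<boxdot> W) \<boxplus> (\<boxminus> T) \<boxplus> (\<boxminus> T)"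
    unfolding VV using c qp T by (simp add: Mat2_smult Md.smult_l_distr)
  finally have "comm2 R V (comm2 R V W) \<boxplus> ((p \<oplus> p) \<boxdot> V) =
      ((q \<oplus> q) \<boxdot> W) \<boxplus> (\<boxminus> T) \<boxplus> (\<boxminus> T) \<boxplus> ((T \<boxplus> (q \<boxdot> W)) \<boxplus> (T \<boxplus> (q \<boxdot> W)))"
    unfolding Tq using c qp T by (simp add: Md.smult_l_distr)
  also have "\<dots> = (q \<oplus> q \<oplus> (q \<oplus> q)) \<boxdot> W"
  proof -
    have *: "Q \<boxplus> (\<boxminus> T) \<boxplus> (\<boxminus> T) \<boxplus> ((T \<boxplus> P) \<boxplus> (T \<boxplus> P)) = Q \<boxplus> (P \<boxplus> P)"
      if "Q \<in> carrier (Mat2 R)" "P \<in> carrier (Mat2 R)" for P Q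
      using that T by (simp add: Mt.a_ac Mt.r_neg1 Mt.r_neg2 Mt.r_neg)
    show ?thesis using c qp by (simp add: * Md.smult_l_distr)
  qed
  finally show thesis using that qp VV VW by blast
qed

text \<open>With e_11 = e f, e_21 = f, E_11 = E F and E_12 = E, the matrix \<open>g\<close> is the
  sum of e_i1 m E_1i over i = 1, 2. Multiplying by a unit e_kl on the left or by E_kl on the right
  selects and shifts the same summand.\<close>

lemma intertwine_EF:
  assumes cl: "e \<in> carrier (Mat2 R)" "f \<in> carrier (Mat2 R)" "m \<in> carrier (Mat2 R)"
    and ee: "e \<boxtimes> e = \<zero>\<^bsub>Mat2 R\<^esub>" and ff: "f \<boxtimes> f = \<zero>\<^bsub>Mat2 R\<^esub>" and ef: "(e \<boxtimes> f) \<boxplus> (f \<boxtimes> e) = \<one>\<^bsub>Mat2 R\<^esub>"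
  defines "g \<equiv> (e \<boxtimes> (f \<boxtimes> (m \<boxtimes> (matE R \<boxtimes> matF R)))) \<boxplus> (f \<boxtimes> (m \<boxtimes> matE R))"
  shows "e \<boxtimes> g = g \<boxtimes> matE R" "f \<boxtimes> g = g \<boxtimes> matF R"
proof -
  have EF: "matE R \<in> carrier (Mat2 R)" "matF R \<in> carrier (Mat2 R)" by (auto intro: sl2_carrier)
  have EE: "matE R \<boxtimes> matE R = \<zero>\<^bsub>Mat2 R\<^esub>" "matF R \<boxtimes> matF R = \<zero>\<^bsub>Mat2 R\<^esub>"
    "matE R \<boxtimes> (matF R \<boxtimes> matE R) = matE R"
    by (simp_all add: matE_def matF_def Mat2_zero)
  have z: "e \<boxtimes> (e \<boxtimes> x) = \<zero>\<^bsub>Mat2 R\<^esub>" "f \<boxtimes> (f \<boxtimes> x) = \<zero>\<^bsub>Mat2 R\<^esub>" if "x \<in> carrier (Mat2 R)" for x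
    using that cl ee ff by (simp_all flip: Mt.m_assoc)
  \<comment> \<open>Multiplying e f + f e = 1 by \<open>f\<close> gives f e f = f, the one relation
    among matrix units that is not assumed outright.\<close>
  have "f \<boxtimes> ((e \<boxtimes> f) \<boxplus> (f \<boxtimes> e)) = f" using ef cl by simp
  then have "f \<boxtimes> (e \<boxtimes> f) = f" using cl ff by (simp add: Mt.r_distr flip: Mt.m_assoc)
  then have fef: "f \<boxtimes> (e \<boxtimes> (f \<boxtimes> x)) = f \<boxtimes> x" if "x \<in> carrier (Mat2 R)" for x
    using that cl by (metis Mt.m_assoc Mt.m_closed)
  show "e \<boxtimes> g = g \<boxtimes> matE R"
    unfolding g_def using cl EF by (simp add: Mt.r_distr Mt.l_distr Mt.m_assoc z EE)
  show "f \<boxtimes> g = g \<boxtimes> matF R"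
    unfolding g_def using cl EF by (simp add: Mt.r_distr Mt.l_distr Mt.m_assoc z EE fef)
qed

end

context half_cring_invol
begin

section \<open>The module of intertwiners of a fixed semilinear automorphism\<close>

context
  fixes A
  assumes A: "sl2_semi R \<tau> A"
begin

lemma intertwinersD:
  assumes "g \<in> intertwiners R \<tau> A"
  shows "g \<in> carrier (Mat2 R)" "V \<in> sl2 R \<Longrightarrow> A V \<boxtimes> g = g \<boxtimes> map_mat2 \<tau> V"
  using assms by (auto simp: intertwiners_def)

lemma semi_matH: "A (matH R) = comm2 R (A (matE R)) (A (matF R))"
  using sl2_semiD(6)[OF A, of "matE R" "matF R"] by (simp add: comm2_EFH)

lemma semi_uminus: "V \<in> sl2 R \<Longrightarrow> A (\<boxminus> V) = \<boxminus> A V"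
  using sl2_semiD(5)[OF A, of "\<ominus> \<one>" V] sl2_carrier[OF sl2_semiD(2)[OF A, of V]] sl2_carrier[of V]
  by (simp add: Md.smult_l_minus)

text \<open>The relations for E and F pass to their commutator H, and H, E, F span the traceless
  matrices; semilinearity of \<open>A\<close> does the rest.\<close>

lemma intertwinersI:
  assumes g: "g \<in> carrier (Mat2 R)"
    and EF: "A (matE R) \<boxtimes> g = g \<boxtimes> matE R" "A (matF R) \<boxtimes> g = g \<boxtimes> matF R"
  shows "g \<in> intertwiners R \<tau> A"
  unfolding intertwiners_def
proof (intro CollectI conjI ballI)
  note c = sl2_carrier sl2_semiD(2)[OF A]
  have H: "A (matH R) \<boxtimes> g = g \<boxtimes> matH R"
  proof -
    have *: "matH R = (matE R \<boxtimes> matF R) \<boxplus> (\<boxminus> (matF R \<boxtimes> matE R))"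
      unfolding comm2_EFH(1)[symmetric] comm2_def a_minus_def ..
    have EFc: "A (matE R) \<in> carrier (Mat2 R)" "A (matF R) \<in> carrier (Mat2 R)"
      "matE R \<in> carrier (Mat2 R)" "matF R \<in> carrier (Mat2 R)"
      using c matEFH by blast+
    have "A (matE R) \<boxtimes> (A (matF R) \<boxtimes> g) = (A (matE R) \<boxtimes> g) \<boxtimes> matF R"
      unfolding EF(2) using EFc g by (simp add: Mt.m_assoc)
    then have 1: "A (matE R) \<boxtimes> (A (matF R) \<boxtimes> g) = g \<boxtimes> (matE R \<boxtimes> matF R)"
      unfolding EF(1) using EFc g by (simp add: Mt.m_assoc)
    have "A (matF R) \<boxtimes> (A (matE R) \<boxtimes> g) = (A (matF R) \<boxtimes> g) \<boxtimes> matE R"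
      unfolding EF(1) using EFc g by (simp add: Mt.m_assoc)
    then have 2: "A (matF R) \<boxtimes> (A (matE R) \<boxtimes> g) = g \<boxtimes> (matF R \<boxtimes> matE R)"
      unfolding EF(2) using EFc g by (simp add: Mt.m_assoc)
    have "A (matH R) \<boxtimes> g = ((A (matE R) \<boxtimes> A (matF R)) \<boxplus> (\<boxminus> (A (matF R) \<boxtimes> A (matE R)))) \<boxtimes> g"
      by (simp only: semi_matH comm2_def a_minus_def)
    also have "\<dots> = (A (matE R) \<boxtimes> (A (matF R) \<boxtimes> g)) \<boxplus> (\<boxminus> (A (matF R) \<boxtimes> (A (matE R) \<boxtimes> g)))"
      using g EFc by (simp add: Mt.l_distr Mt.l_minus Mt.m_assoc)
    also have "\<dots> = g \<boxtimes> matH R"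
      unfolding 1 2 * using g EFc by (simp add: Mt.r_distr Mt.r_minus)
    finally show ?thesis .
  qed
  fix V assume "V \<in> sl2 R"
  then obtain x y z where V: "V = (x, y, z, \<ominus> x)" "x \<in> carrier R" "y \<in> carrier R" "z \<in> carrier R"
    by (rule sl2_cases)
  have "A V = (\<tau> x \<boxdot> A (matH R)) \<boxplus> ((\<tau> y \<boxdot> A (matE R)) \<boxplus> (\<tau> z \<boxdot> A (matF R)))"
    unfolding V(1) sl2_expand[OF V(2-)] using V(2-) by (simp add: sl2_semiD(4,5)[OF A])
  moreover have "map_mat2 \<tau> V = (\<tau> x \<boxdot> matH R) \<boxplus> ((\<tau> y \<boxdot> matE R) \<boxplus> (\<tau> z \<boxdot> matF R))"
    unfolding V(1) using V(2-) by (simp add: sl2_expand[symmetric])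
  ultimately show "A V \<boxtimes> g = g \<boxtimes> map_mat2 \<tau> V"
    using V(2-) g EF H by (simp add: Mt.l_distr Mt.r_distr Mat2_smult c)
qed (fact g)

lemma intertwiners_submodule: "submodule (intertwiners R \<tau> A) R (Mat2 R)"
proof (rule Md.submoduleI)
  note c = sl2_carrier sl2_semiD(2)[OF A]
  show "\<zero>\<^bsub>Mat2 R\<^esub> \<in> intertwiners R \<tau> A" by (rule intertwinersI) (simp_all add: c)
  show "\<boxminus> g \<in> intertwiners R \<tau> A" if "g \<in> intertwiners R \<tau> A" for g
    using intertwinersD[OF that]
    by (intro intertwinersI) (simp_all add: c Mt.l_minus Mt.r_minus T.map_mat2_EFH)
  show "g \<boxplus> h \<in> intertwiners R \<tau> A" if "g \<in> intertwiners R \<tau> A" "h \<in> intertwiners R \<tau> A" for g h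
    using intertwinersD[OF that(1)] intertwinersD[OF that(2)]
    by (intro intertwinersI) (simp_all add: c Mt.l_distr Mt.r_distr T.map_mat2_EFH)
  show "s \<boxdot> g \<in> intertwiners R \<tau> A" if "s \<in> carrier R" "g \<in> intertwiners R \<tau> A" for s g
    using intertwinersD[OF that(2)] that(1)
    by (intro intertwinersI) (simp_all add: c Mat2_smult T.map_mat2_EFH)
qed (use intertwinersD(1) in blast)

text \<open>Apply \<open>adj2\<close> to the intertwining relation: products are reversed, and the
  two signs from traceless matrices cancel.\<close>

lemma adj2_intertwiner:
  assumes g: "g \<in> intertwiners R \<tau> A" and V: "V \<in> sl2 R"
  shows "adj2 R g \<boxtimes> A V = map_mat2 \<tau> V \<boxtimes> adj2 R g"
proof -
  have tV: "map_mat2 \<tau> V \<in> sl2 R" and AV: "A V \<in> sl2 R" using V sl2_semiD(2)[OF A] by auto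
  have c: "g \<in> carrier (Mat2 R)" "adj2 R g \<in> carrier (Mat2 R)" "map_mat2 \<tau> V \<in> carrier (Mat2 R)"
    "A V \<in> carrier (Mat2 R)"
    using intertwinersD(1)[OF g] sl2_carrier tV AV by auto
  have "adj2 R g \<boxtimes> (\<boxminus> A V) = adj2 R (A V \<boxtimes> g)"
    unfolding adj2_mult[OF c(4,1)] adj2_sl2[OF AV] ..
  also have "\<dots> = (\<boxminus> map_mat2 \<tau> V) \<boxtimes> adj2 R g"
    unfolding intertwinersD(2)[OF g V] adj2_mult[OF c(1,3)] adj2_sl2[OF tV] ..
  finally have "\<boxminus> (adj2 R g \<boxtimes> A V) = \<boxminus> (map_mat2 \<tau> V \<boxtimes> adj2 R g)"
    using c by (simp add: Mt.l_minus Mt.r_minus)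
  then show ?thesis using c by (metis Mt.minus_minus Mt.m_closed)
qed

text \<open>A form of Schur's lemma without inverting \<open>g\<close>: adj(g) h commutes with every
  \<tau>(V), in particular with E and F, and is therefore a scalar \<open>s\<close>.\<close>

lemma intertwiners_proportional:
  assumes g: "g \<in> intertwiners R \<tau> A" and h: "h \<in> intertwiners R \<tau> A"
  shows "\<exists>s\<in>carrier R. det2 R g \<boxdot> h = s \<boxdot> g"
proof -
  have c: "g \<in> carrier (Mat2 R)" "h \<in> carrier (Mat2 R)" "adj2 R g \<in> carrier (Mat2 R)"
    using intertwinersD(1)[OF g] intertwinersD(1)[OF h] by auto
  have comm: "map_mat2 \<tau> V \<boxtimes> (adj2 R g \<boxtimes> h) = (adj2 R g \<boxtimes> h) \<boxtimes> map_mat2 \<tau> V" if V: "V \<in> sl2 R" for V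
  proof -
    have cV: "map_mat2 \<tau> V \<in> carrier (Mat2 R)" "A V \<in> carrier (Mat2 R)"
      using sl2_carrier V sl2_semiD(2)[OF A V] by auto
    have "map_mat2 \<tau> V \<boxtimes> (adj2 R g \<boxtimes> h) = (adj2 R g \<boxtimes> A V) \<boxtimes> h"
      unfolding adj2_intertwiner[OF g V] using c cV by (simp add: Mt.m_assoc)
    also have "\<dots> = adj2 R g \<boxtimes> (h \<boxtimes> map_mat2 \<tau> V)"
      unfolding intertwinersD(2)[OF h V, symmetric] using c cV by (simp add: Mt.m_assoc)
    also have "\<dots> = (adj2 R g \<boxtimes> h) \<boxtimes> map_mat2 \<tau> V" using c cV by (simp add: Mt.m_assoc)
    finally show ?thesis .
  qed
  have "\<exists>s\<in>carrier R. adj2 R g \<boxtimes> h = s \<boxdot> \<one>\<^bsub>Mat2 R\<^esub>"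
    using comm[OF matEFH(1)] comm[OF matEFH(2)] c
    by (intro scalar_of_commutes) (simp_all add: T.map_mat2_EFH)
  then show ?thesis using det_smult_eq c by blast
qed

text \<open>For \<open>g\<close> in \<open>N\<close> and any intertwiner \<open>h\<close>, the
  multiple det(g) h equals some s g and so lies in \<open>N\<close>; hence the scalars carrying
  \<open>h\<close> into \<open>N\<close> form the unit ideal. All later identifications of a
  concrete submodule with the intertwiners go through this criterion.\<close>

lemma submodule_eq_intertwiners:
  assumes N: "submodule N R (Mat2 R)" "N \<subseteq> intertwiners R \<tau> A" "dets_generate R N"
  shows "N = intertwiners R \<tau> A"
proof
  show "intertwiners R \<tau> A \<subseteq> N"
  proof
    fix h assume h: "h \<in> intertwiners R \<tau> A"
    have "ideal {x \<in> carrier R. x \<boxdot> h \<in> N} R"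
      using Md.submodule_colon_ideal[OF N(1)] intertwinersD(1)[OF h] by blast
    moreover have "det2 R g \<in> {x \<in> carrier R. x \<boxdot> h \<in> N}" if g: "g \<in> N" for g
    proof -
      have gi: "g \<in> intertwiners R \<tau> A" using g N(2) by blast
      obtain s where "s \<in> carrier R" "det2 R g \<boxdot> h = s \<boxdot> g"
        using intertwiners_proportional[OF gi h] by blast
      then show ?thesis
        using Md.submoduleE(4)[OF N(1) _ g] intertwinersD(1)[OF gi] det2_closed by simp
    qed
    ultimately have "\<one> \<in> {x \<in> carrier R. x \<boxdot> h \<in> N}"
      using N(3) unfolding dets_generate_def by blast
    then show "h \<in> N" using intertwinersD(1)[OF h] by simp
  qed
qed (fact N)

text \<open>Independence is evident for E and F and is carried over by injectivity of
  \<open>A\<close>; the scalars pass through \<tau> on the way.\<close>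

lemma semi_EF_independent:
  assumes "s \<in> carrier R" "t \<in> carrier R" "s \<boxdot> A (matE R) = t \<boxdot> A (matF R)"
  shows "s = \<zero>" "t = \<zero>"
proof -
  have "A (\<tau> s \<boxdot> matE R) = A (\<tau> t \<boxdot> matF R)"
    using assms by (simp add: sl2_semiD(5)[OF A] tau_tau)
  then have "\<tau> s \<boxdot> matE R = \<tau> t \<boxdot> matF R"
    using sl2_semiD(3)[OF A] assms by simp
  then have "\<tau> s = \<zero> \<and> \<zero> = \<tau> t" using assms by (auto simp: matE_def matF_def)
  then show "s = \<zero>" "t = \<zero>" using assms tau_zero_iff by auto
qed

lemma quadruple_zero: "x \<in> carrier R \<Longrightarrow> x \<oplus> x \<oplus> (x \<oplus> x) = \<zero> \<longleftrightarrow> x = \<zero>"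
  using double_zero[of x] double_zero[of "x \<oplus> x"] by simp

text \<open>Comparing the double commutator with \<open>sl2_form\<close> gives (2p - 2) V = 4q W, so
  independence and cancellation of 2 yield p = 1 and q = 0.\<close>

lemma form_relations:
  assumes V: "V \<in> sl2 R" and W: "W \<in> sl2 R"
    and c: "comm2 R V (comm2 R V W) = \<boxminus> (V \<boxplus> V)"
    and indep: "\<And>s t. s \<in> carrier R \<Longrightarrow> t \<in> carrier R \<Longrightarrow> s \<boxdot> V = t \<boxdot> W \<Longrightarrow> s = \<zero> \<and> t = \<zero>"
  shows "V \<boxtimes> V = \<zero>\<^bsub>Mat2 R\<^esub>" "(V \<boxtimes> W) \<boxplus> (W \<boxtimes> V) = \<one>\<^bsub>Mat2 R\<^esub>"
proof -
  obtain q p where qp: "q \<in> carrier R" "p \<in> carrier R"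
    "V \<boxtimes> V = q \<boxdot> \<one>\<^bsub>Mat2 R\<^esub>" "(V \<boxtimes> W) \<boxplus> (W \<boxtimes> V) = p \<boxdot> \<one>\<^bsub>Mat2 R\<^esub>"
    "comm2 R V (comm2 R V W) \<boxplus> ((p \<oplus> p) \<boxdot> V) = (q \<oplus> q \<oplus> (q \<oplus> q)) \<boxdot> W"
    using sl2_form[OF V W] .
  have Vc: "V \<in> carrier (Mat2 R)" using V by (rule sl2_carrier)
  have "\<boxminus> (V \<boxplus> V) \<boxplus> ((p \<oplus> p) \<boxdot> V) = ((p \<oplus> p) \<ominus> (\<one> \<oplus> \<one>)) \<boxdot> V"
    using Vc qp(2) by (simp add: a_minus_def Md.smult_l_distr Md.smult_l_minus Mt.minus_add Mt.a_ac)
  then have "((p \<oplus> p) \<ominus> (\<one> \<oplus> \<one>)) \<boxdot> V = (q \<oplus> q \<oplus> (q \<oplus> q)) \<boxdot> W"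
    using qp(5) c by simp
  then have "(p \<oplus> p) \<ominus> (\<one> \<oplus> \<one>) = \<zero>" and q: "q \<oplus> q \<oplus> (q \<oplus> q) = \<zero>"
    using indep[of "(p \<oplus> p) \<ominus> (\<one> \<oplus> \<one>)" "q \<oplus> q \<oplus> (q \<oplus> q)"] qp by auto
  then have "p \<oplus> p = \<one> \<oplus> \<one>" using qp(2) by (simp add: r_right_minus_eq)
  then have "p = \<one>" using double_eq_iff qp by simp
  moreover have "q = \<zero>" using q qp by (simp add: quadruple_zero)
  ultimately show "V \<boxtimes> V = \<zero>\<^bsub>Mat2 R\<^esub>" "(V \<boxtimes> W) \<boxplus> (W \<boxtimes> V) = \<one>\<^bsub>Mat2 R\<^esub>" using qp by simp_all
qed

text \<open>Only [E,[E,F]] = -2E and [F,[F,E]] = -2F are transported by \<open>A\<close>; the second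
  is needed for the square of \<open>f\<close>.\<close>

lemma semi_EF_relations:
  defines "e \<equiv> A (matE R)" and "f \<equiv> A (matF R)"
  shows "e \<boxtimes> e = \<zero>\<^bsub>Mat2 R\<^esub>" "f \<boxtimes> f = \<zero>\<^bsub>Mat2 R\<^esub>" "(e \<boxtimes> f) \<boxplus> (f \<boxtimes> e) = \<one>\<^bsub>Mat2 R\<^esub>"
proof -
  have cl: "e \<in> sl2 R" "f \<in> sl2 R" unfolding e_def f_def by (simp_all add: sl2_semiD(2)[OF A])
  have "comm2 R e (comm2 R e f) = A (comm2 R (matE R) (comm2 R (matE R) (matF R)))"
    unfolding e_def f_def by (simp add: sl2_semiD(6)[OF A] comm2_closed)
  also have "\<dots> = \<boxminus> (e \<boxplus> e)"
    unfolding e_def by (simp add: comm2_EFH semi_uminus sl2_semiD(4)[OF A])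
  finally have 1: "comm2 R e (comm2 R e f) = \<boxminus> (e \<boxplus> e)" .
  have "comm2 R (matF R) (comm2 R (matF R) (matE R)) = \<boxminus> (matF R \<boxplus> matF R)"
    unfolding matE_def matF_def by (simp add: comm2_simp a_minus_def minus_add)
  moreover have "comm2 R f (comm2 R f e) = A (comm2 R (matF R) (comm2 R (matF R) (matE R)))"
    unfolding e_def f_def by (simp add: sl2_semiD(6)[OF A] comm2_closed)
  ultimately have 2: "comm2 R f (comm2 R f e) = \<boxminus> (f \<boxplus> f)"
    unfolding f_def by (simp add: semi_uminus sl2_semiD(4)[OF A])
  show "e \<boxtimes> e = \<zero>\<^bsub>Mat2 R\<^esub>" "(e \<boxtimes> f) \<boxplus> (f \<boxtimes> e) = \<one>\<^bsub>Mat2 R\<^esub>"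
    using form_relations[OF cl 1] semi_EF_independent unfolding e_def f_def by blast+
  show "f \<boxtimes> f = \<zero>\<^bsub>Mat2 R\<^esub>"
    using form_relations(1)[OF cl(2,1) 2] semi_EF_independent unfolding e_def f_def by metis
qed

text \<open>The cover consists of the off-diagonal entries \<open>z\<close> and -\<open>y\<close> of
  \<open>f\<close>, which occur as determinants of two averaged intertwiners. They generate the unit
  ideal because modulo both of them x x = 0 while 2 a x = 1.\<close>

lemma intertwiners_in_points: "intertwiners R \<tau> A \<in> PGL2_points R"
proof -
  obtain a b c where e: "A (matE R) = (a, b, c, \<ominus> a)" "a \<in> carrier R" "b \<in> carrier R" "c \<in> carrier R"
    using sl2_semiD(2)[OF A matEFH(1)] by (rule sl2_cases)
  obtain x y z where f: "A (matF R) = (x, y, z, \<ominus> x)" "x \<in> carrier R" "y \<in> carrier R" "z \<in> carrier R"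
    using sl2_semiD(2)[OF A matEFH(2)] by (rule sl2_cases)
  note cl = e(2-) f(2-)
  note rel = semi_EF_relations
  have q: "x \<otimes> x \<oplus> y \<otimes> z = \<zero>"
    using rel(2) cl unfolding f(1) by (simp add: Mat2_zero)
  have p: "a \<otimes> x \<oplus> b \<otimes> z \<oplus> (x \<otimes> a \<oplus> y \<otimes> c) = \<one>"
    using rel(3) cl unfolding e(1) f(1) by (simp add: Mat2_one)
  define g where "g m = (A (matE R) \<boxtimes> (A (matF R) \<boxtimes> (m \<boxtimes> (matE R \<boxtimes> matF R)))) \<boxplus>
    (A (matF R) \<boxtimes> (m \<boxtimes> matE R))" for m
  have c: "A (matE R) \<in> carrier (Mat2 R)" "A (matF R) \<in> carrier (Mat2 R)"
    by (rule sl2_carrier, rule sl2_semiD(2)[OF A], simp)+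
  have EF: "matE R \<in> carrier (Mat2 R)" "matF R \<in> carrier (Mat2 R)" by (auto intro: sl2_carrier)
  have gi: "g m \<in> intertwiners R \<tau> A" if "m \<in> carrier (Mat2 R)" for m
    unfolding g_def using intertwine_EF[OF c that rel] c EF that by (intro intertwinersI) auto
  \<comment> \<open>If v is the first column of \<open>m\<close> and w = f v, then
    \<open>g m\<close> has the columns e w and w. Thus m = 1 and m = F use the two columns (x, z)
    and (y, -x) of \<open>f\<close>.\<close>
  have "det2 R (g \<one>\<^bsub>Mat2 R\<^esub>) = (a \<otimes> x \<oplus> b \<otimes> z) \<otimes> z \<ominus> x \<otimes> (c \<otimes> x \<ominus> a \<otimes> z)"
    unfolding g_def e(1) f(1) using cl
    by (simp add: matE_def matF_def Mat2_one det2_def, algebra)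
  also have "\<dots> = z \<otimes> (a \<otimes> x \<oplus> b \<otimes> z \<oplus> (x \<otimes> a \<oplus> y \<otimes> c)) \<ominus> c \<otimes> (x \<otimes> x \<oplus> y \<otimes> z)"
    using cl by algebra
  also have "\<dots> = z" using cl by (simp add: p q a_minus_def)
  finally have d1: "det2 R (g \<one>\<^bsub>Mat2 R\<^esub>) = z" .
  have "det2 R (g (matF R)) = \<ominus> ((a \<otimes> y \<ominus> b \<otimes> x) \<otimes> x) \<ominus> y \<otimes> (c \<otimes> y \<oplus> a \<otimes> x)"
    unfolding g_def e(1) f(1) using cl
    by (simp add: matE_def matF_def Mat2_one det2_def, algebra)
  also have "\<dots> = \<ominus> (y \<otimes> (a \<otimes> x \<oplus> b \<otimes> z \<oplus> (x \<otimes> a \<oplus> y \<otimes> c))) \<oplus> b \<otimes> (x \<otimes> x \<oplus> y \<otimes> z)"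
    using cl by algebra
  also have "\<dots> = \<ominus> y" using cl by (simp add: p q a_minus_def)
  finally have d2: "det2 R (g (matF R)) = \<ominus> y" .
  \<comment> \<open>Put w = b z + y c. The relation \<open>p\<close> reads w + 2 a x = 1, so 1 = 2 w
    - w^2 + (2 a x)^2, and x x = - y z turns the last square into -4 a^2 y z. Every term is then a
    multiple of \<open>y\<close> or \<open>z\<close>.\<close>
  have one: "\<one> = (b \<otimes> z \<oplus> y \<otimes> c) \<otimes> (\<one> \<oplus> \<one>) \<ominus> (b \<otimes> z \<oplus> y \<otimes> c) \<otimes> (b \<otimes> z \<oplus> y \<otimes> c)
     \<ominus> (a \<oplus> a) \<otimes> (a \<oplus> a) \<otimes> (y \<otimes> z)"
  proof -
    define w where "w = b \<otimes> z \<oplus> y \<otimes> c"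
    have w: "w \<in> carrier R" using cl by (simp add: w_def)
    have "w \<oplus> (a \<oplus> a) \<otimes> x = a \<otimes> x \<oplus> b \<otimes> z \<oplus> (x \<otimes> a \<oplus> y \<otimes> c)"
      unfolding w_def using cl by algebra
    then have w1: "w \<oplus> (a \<oplus> a) \<otimes> x = \<one>" using p by simp
    have *: "t \<ominus> r \<otimes> r \<otimes> k = t \<ominus> r \<otimes> r \<otimes> (x \<otimes> x \<oplus> k) \<oplus> r \<otimes> x \<otimes> (r \<otimes> x)"
      if "t \<in> carrier R" "r \<in> carrier R" "k \<in> carrier R" for t r k
      using that cl(4) by algebra
    have "w \<otimes> (\<one> \<oplus> \<one>) \<ominus> w \<otimes> w \<ominus> (a \<oplus> a) \<otimes> (a \<oplus> a) \<otimes> (y \<otimes> z) =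
        w \<otimes> (\<one> \<oplus> \<one>) \<ominus> w \<otimes> w \<oplus> (a \<oplus> a) \<otimes> x \<otimes> ((a \<oplus> a) \<otimes> x)"
      using cl w by (subst *) (auto simp: q a_minus_def)
    also have "\<dots> = \<one>"
    proof -
      define v where "v = (a \<oplus> a) \<otimes> x"
      have v: "v \<in> carrier R" using cl by (simp add: v_def)
      have "w \<otimes> (\<one> \<oplus> \<one>) \<ominus> w \<otimes> w \<oplus> v \<otimes> v = (w \<oplus> v) \<otimes> (v \<ominus> w) \<oplus> w \<oplus> w" using v w by algebra
      also have "\<dots> = \<one> \<otimes> (v \<ominus> w) \<oplus> w \<oplus> w" using w1 unfolding v_def by simp
      also have "\<dots> = w \<oplus> v" using v w by algebra
      finally show ?thesis using w1 unfolding v_def by simp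
    qed
    finally show ?thesis unfolding w_def by simp
  qed
  have "genideal R {z, \<ominus> y} = carrier R"
  proof -
    interpret I: ideal "genideal R {z, \<ominus> y}" R by (rule genideal_ideal) (use cl in auto)
    have z: "z \<in> genideal R {z, \<ominus> y}" and "\<ominus> y \<in> genideal R {z, \<ominus> y}"
      using genideal_self[of "{z, \<ominus> y}"] cl by auto
    then have y: "y \<in> genideal R {z, \<ominus> y}"
      using I.a_inv_closed[of "\<ominus> y"] cl by simp
    have w: "b \<otimes> z \<oplus> y \<otimes> c \<in> genideal R {z, \<ominus> y}"
      by (rule I.a_closed[OF I.I_l_closed[OF z] I.I_r_closed[OF y]]) (use cl in auto)
    have 1: "(b \<otimes> z \<oplus> y \<otimes> c) \<otimes> (\<one> \<oplus> \<one>) \<in> genideal R {z, \<ominus> y}"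
      by (rule I.I_r_closed[OF w]) auto
    have 2: "(b \<otimes> z \<oplus> y \<otimes> c) \<otimes> (b \<otimes> z \<oplus> y \<otimes> c) \<in> genideal R {z, \<ominus> y}"
      by (rule I.I_r_closed[OF w]) (use cl in auto)
    have 3: "(a \<oplus> a) \<otimes> (a \<oplus> a) \<otimes> (y \<otimes> z) \<in> genideal R {z, \<ominus> y}"
      by (rule I.I_l_closed[OF I.I_r_closed[OF y]]) (use cl in auto)
    have "(b \<otimes> z \<oplus> y \<otimes> c) \<otimes> (\<one> \<oplus> \<one>) \<ominus> (b \<otimes> z \<oplus> y \<otimes> c) \<otimes> (b \<otimes> z \<oplus> y \<otimes> c)
     \<ominus> (a \<oplus> a) \<otimes> (a \<oplus> a) \<otimes> (y \<otimes> z) \<in> genideal R {z, \<ominus> y}"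
      unfolding a_minus_def by (intro I.a_closed I.a_inv_closed 1 2 3)
    then show ?thesis using one by (intro I.one_imp_carrier) simp
  qed
  moreover have "\<exists>h\<in>intertwiners R \<tau> A. generated_over_localisation R (intertwiners R \<tau> A) d h"
    if "d \<in> {z, \<ominus> y}" for d
  proof -
    obtain m where m: "m \<in> carrier (Mat2 R)" "d = det2 R (g m)"
    proof (cases "d = z")
      case True
      show thesis by (rule that[of "\<one>\<^bsub>Mat2 R\<^esub>"]) (simp_all add: True d1)
    next
      case False
      then have "d = \<ominus> y" using \<open>d \<in> {z, \<ominus> y}\<close> by simp
      then show thesis using EF(2) d2 by (intro that[of "matF R"]) simp_all
    qed
    have dc: "d \<in> carrier R" using that cl by auto
    \<comment> \<open>Exponent 1 suffices in both clauses, because \<open>d\<close> is itself the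
      determinant of the generator \<open>g m\<close>.\<close>
    have "d divides\<^bsub>R\<^esub> d [^] (1::nat)" using dc by (auto simp: factor_def intro!: bexI[of _ \<one>])
    moreover have "\<exists>s\<in>carrier R. (d [^] (1::nat)) \<boxdot> h = s \<boxdot> g m" if "h \<in> intertwiners R \<tau> A" for h
      using intertwiners_proportional[OF gi[OF m(1)] that] dc unfolding m(2) by simp
    ultimately show ?thesis
      using gi[OF m(1)] m(2) unfolding generated_over_localisation_def by blast
  qed
  moreover have "finite {z, \<ominus> y}" "{z, \<ominus> y} \<subseteq> carrier R" using cl by auto
  ultimately show ?thesis
    using intertwiners_submodule unfolding PGL2_points_def by blast
qed

end

end


section \<open>Points of the sheaf as intertwiners\<close>

context half_cring
begin

lemma span2_submodule:
  assumes "B \<subseteq> carrier (Mat2 R)"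
  shows "submodule (span2 R B) R (Mat2 R)"
proof (rule Md.submoduleI)
  \<comment> \<open>\<open>span2\<close> is an intersection; this member of the family keeps the
    intersection inside the matrices.\<close>
  have "carrier (Mat2 R) \<in> {N. submodule N R (Mat2 R) \<and> B \<subseteq> N}"
    using assms Md.carrier_is_submodule by blast
  then show "span2 R B \<subseteq> carrier (Mat2 R)" unfolding span2_def by blast
  have "\<zero>\<^bsub>Mat2 R\<^esub> \<in> N" if "submodule N R (Mat2 R)" for N
    using subgroup.one_closed[OF submodule.axioms(1)[OF that]] by simp
  then show "\<zero>\<^bsub>Mat2 R\<^esub> \<in> span2 R B" unfolding span2_def by blast
qed (auto simp: span2_def dest: Md.submoduleE)

lemma span2_subset: "B \<subseteq> span2 R B"
  unfolding span2_def by blast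

lemma span2_minimal: "submodule N R (Mat2 R) \<Longrightarrow> B \<subseteq> N \<Longrightarrow> span2 R B \<subseteq> N"
  unfolding span2_def by blast

lemma dets_generate_mono: "dets_generate R L \<Longrightarrow> L \<subseteq> N \<Longrightarrow> dets_generate R N"
  unfolding dets_generate_def by blast

lemma dets_generate_adj2:
  assumes "dets_generate R L" "L \<subseteq> carrier (Mat2 R)"
  shows "dets_generate R (adj2 R ` L)"
proof -
  have "det2 R ` adj2 R ` L = det2 R ` L"
    using assms(2) det2_adj2 by (auto simp: image_image intro!: image_cong)
  then show ?thesis using assms(1) unfolding dets_generate_def by simp
qed

lemma points_subset: "L \<in> PGL2_points R \<Longrightarrow> L \<subseteq> carrier (Mat2 R)"
  using Md.submoduleE(1) unfolding PGL2_points_def by blast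

lemma points_submodule: "L \<in> PGL2_points R \<Longrightarrow> submodule L R (Mat2 R)"
  unfolding PGL2_points_def by blast

text \<open>Each \<open>f\<close> of the cover has a power divisible by the determinant of an
  element of \<open>L\<close>, so an ideal containing all determinants contains a power of every
  \<open>f\<close>.\<close>

lemma points_dets_generate:
  assumes L: "L \<in> PGL2_points R"
  shows "dets_generate R L"
  unfolding dets_generate_def
proof (intro allI impI)
  fix I assume I: "ideal I R" and sub: "det2 R ` L \<subseteq> I"
  obtain F where F: "finite F" "F \<subseteq> carrier R" "genideal R F = carrier R"
    "\<forall>f\<in>F. \<exists>g\<in>L. generated_over_localisation R L f g"
    using L unfolding PGL2_points_def by blast
  show "I = carrier R"
  proof (rule ideal_eq_carrier_of_generating_powers[OF F(1-3) I])
    fix f assume "f \<in> F"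
    then obtain g n where g: "g \<in> L" and n: "det2 R g divides f [^] (n::nat)"
      using F(4) unfolding generated_over_localisation_def by blast
    then obtain c where "c \<in> carrier R" "f [^] n = det2 R g \<otimes> c" unfolding factor_def by blast
    then have "f [^] n \<in> I" using g sub ideal.I_r_closed[OF I] by auto
    then show "\<exists>n::nat. f [^] n \<in> I" ..
  qed
qed

text \<open>Over the localisation at \<open>f\<close> both matrices are multiples of one
  \<open>k\<close>, so after multiplication by a power of \<open>f\<close> either product becomes s
  t det(k). The second order of factors is the first one for the set of adjugates of
  \<open>L\<close>.\<close>

lemma points_adj2_scalar:
  assumes L: "L \<in> PGL2_points R" and gh: "g \<in> L" "h \<in> L"
  shows "\<exists>s\<in>carrier R. adj2 R g \<boxtimes> h = s \<boxdot> \<one>\<^bsub>Mat2 R\<^esub>"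
    and "\<exists>s\<in>carrier R. h \<boxtimes> adj2 R g = s \<boxdot> \<one>\<^bsub>Mat2 R\<^esub>"
proof -
  obtain F where F: "finite F" "F \<subseteq> carrier R" "genideal R F = carrier R"
    "\<forall>f\<in>F. \<exists>g\<in>L. generated_over_localisation R L f g"
    using L unfolding PGL2_points_def by blast
  define N where "N = (\<lambda>s. s \<boxdot> \<one>\<^bsub>Mat2 R\<^esub>) ` carrier R"
  have N: "submodule N R (Mat2 R)" unfolding N_def by (rule span2_single) simp
  have c: "g \<in> carrier (Mat2 R)" "h \<in> carrier (Mat2 R)" using gh points_subset[OF L] by auto
  have loc: "\<exists>n::nat. (f [^] n) \<boxdot> (adj2 R g \<boxtimes> h) \<in> N \<and> (f [^] n) \<boxdot> (h \<boxtimes> adj2 R g) \<in> N"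
    if f: "f \<in> F" for f
  proof -
    have fc: "f \<in> carrier R" using f F by blast
    then have fp: "f [^] n \<in> carrier R" for n :: nat by simp
    obtain k where k: "k \<in> L" "generated_over_localisation R L f k" using f F(4) by blast
    then obtain n m :: nat and s t where st: "s \<in> carrier R" "t \<in> carrier R"
      "(f [^] n) \<boxdot> g = s \<boxdot> k" "(f [^] m) \<boxdot> h = t \<boxdot> k"
      using gh unfolding generated_over_localisation_def by meson
    have kc: "k \<in> carrier (Mat2 R)" using k points_subset[OF L] by auto
    have pq: "((f [^] n) \<boxdot> p) \<boxtimes> ((f [^] m) \<boxdot> q) = (f [^] (n + m)) \<boxdot> (p \<boxtimes> q)"
      "((f [^] m) \<boxdot> p) \<boxtimes> ((f [^] n) \<boxdot> q) = (f [^] (n + m)) \<boxdot> (p \<boxtimes> q)"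
      if "p \<in> carrier (Mat2 R)" "q \<in> carrier (Mat2 R)" for p q
      using that fp fc by (simp_all add: Mat2_smult Md.smult_assoc1[symmetric] nat_pow_mult Groups.add_ac)
    have "(f [^] (n + m)) \<boxdot> (adj2 R g \<boxtimes> h) = adj2 R (s \<boxdot> k) \<boxtimes> (t \<boxdot> k)"
      using pq(1)[of "adj2 R g" h] c fp unfolding st(3,4)[symmetric] by (simp add: adj2_smult)
    also have "\<dots> = (s \<otimes> (t \<otimes> det2 R k)) \<boxdot> \<one>\<^bsub>Mat2 R\<^esub>"
      using kc st(1,2)
      by (simp add: adj2_smult Mat2_smult adj2_left det2_closed m_lcomm flip: Md.smult_assoc1)
    finally have 1: "(f [^] (n + m)) \<boxdot> (adj2 R g \<boxtimes> h) \<in> N"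
      unfolding N_def using st(1,2) kc det2_closed by blast
    have "(f [^] (n + m)) \<boxdot> (h \<boxtimes> adj2 R g) = (t \<boxdot> k) \<boxtimes> adj2 R (s \<boxdot> k)"
      using pq(2)[of h "adj2 R g"] c fp unfolding st(3,4)[symmetric] by (simp add: adj2_smult)
    also have "\<dots> = (s \<otimes> (t \<otimes> det2 R k)) \<boxdot> \<one>\<^bsub>Mat2 R\<^esub>"
      using kc st(1,2)
      by (simp add: adj2_smult Mat2_smult adj2_right det2_closed m_lcomm flip: Md.smult_assoc1)
    finally show ?thesis
      using 1 unfolding N_def using st(1,2) kc det2_closed by blast
  qed
  \<comment> \<open>Being scalar is membership in the submodule \<open>N\<close>, hence can be
    tested on the cover.\<close>
  have "Z \<in> N" if Z: "Z \<in> carrier (Mat2 R)" "\<And>f. f \<in> F \<Longrightarrow> \<exists>n::nat. (f [^] n) \<boxdot> Z \<in> N" for Z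
  proof -
    have "{x \<in> carrier R. x \<boxdot> Z \<in> N} = carrier R"
      by (rule ideal_eq_carrier_of_generating_powers[OF F(1-3) Md.submodule_colon_ideal[OF N Z(1)]])
        (use Z(2) F(2) in auto)
    then have "\<one> \<boxdot> Z \<in> N" by blast
    then show ?thesis using Z by simp
  qed
  then have "adj2 R g \<boxtimes> h \<in> N" "h \<boxtimes> adj2 R g \<in> N"
    using loc c by (meson Mt.m_closed adj2_closed)+
  then show "\<exists>s\<in>carrier R. adj2 R g \<boxtimes> h = s \<boxdot> \<one>\<^bsub>Mat2 R\<^esub>" "\<exists>s\<in>carrier R. h \<boxtimes> adj2 R g = s \<boxdot> \<one>\<^bsub>Mat2 R\<^esub>"
    unfolding N_def by auto
qed

text \<open>Formulated for a set of matrices satisfying \<open>scal\<close> rather than for a point,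
  because it is applied to a point and also to the set of its adjugates.\<close>

lemma conj_exists:
  assumes L: "L \<subseteq> carrier (Mat2 R)" "dets_generate R L"
    and scal: "\<And>g h. g \<in> L \<Longrightarrow> h \<in> L \<Longrightarrow> \<exists>s\<in>carrier R. adj2 R g \<boxtimes> h = s \<boxdot> \<one>\<^bsub>Mat2 R\<^esub>"
    and V: "V \<in> sl2 R"
  shows "\<exists>W\<in>sl2 R. \<forall>g\<in>L. W \<boxtimes> g = g \<boxtimes> V"
proof -
  have Vc: "V \<in> carrier (Mat2 R)" using V by (rule sl2_carrier)
  have Lg: "g \<in> carrier (Mat2 R)" if "g \<in> L" for g using that L(1) by blast
  define I where "I = {r \<in> carrier R. \<exists>W\<in>sl2 R. \<forall>g\<in>L. W \<boxtimes> g = r \<boxdot> (g \<boxtimes> V)}"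
  have "ideal I R"
  proof (rule cring_idealI)
    show "I \<subseteq> carrier R" unfolding I_def by blast
    have "\<forall>g\<in>L. \<zero>\<^bsub>Mat2 R\<^esub> \<boxtimes> g = \<zero> \<boxdot> (g \<boxtimes> V)" using Lg Vc by simp
    moreover have "\<zero>\<^bsub>Mat2 R\<^esub> \<in> sl2 R" by (simp add: Mat2_zero)
    ultimately show "\<zero> \<in> I" unfolding I_def by blast
  next
    fix x y assume "x \<in> I" "y \<in> I"
    then obtain W W' where W: "x \<in> carrier R" "W \<in> sl2 R" "\<forall>g\<in>L. W \<boxtimes> g = x \<boxdot> (g \<boxtimes> V)"
      and W': "y \<in> carrier R" "W' \<in> sl2 R" "\<forall>g\<in>L. W' \<boxtimes> g = y \<boxdot> (g \<boxtimes> V)" unfolding I_def by blast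
    have "\<forall>g\<in>L. (W \<boxplus> W') \<boxtimes> g = (x \<oplus> y) \<boxdot> (g \<boxtimes> V)"
      using W W' Lg Vc sl2_carrier by (simp add: Mt.l_distr Md.smult_l_distr)
    moreover have "W \<boxplus> W' \<in> sl2 R" using W(2) W'(2) by simp
    ultimately show "x \<oplus> y \<in> I" unfolding I_def using W(1) W'(1) by blast
  next
    fix r x assume r: "r \<in> carrier R" and "x \<in> I"
    then obtain W where W: "x \<in> carrier R" "W \<in> sl2 R" "\<forall>g\<in>L. W \<boxtimes> g = x \<boxdot> (g \<boxtimes> V)"
      unfolding I_def by blast
    have "\<forall>g\<in>L. (r \<boxdot> W) \<boxtimes> g = (r \<otimes> x) \<boxdot> (g \<boxtimes> V)"
      using W r Lg Vc sl2_carrier[OF W(2)] by (simp add: Mat2_smult Md.smult_assoc1)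
    moreover have "r \<boxdot> W \<in> sl2 R" using W(2) r by simp
    ultimately show "r \<otimes> x \<in> I" unfolding I_def using W(1) r by blast
  qed
  \<comment> \<open>The witness is k V adj(k). Since adj(k) g is a scalar \<open>s\<close> and s k =
    det(k) g, the product k V adj(k) g becomes det(k) g V.\<close>
  moreover have "det2 R k \<in> I" if k: "k \<in> L" for k
  proof -
    have kc: "k \<in> carrier (Mat2 R)" "adj2 R k \<in> carrier (Mat2 R)" using k L by auto
    have "(k \<boxtimes> V \<boxtimes> adj2 R k) \<boxtimes> g = det2 R k \<boxdot> (g \<boxtimes> V)" if g: "g \<in> L" for g
    proof -
      have gc: "g \<in> carrier (Mat2 R)" using g L by auto
      obtain s where s: "s \<in> carrier R" "adj2 R k \<boxtimes> g = s \<boxdot> \<one>\<^bsub>Mat2 R\<^esub>" using scal[OF k g] by blast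
      have "(k \<boxtimes> V \<boxtimes> adj2 R k) \<boxtimes> g = (k \<boxtimes> V) \<boxtimes> (adj2 R k \<boxtimes> g)"
        using kc gc Vc by (simp add: Mt.m_assoc)
      also have "\<dots> = (s \<boxdot> k) \<boxtimes> V" unfolding s(2) using kc Vc s(1) by (simp add: Mat2_smult)
      also have "s \<boxdot> k = det2 R k \<boxdot> g" using det_smult_eq[OF kc(1) gc s] by simp
      finally show ?thesis using gc Vc kc det2_closed by (simp add: Mat2_smult)
    qed
    then show ?thesis unfolding I_def using conj_sl2[OF kc(1) V] det2_closed[OF kc(1)] by blast
  qed
  ultimately have "\<one> \<in> I" using L(2) unfolding dets_generate_def by blast
  then obtain W where "W \<in> sl2 R" "\<forall>g\<in>L. W \<boxtimes> g = \<one> \<boxdot> (g \<boxtimes> V)" unfolding I_def by blast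
  then show ?thesis using Lg Vc by (intro bexI[of _ W]) simp_all
qed

end

context half_cring_invol
begin

text \<open>The images supplied by \<open>conj_exists\<close> are collected by choice. They are
  unique because the point acts faithfully, and this uniqueness yields additivity, semilinearity and
  compatibility with brackets; the adjugates of \<open>L\<close> supply preimages.\<close>

lemma points_are_intertwiners:
  assumes L: "L \<in> PGL2_points R"
  shows "\<exists>A. sl2_semi R \<tau> A \<and> intertwiners R \<tau> A = L"
proof -
  note Lc = points_subset[OF L]
  have Lg: "g \<in> carrier (Mat2 R)" if "g \<in> L" for g using that Lc by blast
  note dets = points_dets_generate[OF L]
  have "\<exists>W\<in>sl2 R. \<forall>g\<in>L. W \<boxtimes> g = g \<boxtimes> map_mat2 \<tau> V" if "V \<in> sl2 R" for V
    by (rule conj_exists[OF Lc dets points_adj2_scalar(1)[OF L]]) (use that in auto)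
  then obtain A where A: "\<And>V. V \<in> sl2 R \<Longrightarrow> A V \<in> sl2 R"
    "\<And>V g. V \<in> sl2 R \<Longrightarrow> g \<in> L \<Longrightarrow> A V \<boxtimes> g = g \<boxtimes> map_mat2 \<tau> V" by metis
  have Ac: "A V \<in> carrier (Mat2 R)" "map_mat2 \<tau> V \<in> carrier (Mat2 R)" "V \<in> carrier (Mat2 R)"
    if "V \<in> sl2 R" for V
    using sl2_carrier A(1) that by auto
  \<comment> \<open>Recognises \<open>A V\<close> by its action on the point; the algebraic laws of
    \<open>A\<close> below all follow from this.\<close>
  have eqI: "A V = W" if "V \<in> sl2 R" "W \<in> carrier (Mat2 R)" "\<And>g. g \<in> L \<Longrightarrow> W \<boxtimes> g = g \<boxtimes> map_mat2 \<tau> V" for V W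
    by (rule dets_faithful[OF dets Lc]) (use that A(2) Ac in auto)
  have adjs: "adj2 R ` L \<subseteq> carrier (Mat2 R)" "dets_generate R (adj2 R ` L)"
    using Lc dets_generate_adj2[OF dets Lc] by auto
  \<comment> \<open>Cancellation on the other side is faithfulness for the adjugates, which have the
    same determinants.\<close>
  have left: "V = W" if VW: "V \<in> carrier (Mat2 R)" "W \<in> carrier (Mat2 R)" "\<And>g. g \<in> L \<Longrightarrow> g \<boxtimes> V = g \<boxtimes> W" for V W
  proof -
    have "adj2 R V = adj2 R W"
    proof (rule dets_faithful[OF adjs(2,1)])
      fix k assume "k \<in> adj2 R ` L"
      then obtain g where g: "g \<in> L" "k = adj2 R g" by blast
      have gc: "g \<in> carrier (Mat2 R)" using g Lc by blast
      show "adj2 R V \<boxtimes> k = adj2 R W \<boxtimes> k"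
        unfolding g(2) adj2_mult[OF gc VW(1), symmetric] adj2_mult[OF gc VW(2), symmetric]
        using VW(3)[OF g(1)] by simp
    qed (use VW in auto)
    then show ?thesis using VW adj2_adj2 by metis
  qed
  have inj: "inj_on A (sl2 R)"
  proof (rule inj_onI)
    fix V W assume VW: "V \<in> sl2 R" "W \<in> sl2 R" "A V = A W"
    have "map_mat2 \<tau> V = map_mat2 \<tau> W"
      by (rule left) (use VW Ac A(2) in \<open>auto simp flip: A(2)\<close>)
    then show "V = W" using VW map_tau_tau sl2_carrier by metis
  qed
  \<comment> \<open>Existence for the adjugates gives V adj(g) = adj(g) W. Taking adjugates once
    more turns this into g V = W g, so \<tau>(V) is a preimage of \<open>W\<close>.\<close>
  have surj: "\<exists>V\<in>sl2 R. A V = W" if W: "W \<in> sl2 R" for W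
  proof -
    have "\<exists>V\<in>sl2 R. \<forall>g\<in>adj2 R ` L. V \<boxtimes> g = g \<boxtimes> W"
    proof (rule conj_exists[OF adjs _ W])
      fix g h assume "g \<in> adj2 R ` L" "h \<in> adj2 R ` L"
      then obtain g' h' where gh: "g' \<in> L" "g = adj2 R g'" "h' \<in> L" "h = adj2 R h'" by blast
      show "\<exists>s\<in>carrier R. adj2 R g \<boxtimes> h = s \<boxdot> \<one>\<^bsub>Mat2 R\<^esub>"
        unfolding gh(2,4) adj2_adj2[OF Lg[OF gh(1)]] by (rule points_adj2_scalar(2)[OF L gh(3,1)])
    qed
    then obtain V where V: "V \<in> sl2 R" "\<forall>g\<in>L. V \<boxtimes> adj2 R g = adj2 R g \<boxtimes> W" by blast
    have "A (map_mat2 \<tau> V) = W"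
    proof (rule eqI)
      fix g assume g: "g \<in> L"
      have gc: "g \<in> carrier (Mat2 R)" using g Lc by blast
      have c: "V \<in> carrier (Mat2 R)" "W \<in> carrier (Mat2 R)" using V W sl2_carrier by auto
      have "adj2 R (V \<boxtimes> adj2 R g) = g \<boxtimes> (\<boxminus> V)"
        using c gc V(1) by (simp add: adj2_mult adj2_adj2 adj2_sl2)
      moreover have "adj2 R (adj2 R g \<boxtimes> W) = (\<boxminus> W) \<boxtimes> g"
        using c gc W by (simp add: adj2_mult adj2_adj2 adj2_sl2)
      ultimately have "\<boxminus> (g \<boxtimes> V) = \<boxminus> (W \<boxtimes> g)"
        using V(2) g c gc by (simp add: Mt.l_minus Mt.r_minus)
      then have "g \<boxtimes> V = W \<boxtimes> g" using c gc by (metis Mt.minus_minus Mt.m_closed)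
      then show "W \<boxtimes> g = g \<boxtimes> map_mat2 \<tau> (map_mat2 \<tau> V)" using map_tau_tau c by simp
    qed (use V W sl2_carrier in auto)
    then show ?thesis using V(1) by blast
  qed
  have A_comm: "A (comm2 R V W) = comm2 R (A V) (A W)" if VW: "V \<in> sl2 R" "W \<in> sl2 R" for V W
  proof (rule eqI)
    fix g assume g: "g \<in> L"
    have gc: "g \<in> carrier (Mat2 R)" using g Lc by blast
    note c = Ac[OF VW(1)] Ac[OF VW(2)] gc
    \<comment> \<open>The commutator is built from products that leave \<open>sl2\<close>, so the
      intertwining relation is first extended to such products.\<close>
    have prod: "(A P \<boxtimes> A Q) \<boxtimes> g = g \<boxtimes> (map_mat2 \<tau> P \<boxtimes> map_mat2 \<tau> Q)"
      if PQ: "P \<in> sl2 R" "Q \<in> sl2 R" for P Q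
    proof -
      note c' = Ac[OF PQ(1)] Ac[OF PQ(2)] gc
      have "(A P \<boxtimes> A Q) \<boxtimes> g = (A P \<boxtimes> g) \<boxtimes> map_mat2 \<tau> Q"
        using c' A(2)[OF PQ(2) g] by (simp add: Mt.m_assoc)
      also have "\<dots> = g \<boxtimes> (map_mat2 \<tau> P \<boxtimes> map_mat2 \<tau> Q)"
        unfolding A(2)[OF PQ(1) g] using c' by (simp add: Mt.m_assoc)
      finally show ?thesis .
    qed
    have "comm2 R (A V) (A W) \<boxtimes> g = ((A V \<boxtimes> A W) \<boxtimes> g) \<boxplus> (\<boxminus> ((A W \<boxtimes> A V) \<boxtimes> g))"
      unfolding comm2_def a_minus_def using c by (simp add: Mt.l_distr Mt.l_minus)
    also have "\<dots> = g \<boxtimes> comm2 R (map_mat2 \<tau> V) (map_mat2 \<tau> W)"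
      unfolding prod[OF VW] prod[OF VW(2,1)] comm2_def a_minus_def
      using c by (simp add: Mt.r_distr Mt.r_minus)
    finally show "comm2 R (A V) (A W) \<boxtimes> g = g \<boxtimes> map_mat2 \<tau> (comm2 R V W)"
      by (simp add: T.map_mat2_comm2[OF VW])
  qed (use VW A(1) comm2_closed sl2_carrier in auto)
  have semi: "sl2_semi R \<tau> A"
    unfolding sl2_semi_def
  proof (intro conjI ballI)
    show "bij_betw A (sl2 R) (sl2 R)"
      unfolding bij_betw_def using inj surj A(1) by (auto simp: image_iff) metis
    show "A (V \<boxplus> W) = A V \<boxplus> A W" if VW: "V \<in> sl2 R" "W \<in> sl2 R" for V W
    proof (rule eqI)
      show "(A V \<boxplus> A W) \<boxtimes> g = g \<boxtimes> map_mat2 \<tau> (V \<boxplus> W)" if "g \<in> L" for g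
        using VW A(2) Ac Lg[OF that] that by (simp add: T.map_mat2_add Mt.l_distr Mt.r_distr)
    qed (use VW Ac in auto)
    show "A (s \<boxdot> V) = \<tau> s \<boxdot> A V" if V: "s \<in> carrier R" "V \<in> sl2 R" for V s
    proof (rule eqI)
      show "(\<tau> s \<boxdot> A V) \<boxtimes> g = g \<boxtimes> map_mat2 \<tau> (s \<boxdot> V)" if "g \<in> L" for g
        using V A(2) Ac Lg[OF that] that by (simp add: T.map_mat2_smult Mat2_smult)
    qed (use V Ac in auto)
  qed (rule A_comm)
  \<comment> \<open>Up to here \<open>L\<close> is only contained in the intertwiners; equality is
    the maximality criterion for the submodule \<open>L\<close>.\<close>
  have "L \<subseteq> intertwiners R \<tau> A" unfolding intertwiners_def using Lc A(2) by blast
  from submodule_eq_intertwiners[OF semi points_submodule[OF L] this dets] semi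
  show ?thesis by metis
qed

text \<open>Both maps act on the common intertwiners in the same way, and these act
  faithfully.\<close>

lemma intertwiners_inj:
  assumes A: "sl2_semi R \<tau> A" and B: "sl2_semi R \<tau> B"
    and eq: "intertwiners R \<tau> A = intertwiners R \<tau> B" and V: "V \<in> sl2 R"
  shows "A V = B V"
proof (rule dets_faithful)
  let ?L = "intertwiners R \<tau> A"
  show "dets_generate R ?L" by (rule points_dets_generate[OF intertwiners_in_points[OF A]])
  show "?L \<subseteq> carrier (Mat2 R)" by (rule points_subset[OF intertwiners_in_points[OF A]])
  show "A V \<boxtimes> g = B V \<boxtimes> g" if "g \<in> ?L" for g
    using that V intertwinersD(2)[OF A, of g V] intertwinersD(2)[OF B, of g V] eq by simp
qed (use V A B sl2_semiD(2) sl2_carrier in blast)+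

lemma intertwiners_id:
  assumes "\<And>s. s \<in> carrier R \<Longrightarrow> \<tau> s = s" "\<And>V. V \<in> sl2 R \<Longrightarrow> A V = V" "sl2_semi R \<tau> A"
  shows "intertwiners R \<tau> A = span2 R {\<one>\<^bsub>Mat2 R\<^esub>}"
proof (rule submodule_eq_intertwiners[symmetric, OF assms(3)])
  show sub: "submodule (span2 R {\<one>\<^bsub>Mat2 R\<^esub>}) R (Mat2 R)" by (rule span2_submodule) simp
  have t: "map_mat2 \<tau> V = V" if "V \<in> sl2 R" for V
    using that assms(1) by (elim sl2_cases) simp
  have "\<one>\<^bsub>Mat2 R\<^esub> \<in> intertwiners R \<tau> A"
    unfolding intertwiners_def using assms(2) t sl2_carrier by simp
  then show "span2 R {\<one>\<^bsub>Mat2 R\<^esub>} \<subseteq> intertwiners R \<tau> A"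
    by (intro span2_minimal intertwiners_submodule[OF assms(3)]) simp
  show "dets_generate R (span2 R {\<one>\<^bsub>Mat2 R\<^esub>})"
  proof (rule dets_generate_mono[OF _ span2_subset])
    have "det2 R \<one>\<^bsub>Mat2 R\<^esub> = \<one>" by (simp add: Mat2_one det2_def a_minus_def)
    then show "dets_generate R {\<one>\<^bsub>Mat2 R\<^esub>}"
      unfolding dets_generate_def using ideal.one_imp_carrier by fastforce
  qed
qed

end

section \<open>Intertwiners under base change and composition\<close>

lemma (in ring_hom_cring) ideal_vimage:
  assumes "ideal I S"
  shows "ideal {r \<in> carrier R. h r \<in> I} R"
proof -
  interpret I: ideal I S by fact
  show ?thesis
    by (rule R.cring_idealI) (use I.I_l_closed in auto)
qed

text \<open>A test ideal of \<open>S\<close> is pulled back along \<open>h\<close> and then contains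
  the determinants of \<open>L\<close>, hence 1.\<close>

lemma (in ring_hom_cring) dets_generate_map:
  assumes "dets_generate R L" "L \<subseteq> carrier (Mat2 R)"
  shows "dets_generate S (map_mat2 h ` L)"
  unfolding dets_generate_def
proof (intro allI impI)
  fix I assume I: "ideal I S" and sub: "det2 S ` map_mat2 h ` L \<subseteq> I"
  have "det2 R ` L \<subseteq> {r \<in> carrier R. h r \<in> I}"
  proof clarify
    fix g assume g: "g \<in> L"
    then have gc: "g \<in> carrier (Mat2 R)" using assms(2) by blast
    have "det2 S (map_mat2 h g) \<in> I" using sub g by blast
    then show "det2 R g \<in> carrier R \<and> h (det2 R g) \<in> I"
      using R.det2_closed[OF gc] map_mat2_det2[OF gc] by simp
  qed
  then have "\<one> \<in> {r \<in> carrier R. h r \<in> I}"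
    using assms(1) ideal_vimage[OF I] unfolding dets_generate_def by blast
  then show "I = carrier S" by (intro ideal.one_imp_carrier[OF I]) simp
qed

text \<open>Images of intertwiners intertwine \<open>B\<close>, first for E and F and then in
  general, and their determinants still generate; the maximality criterion identifies the
  span.\<close>

lemma intertwiners_base_change:
  assumes hom: "ring_hom_cring R S h" and R: "half_cring_invol R \<tau>" and S: "half_cring_invol S \<sigma>"
    and eq: "\<And>s. s \<in> carrier R \<Longrightarrow> h (\<tau> s) = \<sigma> (h s)"
    and A: "sl2_semi R \<tau> A" and B: "sl2_semi S \<sigma> B"
    and AB: "\<And>V. V \<in> sl2 R \<Longrightarrow> B (map_mat2 h V) = map_mat2 h (A V)"
  shows "intertwiners S \<sigma> B = span2 S (map_mat2 h ` intertwiners R \<tau> A)"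
proof (rule half_cring_invol.submodule_eq_intertwiners[OF S B, symmetric])
  interpret h: ring_hom_cring R S h by fact
  interpret R: half_cring_invol R \<tau> by fact
  interpret S: half_cring_invol S \<sigma> by fact
  let ?L = "intertwiners R \<tau> A"
  have Lc: "?L \<subseteq> carrier (Mat2 R)" by (auto simp: intertwiners_def)
  then have c: "map_mat2 h ` ?L \<subseteq> carrier (Mat2 S)" by blast
  show "submodule (span2 S (map_mat2 h ` ?L)) S (Mat2 S)" by (rule S.span2_submodule[OF c])
  have "map_mat2 h g \<in> intertwiners S \<sigma> B" if g: "g \<in> ?L" for g
  proof (rule S.intertwinersI[OF B])
    have gc: "g \<in> carrier (Mat2 R)" using g Lc by blast
    have *: "B (map_mat2 h V) \<boxtimes>\<^bsub>S\<^esub> map_mat2 h g = map_mat2 h g \<boxtimes>\<^bsub>S\<^esub> map_mat2 h (map_mat2 \<tau> V)"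
      if V: "V \<in> sl2 R" for V
    proof -
      have "A V \<boxtimes>\<^bsub>R\<^esub> g = g \<boxtimes>\<^bsub>R\<^esub> map_mat2 \<tau> V" by (rule R.intertwinersD(2)[OF A g V])
      then have "map_mat2 h (A V \<boxtimes>\<^bsub>R\<^esub> g) = map_mat2 h (g \<boxtimes>\<^bsub>R\<^esub> map_mat2 \<tau> V)" by simp
      then show ?thesis
        using gc V h.R.sl2_carrier[OF V] h.R.sl2_carrier[OF sl2_semiD(2)[OF A V]]
        by (simp add: AB h.map_mat2_mult)
    qed
    show "B (matE S) \<boxtimes>\<^bsub>S\<^esub> map_mat2 h g = map_mat2 h g \<boxtimes>\<^bsub>S\<^esub> matE S"
      using *[OF h.R.matEFH(1)] by (simp add: h.map_mat2_EFH R.T.map_mat2_EFH)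
    show "B (matF S) \<boxtimes>\<^bsub>S\<^esub> map_mat2 h g = map_mat2 h g \<boxtimes>\<^bsub>S\<^esub> matF S"
      using *[OF h.R.matEFH(2)] by (simp add: h.map_mat2_EFH R.T.map_mat2_EFH)
    show "map_mat2 h g \<in> carrier (Mat2 S)" using gc by simp
  qed
  then show "span2 S (map_mat2 h ` ?L) \<subseteq> intertwiners S \<sigma> B"
    by (intro S.span2_minimal S.intertwiners_submodule[OF B]) auto
  show "dets_generate S (span2 S (map_mat2 h ` ?L))"
    by (rule S.dets_generate_mono[OF h.dets_generate_map[OF
          R.points_dets_generate[OF R.intertwiners_in_points[OF A]] Lc] S.span2_subset])
qed

lemma sl2_semi_compose:
  assumes T: "half_cring_invol R \<tau>" and S: "half_cring_invol R \<sigma>"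
    and eq: "\<And>s. s \<in> carrier R \<Longrightarrow> \<rho> s = \<tau> (\<sigma> s)"
    and A: "sl2_semi R \<tau> A" and B: "sl2_semi R \<sigma> B"
    and C: "\<And>V. V \<in> sl2 R \<Longrightarrow> C V = A (B V)"
  shows "sl2_semi R \<rho> C"
proof -
  interpret T: half_cring_invol R \<tau> by fact
  interpret S: half_cring_invol R \<sigma> by fact
  have "bij_betw (A \<circ> B) (sl2 R) (sl2 R)"
    using bij_betw_trans[OF sl2_semiD(1)[OF B] sl2_semiD(1)[OF A]] .
  moreover have "bij_betw C (sl2 R) (sl2 R) \<longleftrightarrow> bij_betw (A \<circ> B) (sl2 R) (sl2 R)"
    by (rule bij_betw_cong) (simp add: C)
  ultimately show ?thesis
    unfolding sl2_semi_def
    by (simp add: C eq sl2_semiD(2-6)[OF A] sl2_semiD(2-6)[OF B] T.comm2_closed)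
qed

text \<open>A(B(V)) g \<tau>(h) = g \<tau>(B(V) h) = g \<tau>(h) \<tau>(\<sigma>(V)). Moving
  \<open>g\<close> past B(V) thus forces the twist of the second factor, and this twist is the
  action in the semidirect product.\<close>

lemma intertwiners_compose:
  assumes T: "half_cring_invol R \<tau>" and S: "half_cring_invol R \<sigma>" and P: "half_cring_invol R \<rho>"
    and eq: "\<And>s. s \<in> carrier R \<Longrightarrow> \<rho> s = \<tau> (\<sigma> s)"
    and A: "sl2_semi R \<tau> A" and B: "sl2_semi R \<sigma> B"
    and C: "\<And>V. V \<in> sl2 R \<Longrightarrow> C V = A (B V)"
  shows "intertwiners R \<rho> C =
    span2 R (set_mult (Mat2 R) (intertwiners R \<tau> A) (map_mat2 \<tau> ` intertwiners R \<sigma> B))"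
proof (rule half_cring_invol.submodule_eq_intertwiners[OF P _, symmetric])
  interpret T: half_cring_invol R \<tau> by fact
  interpret S: half_cring_invol R \<sigma> by fact
  interpret P: half_cring_invol R \<rho> by fact
  show semi: "sl2_semi R \<rho> C" by (rule sl2_semi_compose[OF T S eq A B C])
  let ?P = "set_mult (Mat2 R) (intertwiners R \<tau> A) (map_mat2 \<tau> ` intertwiners R \<sigma> B)"
  have Ic: "intertwiners R \<tau> A \<subseteq> carrier (Mat2 R)" "intertwiners R \<sigma> B \<subseteq> carrier (Mat2 R)"
    by (auto simp: intertwiners_def)
  have sub: "?P \<subseteq> intertwiners R \<rho> C"
  proof
    fix k assume "k \<in> ?P"
    then obtain g h where gh: "g \<in> intertwiners R \<tau> A" "h \<in> intertwiners R \<sigma> B"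
      "k = g \<boxtimes>\<^bsub>R\<^esub> map_mat2 \<tau> h" unfolding set_mult_def by blast
    then have c: "g \<in> carrier (Mat2 R)" "h \<in> carrier (Mat2 R)" "map_mat2 \<tau> h \<in> carrier (Mat2 R)"
      using Ic by auto
    have "C V \<boxtimes>\<^bsub>R\<^esub> k = k \<boxtimes>\<^bsub>R\<^esub> map_mat2 \<rho> V" if V: "V \<in> sl2 R" for V
    proof -
      have BV: "B V \<in> sl2 R" "A (B V) \<in> sl2 R" "map_mat2 \<sigma> V \<in> sl2 R"
        using V sl2_semiD(2)[OF A] sl2_semiD(2)[OF B] by auto
      note cV = BV[THEN T.sl2_carrier] T.sl2_carrier[OF V]
      have "C V \<boxtimes>\<^bsub>R\<^esub> k = (A (B V) \<boxtimes>\<^bsub>R\<^esub> g) \<boxtimes>\<^bsub>R\<^esub> map_mat2 \<tau> h"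
        unfolding gh(3) C[OF V] using c cV by (simp add: T.Mt.m_assoc)
      also have "\<dots> = g \<boxtimes>\<^bsub>R\<^esub> map_mat2 \<tau> (B V \<boxtimes>\<^bsub>R\<^esub> h)"
        unfolding T.intertwinersD(2)[OF A gh(1) BV(1)] using c cV by (simp add: T.Mt.m_assoc T.T.map_mat2_mult)
      also have "\<dots> = k \<boxtimes>\<^bsub>R\<^esub> map_mat2 \<tau> (map_mat2 \<sigma> V)"
        unfolding S.intertwinersD(2)[OF B gh(2) V] gh(3) using c cV
        by (simp add: T.Mt.m_assoc T.T.map_mat2_mult)
      also have "map_mat2 \<tau> (map_mat2 \<sigma> V) = map_mat2 \<rho> V"
        using V by (elim T.sl2_cases) (simp add: eq)
      finally show ?thesis .
    qed
    then show "k \<in> intertwiners R \<rho> C" unfolding intertwiners_def gh(3) using c by simp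
  qed
  then have Pc: "?P \<subseteq> carrier (Mat2 R)" by (auto simp: intertwiners_def)
  show "submodule (span2 R ?P) R (Mat2 R)" by (rule T.span2_submodule[OF Pc])
  show "span2 R ?P \<subseteq> intertwiners R \<rho> C"
    by (rule T.span2_minimal[OF P.intertwiners_submodule[OF semi] sub])
  have "dets_generate R ?P"
    unfolding dets_generate_def
  proof (intro allI impI)
    fix I assume I: "ideal I R" and I_sub: "det2 R ` ?P \<subseteq> I"
    note dA = T.points_dets_generate[OF T.intertwiners_in_points[OF A]]
    note dB = T.T.dets_generate_map[OF T.points_dets_generate[OF S.intertwiners_in_points[OF B]] Ic(2)]
    \<comment> \<open>Determinants of products are handled one factor at a time: for fixed
      \<open>g\<close> the x with det(g) x in \<open>I\<close> form an ideal containing all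
      determinants of the second factor, hence 1.\<close>
    have "det2 R g \<in> I" if g: "g \<in> intertwiners R \<tau> A" for g
    proof -
      have gc: "g \<in> carrier (Mat2 R)" using g Ic by blast
      have "det2 R ` map_mat2 \<tau> ` intertwiners R \<sigma> B \<subseteq> {x \<in> carrier R. det2 R g \<otimes>\<^bsub>R\<^esub> x \<in> I}"
      proof (rule subsetI)
        fix d assume "d \<in> det2 R ` map_mat2 \<tau> ` intertwiners R \<sigma> B"
        then obtain h where h: "h \<in> intertwiners R \<sigma> B" and d: "d = det2 R (map_mat2 \<tau> h)" by blast
        then have c: "map_mat2 \<tau> h \<in> carrier (Mat2 R)" using Ic by auto
        have "det2 R (g \<boxtimes>\<^bsub>R\<^esub> map_mat2 \<tau> h) \<in> I"
          using I_sub g h unfolding set_mult_def by blast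
        then show "d \<in> {x \<in> carrier R. det2 R g \<otimes>\<^bsub>R\<^esub> x \<in> I}"
          using gc c T.det2_closed by (simp add: d T.det2_mult)
      qed
      then have "\<one>\<^bsub>R\<^esub> \<in> {x \<in> carrier R. det2 R g \<otimes>\<^bsub>R\<^esub> x \<in> I}"
        using dB T.cring_ideal_colon[OF I T.det2_closed[OF gc]] unfolding dets_generate_def by blast
      then show ?thesis using T.det2_closed[OF gc] by simp
    qed
    then show "I = carrier R" using dA I unfolding dets_generate_def by blast
  qed
  then show "dets_generate R (span2 R ?P)" by (rule T.dets_generate_mono[OF _ T.span2_subset])
qed


section \<open>The centroid and the algebra of pairs\<close>

context half_cring
begin

text \<open>C(H) commutes with H because [H,H] = 0; as 2 is invertible, it is diagonal, say p H.
  Then [H, sE] = 2 sE and [H, sF] = -2 sF give the factor \<open>p\<close> on sE and sF, and [sE, F]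
  = sH gives it on sH. Since \<open>C\<close> is only additive, the scalar s stays inside the
  argument throughout.\<close>

lemma sl2_centroid:
  assumes C: "\<And>V. V \<in> sl2 R \<Longrightarrow> C V \<in> sl2 R"
    and add: "\<And>V W. V \<in> sl2 R \<Longrightarrow> W \<in> sl2 R \<Longrightarrow> C (V \<boxplus> W) = C V \<boxplus> C W"
    and comm: "\<And>V W. V \<in> sl2 R \<Longrightarrow> W \<in> sl2 R \<Longrightarrow> C (comm2 R V W) = comm2 R (C V) W"
  shows "\<exists>c\<in>carrier R. \<forall>V\<in>sl2 R. C V = c \<boxdot> V"
proof -
  have "C \<zero>\<^bsub>Mat2 R\<^esub> = \<zero>\<^bsub>Mat2 R\<^esub>"
  proof -
    have z: "\<zero>\<^bsub>Mat2 R\<^esub> \<in> sl2 R" by (simp add: Mat2_zero)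
    have "C \<zero>\<^bsub>Mat2 R\<^esub> \<boxplus> C \<zero>\<^bsub>Mat2 R\<^esub> = C \<zero>\<^bsub>Mat2 R\<^esub>" using add[OF z z] by simp
    then show ?thesis using sl2_carrier[OF C[OF z]] by (metis Mt.add.r_cancel_one')
  qed
  obtain p q r where CH: "C (matH R) = (p, q, r, \<ominus> p)" "p \<in> carrier R" "q \<in> carrier R" "r \<in> carrier R"
    using C[OF matEFH(3)] by (rule sl2_cases)
  have "comm2 R (matH R) (matH R) = \<zero>\<^bsub>Mat2 R\<^esub>"
    unfolding matH_def by (simp add: comm2_simp a_minus_def Mat2_zero r_neg)
  then have 0: "comm2 R (p, q, r, \<ominus> p) (matH R) = \<zero>\<^bsub>Mat2 R\<^esub>"
    using comm[OF matEFH(3,3)] \<open>C \<zero>\<^bsub>Mat2 R\<^esub> = \<zero>\<^bsub>Mat2 R\<^esub>\<close> CH(1) by simp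
  have "comm2 R (p, q, r, \<ominus> p) (matH R) = (\<zero>, \<ominus> (q \<oplus> q), r \<oplus> r, \<zero>)"
    unfolding matH_def using CH(2-) by (simp add: comm2_simp a_minus_def minus_add l_minus r_minus)
  with 0 have "\<ominus> (q \<oplus> q) = \<zero>" "r \<oplus> r = \<zero>" by (simp_all add: Mat2_zero)
  then have qr: "q = \<zero>" "r = \<zero>"
    using double_zero CH(3,4) by (metis a_closed minus_minus minus_zero)+
  have CH': "C (matH R) = (p, \<zero>, \<zero>, \<ominus> p)" using CH(1) qr by simp
  have CE: "C (s \<boxdot> matE R) = p \<boxdot> (s \<boxdot> matE R)" if s: "s \<in> carrier R" for s
  proof -
    obtain x y z where W: "C (s \<boxdot> matE R) = (x, y, z, \<ominus> x)" "x \<in> carrier R" "y \<in> carrier R" "z \<in> carrier R"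
      using C[OF sl2_smult[OF s matEFH(1)]] by (rule sl2_cases)
    have "comm2 R (matH R) (s \<boxdot> matE R) = (s \<boxdot> matE R) \<boxplus> (s \<boxdot> matE R)"
      unfolding matH_def matE_def using s by (simp add: comm2_simp a_minus_def l_minus r_minus)
    then have "C (s \<boxdot> matE R) \<boxplus> C (s \<boxdot> matE R) = comm2 R (C (matH R)) (s \<boxdot> matE R)"
      using comm[OF matEFH(3) sl2_smult[OF s matEFH(1)]] add[OF sl2_smult[OF s matEFH(1)] sl2_smult[OF s matEFH(1)]] by simp
    also have "\<dots> = (\<zero>, p \<otimes> s \<oplus> p \<otimes> s, \<zero>, \<zero>)"
      unfolding CH' matE_def using s CH(2) by (simp add: comm2_simp a_minus_def r_minus m_comm)
    finally have "x \<oplus> x = \<zero>" "y \<oplus> y = p \<otimes> s \<oplus> p \<otimes> s" "z \<oplus> z = \<zero>" unfolding W(1) by auto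
    then have "x = \<zero>" "y = p \<otimes> s" "z = \<zero>" using W s CH(2) by (auto simp: double_zero double_eq_iff)
    then show ?thesis using W(1) s CH(2) by (simp add: matE_def)
  qed
  have CF: "C (s \<boxdot> matF R) = p \<boxdot> (s \<boxdot> matF R)" if s: "s \<in> carrier R" for s
  proof -
    obtain x y z where W: "C (s \<boxdot> matF R) = (x, y, z, \<ominus> x)" "x \<in> carrier R" "y \<in> carrier R" "z \<in> carrier R"
      using C[OF sl2_smult[OF s matEFH(2)]] by (rule sl2_cases)
    have s': "(\<ominus> s) \<boxdot> matF R \<in> sl2 R" using s by (intro sl2_smult) auto
    \<comment> \<open>[H, sF] = -2 sF is written as a vanishing sum so that additivity of
      \<open>C\<close> applies directly.\<close>
    have "(s \<boxdot> matF R) \<boxplus> ((s \<boxdot> matF R) \<boxplus> comm2 R (matH R) (s \<boxdot> matF R)) = \<zero>\<^bsub>Mat2 R\<^esub>"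
      unfolding matH_def matF_def using s
      by (simp add: comm2_simp a_minus_def l_minus minus_add Mat2_zero) algebra
    then have "C (s \<boxdot> matF R) \<boxplus> (C (s \<boxdot> matF R) \<boxplus> comm2 R (C (matH R)) (s \<boxdot> matF R)) = \<zero>\<^bsub>Mat2 R\<^esub>"
      using s by (simp add: \<open>C \<zero>\<^bsub>Mat2 R\<^esub> = \<zero>\<^bsub>Mat2 R\<^esub>\<close> comm2_closed flip: comm add)
    moreover have "comm2 R (C (matH R)) (s \<boxdot> matF R) = (\<zero>, \<zero>, \<ominus> (p \<otimes> s \<oplus> p \<otimes> s), \<zero>)"
      unfolding CH' matF_def using s CH(2) by (simp add: comm2_simp a_minus_def l_minus r_minus m_comm minus_add)
    ultimately have "x \<oplus> x = \<zero>" "y \<oplus> y = \<zero>" "z \<oplus> (z \<oplus> \<ominus> (p \<otimes> s \<oplus> p \<otimes> s)) = \<zero>"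
      unfolding W(1) Mat2_zero using W(2-) CH(2) s by auto
    moreover have "z \<oplus> z = (z \<oplus> (z \<oplus> \<ominus> (p \<otimes> s \<oplus> p \<otimes> s))) \<oplus> (p \<otimes> s \<oplus> p \<otimes> s)"
      using W(4) CH(2) s by algebra
    ultimately have "x = \<zero>" "y = \<zero>" "z = p \<otimes> s" using W s CH(2) by (auto simp: double_zero double_eq_iff)
    then show ?thesis using W(1) s CH(2) by (simp add: matF_def)
  qed
  have CsH: "C (s \<boxdot> matH R) = p \<boxdot> (s \<boxdot> matH R)" if s: "s \<in> carrier R" for s
  proof -
    have *: "s \<boxdot> matH R = comm2 R (s \<boxdot> matE R) (matF R)" if "s \<in> carrier R" for s
      unfolding matH_def matE_def matF_def using that by (simp add: comm2_simp a_minus_def r_minus)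
    have "C (s \<boxdot> matH R) = comm2 R ((p \<otimes> s) \<boxdot> matE R) (matF R)"
      unfolding *[OF s] using s CH(2) sl2_carrier[OF matEFH(1)] by (simp add: comm CE Md.smult_assoc1)
    also have "\<dots> = p \<boxdot> (s \<boxdot> matH R)"
      using s CH(2) sl2_carrier[OF matEFH(3)] by (simp add: Md.smult_assoc1 flip: *)
    finally show ?thesis .
  qed
  show ?thesis
  proof (intro bexI ballI)
    fix V assume "V \<in> sl2 R"
    then obtain x y z where V: "V = (x, y, z, \<ominus> x)" "x \<in> carrier R" "y \<in> carrier R" "z \<in> carrier R"
      by (rule sl2_cases)
    note c = matEFH[THEN sl2_carrier]
    show "C V = p \<boxdot> V"
      unfolding V(1) sl2_expand[OF V(2-)] using V(2-) CH(2) c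
      by (simp add: add CE CF CsH Md.smult_r_distr)
  qed (fact CH(2))
qed

end

context half_cring_invol
begin

lemma semi_smult_H_inj:
  assumes A: "sl2_semi R \<tau> A" and st: "s \<in> carrier R" "t \<in> carrier R"
    and eq: "s \<boxdot> A (matH R) = t \<boxdot> A (matH R)"
  shows "s = t"
proof -
  have "A (\<tau> s \<boxdot> matH R) = A (\<tau> t \<boxdot> matH R)"
    using eq st by (simp add: sl2_semiD(5)[OF A] tau_tau)
  then have "\<tau> s \<boxdot> matH R = \<tau> t \<boxdot> matH R"
    by (rule sl2_semiD(3)[OF A, rotated 2]) (use st in auto)
  then have "\<tau> s = \<tau> t" using st by (simp add: matH_def)
  then show ?thesis using tau_tau st by metis
qed

end

section \<open>The ring of pairs and its sign automorphisms\<close>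

context cring
begin

lemma bar_simps [simp]:
  "(x, y) \<otimes>\<^bsub>bar R\<^esub> (u, v) = ((x \<otimes> u) \<ominus> (y \<otimes> v), (x \<otimes> v) \<oplus> (y \<otimes> u))"
  "(x, y) \<oplus>\<^bsub>bar R\<^esub> (u, v) = (x \<oplus> u, y \<oplus> v)"
  "\<one>\<^bsub>bar R\<^esub> = (\<one>, \<zero>)" "\<zero>\<^bsub>bar R\<^esub> = (\<zero>, \<zero>)"
  "(x, y) \<in> carrier (bar R) \<longleftrightarrow> x \<in> carrier R \<and> y \<in> carrier R"
  by (simp_all add: bar_def)

lemma bar_cases:
  assumes "s \<in> carrier (bar R)"
  obtains x y where "s = (x, y)" "x \<in> carrier R" "y \<in> carrier R"
  using assms by (cases s) auto

lemma bar_cring: "cring (bar R)"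
proof (rule cringI)
  show "abelian_group (bar R)"
  proof (rule abelian_groupI)
    fix x assume "x \<in> carrier (bar R)"
    then obtain a b where x: "x = (a, b)" "a \<in> carrier R" "b \<in> carrier R" by (rule bar_cases)
    then have "(\<ominus> a, \<ominus> b) \<oplus>\<^bsub>bar R\<^esub> x = \<zero>\<^bsub>bar R\<^esub>" "(\<ominus> a, \<ominus> b) \<in> carrier (bar R)" by (simp_all add: l_neg)
    then show "\<exists>y\<in>carrier (bar R). y \<oplus>\<^bsub>bar R\<^esub> x = \<zero>\<^bsub>bar R\<^esub>" by blast
  qed (auto elim!: bar_cases simp: a_ac)
  show "comm_monoid (bar R)"
  proof (rule comm_monoidI)
    fix x y z assume "x \<in> carrier (bar R)" "y \<in> carrier (bar R)" "z \<in> carrier (bar R)"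
    then show "x \<otimes>\<^bsub>bar R\<^esub> y \<otimes>\<^bsub>bar R\<^esub> z = x \<otimes>\<^bsub>bar R\<^esub> (y \<otimes>\<^bsub>bar R\<^esub> z)"
      by (elim bar_cases) (simp, intro conjI; algebra)
  qed (auto elim!: bar_cases simp: a_minus_def m_comm a_comm)
  fix x y z assume "x \<in> carrier (bar R)" "y \<in> carrier (bar R)" "z \<in> carrier (bar R)"
  then show "(x \<oplus>\<^bsub>bar R\<^esub> y) \<otimes>\<^bsub>bar R\<^esub> z = x \<otimes>\<^bsub>bar R\<^esub> z \<oplus>\<^bsub>bar R\<^esub> y \<otimes>\<^bsub>bar R\<^esub> z"
    by (elim bar_cases) (simp, intro conjI; algebra)
qed

lemma bar_uminus [simp]:
  assumes "x \<in> carrier R" "y \<in> carrier R"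
  shows "\<ominus>\<^bsub>bar R\<^esub> (x, y) = (\<ominus> x, \<ominus> y)"
proof -
  interpret B: cring "bar R" by (rule bar_cring)
  show ?thesis by (rule B.minus_equality) (use assms in \<open>auto simp: l_neg\<close>)
qed

lemma bar_aut_simp [simp]: "bar_aut R b (x, y) = (x, b \<otimes> y)"
  by (simp add: bar_aut_def)

lemma mu2_iff: "b \<in> carrier (mu2 R) \<longleftrightarrow> b \<in> carrier R \<and> b \<otimes> b = \<one>"
  unfolding mu2_def by (auto simp: Units_def)

lemma bar_aut_hom: "b \<in> carrier (mu2 R) \<Longrightarrow> bar_aut R b \<in> ring_hom (bar R) (bar R)"
proof (rule ring_hom_memI)
  assume b: "b \<in> carrier (mu2 R)"
  then have bc: "b \<in> carrier R" "b \<otimes> b = \<one>" by (auto simp: mu2_iff)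
  show "bar_aut R b x \<in> carrier (bar R)" if "x \<in> carrier (bar R)" for x
    using that bc by (auto elim!: bar_cases)
  show "bar_aut R b \<one>\<^bsub>bar R\<^esub> = \<one>\<^bsub>bar R\<^esub>" using bc by simp
  fix x y assume "x \<in> carrier (bar R)" "y \<in> carrier (bar R)"
  then obtain p q r s where xy: "x = (p, q)" "y = (r, s)" "p \<in> carrier R" "q \<in> carrier R"
    "r \<in> carrier R" "s \<in> carrier R" by (metis bar_cases)
  show "bar_aut R b (x \<oplus>\<^bsub>bar R\<^esub> y) = bar_aut R b x \<oplus>\<^bsub>bar R\<^esub> bar_aut R b y"
    using xy bc by (simp add: r_distr)
  have "b \<otimes> q \<otimes> (b \<otimes> s) = (b \<otimes> b) \<otimes> (q \<otimes> s)" using xy bc(1) by algebra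
  then show "bar_aut R b (x \<otimes>\<^bsub>bar R\<^esub> y) = bar_aut R b x \<otimes>\<^bsub>bar R\<^esub> bar_aut R b y"
    using xy bc by (simp add: r_distr m_lcomm m_assoc)
qed

end

context half_cring
begin

lemma bar_half_cring: "half_cring (bar R)"
proof -
  interpret B: cring "bar R" by (rule bar_cring)
  have "(half, \<zero>) \<in> carrier (bar R)" "(half, \<zero>) \<otimes>\<^bsub>bar R\<^esub> (\<one>\<^bsub>bar R\<^esub> \<oplus>\<^bsub>bar R\<^esub> \<one>\<^bsub>bar R\<^esub>) = \<one>\<^bsub>bar R\<^esub>"
    by (simp_all add: a_minus_def r_distr half_sum)
  then have "\<one>\<^bsub>bar R\<^esub> \<oplus>\<^bsub>bar R\<^esub> \<one>\<^bsub>bar R\<^esub> \<in> Units (bar R)"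
    unfolding Units_def using B.m_comm by (metis (mono_tags, lifting) B.add.m_closed B.one_closed mem_Collect_eq)
  then show ?thesis by (intro half_cring.intro bar_cring half_cring_axioms.intro)
qed

lemma bar_half_cring_invol:
  assumes "b \<in> carrier (mu2 R)"
  shows "half_cring_invol (bar R) (bar_aut R b)"
proof -
  have "bar_aut R b (bar_aut R b s) = s" if "s \<in> carrier (bar R)" for s
    using assms that by (auto elim!: bar_cases simp: mu2_iff simp flip: m_assoc)
  then show ?thesis
    by (intro half_cring_invol.intro bar_half_cring half_cring_invol_axioms.intro bar_aut_hom assms)
qed

lemma bar_aut_mult:
  assumes "b \<in> carrier R" "c \<in> carrier R" "s \<in> carrier (bar R)"
  shows "bar_aut R (b \<otimes> c) s = bar_aut R b (bar_aut R c s)"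
  using assms by (auto elim!: bar_cases simp: m_assoc)

lemma mu2_comm_group: "comm_group (mu2 R)"
proof (rule comm_groupI)
  fix x assume x: "x \<in> carrier (mu2 R)"
  then have "x \<otimes>\<^bsub>mu2 R\<^esub> x = \<one>\<^bsub>mu2 R\<^esub>" by (simp add: mu2_iff) (simp add: mu2_def units_of_def)
  then show "\<exists>y\<in>carrier (mu2 R). y \<otimes>\<^bsub>mu2 R\<^esub> x = \<one>\<^bsub>mu2 R\<^esub>" using x by blast
next
  fix x y assume "x \<in> carrier (mu2 R)" "y \<in> carrier (mu2 R)"
  then have xy: "x \<in> carrier R" "x \<otimes> x = \<one>" "y \<in> carrier R" "y \<otimes> y = \<one>" by (auto simp: mu2_iff)
  have "x \<otimes> y \<otimes> (x \<otimes> y) = (x \<otimes> x) \<otimes> (y \<otimes> y)" using xy(1,3) by algebra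
  then have "x \<otimes> y \<otimes> (x \<otimes> y) = \<one>" using xy by simp
  moreover have "x \<otimes>\<^bsub>mu2 R\<^esub> y = x \<otimes> y" by (simp add: mu2_def units_of_def)
  ultimately show "x \<otimes>\<^bsub>mu2 R\<^esub> y \<in> carrier (mu2 R)" using xy by (simp add: mu2_iff)
qed (simp_all add: mu2_iff, simp_all add: mu2_def units_of_def m_ac)

lemma mu2_mult [simp]: "b \<otimes>\<^bsub>mu2 R\<^esub> c = b \<otimes> c"
  by (simp add: mu2_def units_of_def)

lemma mu2_one [simp]: "\<one>\<^bsub>mu2 R\<^esub> = \<one>"
  by (simp add: mu2_def units_of_def)

text \<open>Conjugating multiplication by i = (0,1) with \<open>A\<close> gives a map in the
  centroid, hence multiplication by some (x, y) whose square is -1. This alone does not give x = 0: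
  if \<open>R\<close> contains a square root x of -1, then (x, 0) is another solution. Injectivity
  of \<open>A\<close> excludes it.\<close>

lemma linear_sl2_semi:
  assumes bij: "bij_betw A (sl2 (bar R)) (sl2 (bar R))"
    and add: "\<And>V W. V \<in> sl2 (bar R) \<Longrightarrow> W \<in> sl2 (bar R) \<Longrightarrow> A (V \<boxplus>\<^bsub>bar R\<^esub> W) = A V \<boxplus>\<^bsub>bar R\<^esub> A W"
    and lin: "\<And>r V. r \<in> carrier R \<Longrightarrow> V \<in> sl2 (bar R) \<Longrightarrow> A ((r, \<zero>) \<boxdot>\<^bsub>bar R\<^esub> V) = (r, \<zero>) \<boxdot>\<^bsub>bar R\<^esub> A V"
    and comm: "\<And>V W. V \<in> sl2 (bar R) \<Longrightarrow> W \<in> sl2 (bar R) \<Longrightarrow>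
      A (comm2 (bar R) V W) = comm2 (bar R) (A V) (A W)"
  shows "\<exists>b\<in>carrier (mu2 R). sl2_semi (bar R) (bar_aut R b) A"
proof -
  interpret B: half_cring "bar R" by (rule bar_half_cring)
  let ?S = "bar R" and ?i = "(\<zero>, \<one>)"
  have i: "?i \<in> carrier ?S" by simp
  have As: "A V \<in> sl2 ?S" if "V \<in> sl2 ?S" for V using bij that by (auto dest: bij_betwE)
  define A' where "A' = inv_into (sl2 ?S) A"
  have A': "A' V \<in> sl2 ?S" "A (A' V) = V" "A' (A V) = V" if "V \<in> sl2 ?S" for V
    using that bij unfolding A'_def
    by (auto simp: bij_betw_inv_into_right bij_betw_inv_into_left intro: bij_betwE[OF bij_betw_inv_into, rule_format])
  have inj: "V = W" if "V \<in> sl2 ?S" "W \<in> sl2 ?S" "A V = A W" for V W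
    using that A'(3) by metis
  have icomm: "?i \<boxdot>\<^bsub>bar R\<^esub> comm2 ?S V W = comm2 ?S (?i \<boxdot>\<^bsub>bar R\<^esub> V) W" if "V \<in> sl2 ?S" "W \<in> sl2 ?S" for V W
  proof -
    note c = B.sl2_carrier[OF that(1)] B.sl2_carrier[OF that(2)]
    show ?thesis
      unfolding comm2_def a_minus_def using c i
      by (simp add: B.Mat2_smult B.Md.smult_r_distr B.Md.smult_r_minus)
  qed
  define C where "C V = A (?i \<boxdot>\<^bsub>bar R\<^esub> A' V)" for V
  have "\<exists>c\<in>carrier ?S. \<forall>V\<in>sl2 ?S. C V = c \<boxdot>\<^bsub>bar R\<^esub> V"
  proof (rule B.sl2_centroid)
    show "C V \<in> sl2 ?S" if "V \<in> sl2 ?S" for V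
      unfolding C_def using that As A' i by simp
    fix V W assume VW: "V \<in> sl2 ?S" "W \<in> sl2 ?S"
    note c = VW[THEN A'(1)] VW[THEN A'(1), THEN B.sl2_carrier]
    have "A' (V \<boxplus>\<^bsub>bar R\<^esub> W) = A' V \<boxplus>\<^bsub>bar R\<^esub> A' W"
      by (rule inj) (use VW A' add in auto)
    then show "C (V \<boxplus>\<^bsub>bar R\<^esub> W) = C V \<boxplus>\<^bsub>bar R\<^esub> C W"
      unfolding C_def using c i by (simp add: B.Md.smult_r_distr add)
    have "A' (comm2 ?S V W) = comm2 ?S (A' V) (A' W)"
      by (rule inj) (use VW A' comm B.comm2_closed in auto)
    then show "C (comm2 ?S V W) = comm2 ?S (C V) W"
      unfolding C_def using c i VW by (simp add: icomm comm A')
  qed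
  then obtain x y where xy: "x \<in> carrier R" "y \<in> carrier R" "\<And>V. V \<in> sl2 ?S \<Longrightarrow> C V = (x, y) \<boxdot>\<^bsub>bar R\<^esub> V"
    by auto
  have Ai: "A (?i \<boxdot>\<^bsub>bar R\<^esub> V) = (x, y) \<boxdot>\<^bsub>bar R\<^esub> A V" if "V \<in> sl2 ?S" for V
    using xy(3)[OF As[OF that]] A'(3)[OF that] by (simp add: C_def)
  have ii: "?i \<boxdot>\<^bsub>bar R\<^esub> (?i \<boxdot>\<^bsub>bar R\<^esub> V) = (\<ominus> \<one>, \<zero>) \<boxdot>\<^bsub>bar R\<^esub> V" if "V \<in> carrier (Mat2 ?S)" for V
  proof -
    have "?i \<boxdot>\<^bsub>bar R\<^esub> (?i \<boxdot>\<^bsub>bar R\<^esub> V) = (?i \<otimes>\<^bsub>bar R\<^esub> ?i) \<boxdot>\<^bsub>bar R\<^esub> V"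
      by (rule B.Md.smult_assoc1[symmetric]) (use that i in auto)
    then show ?thesis by (simp add: a_minus_def)
  qed
  have Hc: "matH ?S \<in> sl2 ?S" "matH ?S \<in> carrier (Mat2 ?S)" using B.matEFH(3) B.sl2_carrier by auto
  have m1: "(\<ominus> \<one>, \<zero>) \<in> carrier ?S" "(x, y) \<in> carrier ?S" using xy by auto
  \<comment> \<open>Scalars can be compared on \<open>matH\<close>, whose upper left entry is 1; to
    let \<open>A\<close> act, a preimage of \<open>matH\<close> is used.\<close>
  define W where "W = A' (matH ?S)"
  have W: "W \<in> sl2 ?S" "A W = matH ?S" "W \<in> carrier (Mat2 ?S)"
    unfolding W_def using A' Hc B.sl2_carrier by auto
  have "((x, y) \<otimes>\<^bsub>bar R\<^esub> (x, y)) \<boxdot>\<^bsub>bar R\<^esub> matH ?S = (x, y) \<boxdot>\<^bsub>bar R\<^esub> ((x, y) \<boxdot>\<^bsub>bar R\<^esub> A W)"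
    using B.Md.smult_assoc1[OF m1(2,2) Hc(2)] W by simp
  also have "\<dots> = A (?i \<boxdot>\<^bsub>bar R\<^esub> (?i \<boxdot>\<^bsub>bar R\<^esub> W))" using W i by (simp add: Ai)
  also have "\<dots> = (\<ominus> \<one>, \<zero>) \<boxdot>\<^bsub>bar R\<^esub> matH ?S" using W by (simp add: ii lin)
  finally have "(x, y) \<otimes>\<^bsub>bar R\<^esub> (x, y) = (\<ominus> \<one>, \<zero>)"
    using m1 by (simp add: matH_def a_minus_def r_minus l_minus)
  then have sq: "x \<otimes> x \<ominus> y \<otimes> y = \<ominus> \<one>" and "x \<otimes> y \<oplus> y \<otimes> x = \<zero>" by simp_all
  then have "x \<otimes> y \<oplus> x \<otimes> y = \<zero>" using xy by (simp add: m_comm)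
  then have xy0: "x \<otimes> y = \<zero>" using double_zero xy by simp
  \<comment> \<open>Since x y = 0, the product x (x, y) is (x^2, 0), so x i H and x^2 H have the
    same image under \<open>A\<close>.\<close>
  have "A ((x, \<zero>) \<boxdot>\<^bsub>bar R\<^esub> (?i \<boxdot>\<^bsub>bar R\<^esub> matH ?S)) = A ((x \<otimes> x, \<zero>) \<boxdot>\<^bsub>bar R\<^esub> matH ?S)"
  proof -
    have "A ((x, \<zero>) \<boxdot>\<^bsub>bar R\<^esub> (?i \<boxdot>\<^bsub>bar R\<^esub> matH ?S)) = (x, \<zero>) \<boxdot>\<^bsub>bar R\<^esub> ((x, y) \<boxdot>\<^bsub>bar R\<^esub> A (matH ?S))"
      using Hc xy i by (simp add: lin Ai)
    also have "\<dots> = ((x, \<zero>) \<otimes>\<^bsub>bar R\<^esub> (x, y)) \<boxdot>\<^bsub>bar R\<^esub> A (matH ?S)"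
      by (rule B.Md.smult_assoc1[symmetric]) (use xy As Hc B.sl2_carrier in auto)
    also have "\<dots> = (x \<otimes> x, \<zero>) \<boxdot>\<^bsub>bar R\<^esub> A (matH ?S)" using xy by (simp add: xy0 a_minus_def)
    finally show ?thesis using Hc xy by (simp add: lin)
  qed
  moreover have "(x, \<zero>) \<boxdot>\<^bsub>bar R\<^esub> (?i \<boxdot>\<^bsub>bar R\<^esub> matH ?S) \<in> sl2 ?S" "(x \<otimes> x, \<zero>) \<boxdot>\<^bsub>bar R\<^esub> matH ?S \<in> sl2 ?S"
    using xy Hc by (auto intro!: B.sl2_smult)
  ultimately have "(x, \<zero>) \<boxdot>\<^bsub>bar R\<^esub> (?i \<boxdot>\<^bsub>bar R\<^esub> matH ?S) = (x \<otimes> x, \<zero>) \<boxdot>\<^bsub>bar R\<^esub> matH ?S"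
    using inj by blast
  \<comment> \<open>\<open>snd (fst _)\<close> is the i-component of the upper left entry: it is
    \<open>x\<close> on the left and zero on the right.\<close>
  then have "snd (fst ((x, \<zero>) \<boxdot>\<^bsub>bar R\<^esub> (?i \<boxdot>\<^bsub>bar R\<^esub> matH ?S))) = snd (fst ((x \<otimes> x, \<zero>) \<boxdot>\<^bsub>bar R\<^esub> matH ?S))" by (rule arg_cong)
  then have x: "x = \<zero>" using xy by (simp add: matH_def a_minus_def)
  then have "y \<otimes> y = \<one>" using sq xy by (simp add: a_minus_def) (metis m_closed minus_minus one_closed)
  then have y: "y \<in> carrier (mu2 R)" using xy by (simp add: mu2_iff)
  have "A (s \<boxdot>\<^bsub>bar R\<^esub> V) = bar_aut R y s \<boxdot>\<^bsub>bar R\<^esub> A V" if s: "s \<in> carrier ?S" and V: "V \<in> sl2 ?S" for s V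
  proof -
    obtain u v where uv: "s = (u, v)" "u \<in> carrier R" "v \<in> carrier R" using s by (rule bar_cases)
    have "s = (u, \<zero>) \<oplus>\<^bsub>bar R\<^esub> ((v, \<zero>) \<otimes>\<^bsub>bar R\<^esub> ?i)" using uv by (simp add: a_minus_def)
    then have "s \<boxdot>\<^bsub>bar R\<^esub> V = ((u, \<zero>) \<boxdot>\<^bsub>bar R\<^esub> V) \<boxplus>\<^bsub>bar R\<^esub> ((v, \<zero>) \<boxdot>\<^bsub>bar R\<^esub> (?i \<boxdot>\<^bsub>bar R\<^esub> V))"
      using uv V B.sl2_carrier i by (simp add: B.Md.smult_l_distr B.Md.smult_assoc1 del: bar_simps(1,2))
    then have "A (s \<boxdot>\<^bsub>bar R\<^esub> V) = ((u, \<zero>) \<boxdot>\<^bsub>bar R\<^esub> A V) \<boxplus>\<^bsub>bar R\<^esub> ((v, \<zero>) \<boxdot>\<^bsub>bar R\<^esub> ((x, y) \<boxdot>\<^bsub>bar R\<^esub> A V))"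
      using uv V i by (simp add: add lin Ai)
    also have "\<dots> = ((u, \<zero>) \<oplus>\<^bsub>bar R\<^esub> ((v, \<zero>) \<otimes>\<^bsub>bar R\<^esub> (x, y))) \<boxdot>\<^bsub>bar R\<^esub> A V"
      using uv xy As[OF V] B.sl2_carrier by (simp add: B.Md.smult_l_distr B.Md.smult_assoc1 del: bar_simps(1,2))
    also have "(u, \<zero>) \<oplus>\<^bsub>bar R\<^esub> ((v, \<zero>) \<otimes>\<^bsub>bar R\<^esub> (x, y)) = bar_aut R y s"
      using uv xy by (simp add: x a_minus_def m_comm)
    finally show ?thesis .
  qed
  then have "sl2_semi ?S (bar_aut R y) A" unfolding sl2_semi_def using bij add comm by blast
  with y show ?thesis by blast
qed

text \<open>The sign can be read off from the action on i H. Here \<open>c\<close> ranges over all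
  ring elements, so that the image of a sign under a ring homomorphism can be inserted before it is
  recognised as a sign.\<close>

lemma bar_semi_unique:
  assumes b: "b \<in> carrier (mu2 R)" "sl2_semi (bar R) (bar_aut R b) A"
    and c: "c \<in> carrier R"
    and eq: "A ((\<zero>, \<one>) \<boxdot>\<^bsub>bar R\<^esub> matH (bar R)) = (\<zero>, c) \<boxdot>\<^bsub>bar R\<^esub> A (matH (bar R))"
  shows "c = b"
proof -
  interpret B: half_cring_invol "bar R" "bar_aut R b" by (rule bar_half_cring_invol[OF b(1)])
  have bc: "b \<in> carrier R" using b by (simp add: mu2_iff)
  have "A ((\<zero>, \<one>) \<boxdot>\<^bsub>bar R\<^esub> matH (bar R)) = bar_aut R b (\<zero>, \<one>) \<boxdot>\<^bsub>bar R\<^esub> A (matH (bar R))"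
    by (rule sl2_semiD(5)[OF b(2)]) auto
  then have "(\<zero>, c) \<boxdot>\<^bsub>bar R\<^esub> A (matH (bar R)) = (\<zero>, b) \<boxdot>\<^bsub>bar R\<^esub> A (matH (bar R))" using eq bc by simp
  then have "(\<zero>, c) = (\<zero>, b)"
    by (rule B.semi_smult_H_inj[OF b(2), rotated 2]) (use bc c in auto)
  then show ?thesis by simp
qed

end


section \<open>The Lorentz algebra as traceless matrices\<close>

text \<open>
  Sending \<open>b\<^sub>1, b\<^sub>2, b\<^sub>3\<close> to the Pauli matrices avoids the factor \<open>1/2\<close>, but then the commutator of
  two images is twice the image of the bracket.
\<close>

definition lor_mat :: "('r, 'm) ring_scheme \<Rightarrow> (nat \<Rightarrow> 'r) \<Rightarrow> ('r \<times> 'r) mat2" where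
  "lor_mat R x =
     ((x 3, x 4), (x 1 \<ominus>\<^bsub>R\<^esub> x 5, x 6 \<ominus>\<^bsub>R\<^esub> x 2), (x 1 \<oplus>\<^bsub>R\<^esub> x 5, x 6 \<oplus>\<^bsub>R\<^esub> x 2), (\<ominus>\<^bsub>R\<^esub> x 3, \<ominus>\<^bsub>R\<^esub> x 4))"

text \<open>The inverse of \<open>lor_mat\<close> on traceless matrices; the lower right entry is
  dictated by the trace and is discarded.\<close>

definition (in half_cring) lor_vec :: "('a \<times> 'a) mat2 \<Rightarrow> nat \<Rightarrow> 'a" where
  "lor_vec = (\<lambda>((a, a'), (b, b'), (c, c'), _). \<lambda>i\<in>{1..6}.
     if i = 1 then half \<otimes> (b \<oplus> c) else if i = 2 then half \<otimes> (c' \<ominus> b') else if i = 3 then a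
     else if i = 4 then a' else if i = 5 then half \<otimes> (c \<ominus> b) else half \<otimes> (b' \<oplus> c'))"

lemma lorentz_carrier: "x \<in> carrier (lorentz R) \<longleftrightarrow> x \<in> {1..6} \<rightarrow>\<^sub>E carrier R"
  by (simp add: lorentz_def)

lemma lorentz_coord:
  assumes "x \<in> carrier (lorentz R)"
  shows "i \<in> {1..6} \<Longrightarrow> x i \<in> carrier R"
    "x 1 \<in> carrier R" "x 2 \<in> carrier R" "x 3 \<in> carrier R" "x 4 \<in> carrier R" "x 5 \<in> carrier R" "x 6 \<in> carrier R"
  using assms by (auto simp: lorentz_def)

lemma lorentz_eqI:
  assumes "x \<in> carrier (lorentz R)" "y \<in> carrier (lorentz R)"
    "x 1 = y 1" "x 2 = y 2" "x 3 = y 3" "x 4 = y 4" "x 5 = y 5" "x 6 = y 6"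
  shows "x = y"
proof (rule PiE_ext)
  show "x \<in> {1..6} \<rightarrow>\<^sub>E carrier R" "y \<in> {1..6} \<rightarrow>\<^sub>E carrier R" using assms by (auto simp: lorentz_def)
  fix i :: nat assume "i \<in> {1..6}"
  then have "i = 1 \<or> i = 2 \<or> i = 3 \<or> i = 4 \<or> i = 5 \<or> i = 6" by auto
  then show "x i = y i" using assms by metis
qed

lemma lorentz_add_apply: "i \<in> {1..6} \<Longrightarrow> (x \<oplus>\<^bsub>lorentz R\<^esub> y) i = x i \<oplus>\<^bsub>R\<^esub> y i"
  and lorentz_smult_apply: "i \<in> {1..6} \<Longrightarrow> (r \<odot>\<^bsub>lorentz R\<^esub> x) i = r \<otimes>\<^bsub>R\<^esub> x i"
  by (simp_all add: lorentz_def)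

lemma lorentz_mult: "x \<otimes>\<^bsub>lorentz R\<^esub> y = lorentz_bracket R x y"
  by (simp add: lorentz_def)

lemma lorentz_add_coord:
  "(x \<oplus>\<^bsub>lorentz R\<^esub> y) 1 = x 1 \<oplus>\<^bsub>R\<^esub> y 1" "(x \<oplus>\<^bsub>lorentz R\<^esub> y) 2 = x 2 \<oplus>\<^bsub>R\<^esub> y 2" "(x \<oplus>\<^bsub>lorentz R\<^esub> y) 3 = x 3 \<oplus>\<^bsub>R\<^esub> y 3"
  "(x \<oplus>\<^bsub>lorentz R\<^esub> y) 4 = x 4 \<oplus>\<^bsub>R\<^esub> y 4" "(x \<oplus>\<^bsub>lorentz R\<^esub> y) 5 = x 5 \<oplus>\<^bsub>R\<^esub> y 5" "(x \<oplus>\<^bsub>lorentz R\<^esub> y) 6 = x 6 \<oplus>\<^bsub>R\<^esub> y 6"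
  by (simp_all add: lorentz_add_apply)

lemma lorentz_smult_coord:
  "(r \<odot>\<^bsub>lorentz R\<^esub> x) 1 = r \<otimes>\<^bsub>R\<^esub> x 1" "(r \<odot>\<^bsub>lorentz R\<^esub> x) 2 = r \<otimes>\<^bsub>R\<^esub> x 2" "(r \<odot>\<^bsub>lorentz R\<^esub> x) 3 = r \<otimes>\<^bsub>R\<^esub> x 3"
  "(r \<odot>\<^bsub>lorentz R\<^esub> x) 4 = r \<otimes>\<^bsub>R\<^esub> x 4" "(r \<odot>\<^bsub>lorentz R\<^esub> x) 5 = r \<otimes>\<^bsub>R\<^esub> x 5" "(r \<odot>\<^bsub>lorentz R\<^esub> x) 6 = r \<otimes>\<^bsub>R\<^esub> x 6"
  by (simp_all add: lorentz_smult_apply)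

lemma lorentz_mult_coord:
  "(x \<otimes>\<^bsub>lorentz R\<^esub> y) 1 = (\<ominus>\<^bsub>R\<^esub> (x 2 \<otimes>\<^bsub>R\<^esub> y 4 \<ominus>\<^bsub>R\<^esub> x 4 \<otimes>\<^bsub>R\<^esub> y 2)) \<ominus>\<^bsub>R\<^esub> (x 3 \<otimes>\<^bsub>R\<^esub> y 5 \<ominus>\<^bsub>R\<^esub> x 5 \<otimes>\<^bsub>R\<^esub> y 3)"
  "(x \<otimes>\<^bsub>lorentz R\<^esub> y) 2 = (x 1 \<otimes>\<^bsub>R\<^esub> y 4 \<ominus>\<^bsub>R\<^esub> x 4 \<otimes>\<^bsub>R\<^esub> y 1) \<ominus>\<^bsub>R\<^esub> (x 3 \<otimes>\<^bsub>R\<^esub> y 6 \<ominus>\<^bsub>R\<^esub> x 6 \<otimes>\<^bsub>R\<^esub> y 3)"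
  "(x \<otimes>\<^bsub>lorentz R\<^esub> y) 3 = (x 1 \<otimes>\<^bsub>R\<^esub> y 5 \<ominus>\<^bsub>R\<^esub> x 5 \<otimes>\<^bsub>R\<^esub> y 1) \<oplus>\<^bsub>R\<^esub> (x 2 \<otimes>\<^bsub>R\<^esub> y 6 \<ominus>\<^bsub>R\<^esub> x 6 \<otimes>\<^bsub>R\<^esub> y 2)"
  "(x \<otimes>\<^bsub>lorentz R\<^esub> y) 4 = (x 1 \<otimes>\<^bsub>R\<^esub> y 2 \<ominus>\<^bsub>R\<^esub> x 2 \<otimes>\<^bsub>R\<^esub> y 1) \<ominus>\<^bsub>R\<^esub> (x 5 \<otimes>\<^bsub>R\<^esub> y 6 \<ominus>\<^bsub>R\<^esub> x 6 \<otimes>\<^bsub>R\<^esub> y 5)"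
  "(x \<otimes>\<^bsub>lorentz R\<^esub> y) 5 = (x 1 \<otimes>\<^bsub>R\<^esub> y 3 \<ominus>\<^bsub>R\<^esub> x 3 \<otimes>\<^bsub>R\<^esub> y 1) \<oplus>\<^bsub>R\<^esub> (x 4 \<otimes>\<^bsub>R\<^esub> y 6 \<ominus>\<^bsub>R\<^esub> x 6 \<otimes>\<^bsub>R\<^esub> y 4)"
  "(x \<otimes>\<^bsub>lorentz R\<^esub> y) 6 = (x 2 \<otimes>\<^bsub>R\<^esub> y 3 \<ominus>\<^bsub>R\<^esub> x 3 \<otimes>\<^bsub>R\<^esub> y 2) \<ominus>\<^bsub>R\<^esub> (x 4 \<otimes>\<^bsub>R\<^esub> y 5 \<ominus>\<^bsub>R\<^esub> x 5 \<otimes>\<^bsub>R\<^esub> y 4)"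
  unfolding lorentz_mult lorentz_bracket_def Let_def by simp_all

context cring
begin

lemma lorentz_add_closed:
  "x \<in> carrier (lorentz R) \<Longrightarrow> y \<in> carrier (lorentz R) \<Longrightarrow> x \<oplus>\<^bsub>lorentz R\<^esub> y \<in> carrier (lorentz R)"
  by (auto simp: lorentz_def)

lemma lorentz_smult_closed:
  "r \<in> carrier R \<Longrightarrow> x \<in> carrier (lorentz R) \<Longrightarrow> r \<odot>\<^bsub>lorentz R\<^esub> x \<in> carrier (lorentz R)"
  by (auto simp: lorentz_def)

lemma lorentz_mult_closed:
  "x \<in> carrier (lorentz R) \<Longrightarrow> y \<in> carrier (lorentz R) \<Longrightarrow> x \<otimes>\<^bsub>lorentz R\<^esub> y \<in> carrier (lorentz R)"
  using lorentz_coord(2-7)[of x R] lorentz_coord(2-7)[of y R]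
  by (auto simp: lorentz_def lorentz_bracket_def Let_def)

end

text \<open>The off-diagonal entries appear as visible doubles, matching the factor 2 in
  \<open>lor_mat_mult\<close>.\<close>

lemma (in cring) comm2_sl2:
  assumes "a \<in> carrier R" "b \<in> carrier R" "c \<in> carrier R"
    "a' \<in> carrier R" "b' \<in> carrier R" "c' \<in> carrier R"
  shows "comm2 R (a, b, c, \<ominus> a) (a', b', c', \<ominus> a') =
    (b \<otimes> c' \<ominus> b' \<otimes> c, (a \<otimes> b' \<ominus> a' \<otimes> b) \<oplus> (a \<otimes> b' \<ominus> a' \<otimes> b),
     (c \<otimes> a' \<ominus> c' \<otimes> a) \<oplus> (c \<otimes> a' \<ominus> c' \<otimes> a), \<ominus> (b \<otimes> c' \<ominus> b' \<otimes> c))"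
  using assms by (simp add: comm2_simp, intro conjI; algebra)

context half_cring
begin

lemma lor_mat_sl2: "x \<in> carrier (lorentz R) \<Longrightarrow> lor_mat R x \<in> sl2 (bar R)"
  using lorentz_coord[of x R] cring.sl2_simp[OF bar_cring]
  by (simp add: lor_mat_def)

lemma lor_mat_add:
  assumes "x \<in> carrier (lorentz R)" "y \<in> carrier (lorentz R)"
  shows "lor_mat R (x \<oplus>\<^bsub>lorentz R\<^esub> y) = lor_mat R x \<boxplus>\<^bsub>bar R\<^esub> lor_mat R y"
proof -
  interpret B: cring "bar R" by (rule bar_cring)
  note c = lorentz_coord(2-7)[OF assms(1)] lorentz_coord(2-7)[OF assms(2)]
  show ?thesis
    unfolding lor_mat_def B.Mat2_add_simp bar_simps(2) prod.inject
    using c by (auto simp: lorentz_add_apply minus_add a_minus_def a_ac)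
qed

lemma lor_mat_smult:
  assumes "r \<in> carrier R" "x \<in> carrier (lorentz R)"
  shows "lor_mat R (r \<odot>\<^bsub>lorentz R\<^esub> x) = (r, \<zero>) \<boxdot>\<^bsub>bar R\<^esub> lor_mat R x"
proof -
  interpret B: cring "bar R" by (rule bar_cring)
  note c = lorentz_coord(2-7)[OF assms(2)] assms(1)
  show ?thesis
    unfolding lor_mat_def B.Mat2_smult_simp bar_simps(1) prod.inject
    using c by (auto simp: lorentz_smult_apply r_minus a_minus_def r_distr)
qed

lemma lor_mat_mult:
  assumes "x \<in> carrier (lorentz R)" "y \<in> carrier (lorentz R)"
  shows "comm2 (bar R) (lor_mat R x) (lor_mat R y) =
    lor_mat R (x \<otimes>\<^bsub>lorentz R\<^esub> y) \<boxplus>\<^bsub>bar R\<^esub> lor_mat R (x \<otimes>\<^bsub>lorentz R\<^esub> y)"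
proof -
  interpret B: cring "bar R" by (rule bar_cring)
  \<comment> \<open>The coordinates become plain variables, and the claim becomes six polynomial
    identities in them, two for each independent matrix entry.\<close>
  obtain x1 x2 x3 x4 x5 x6 where x: "x 1 = x1" "x 2 = x2" "x 3 = x3" "x 4 = x4" "x 5 = x5" "x 6 = x6" by blast
  obtain y1 y2 y3 y4 y5 y6 where y: "y 1 = y1" "y 2 = y2" "y 3 = y3" "y 4 = y4" "y 5 = y5" "y 6 = y6" by blast
  have c: "x1 \<in> carrier R" "x2 \<in> carrier R" "x3 \<in> carrier R" "x4 \<in> carrier R" "x5 \<in> carrier R" "x6 \<in> carrier R"
    "y1 \<in> carrier R" "y2 \<in> carrier R" "y3 \<in> carrier R" "y4 \<in> carrier R" "y5 \<in> carrier R" "y6 \<in> carrier R"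
    using lorentz_coord(2-7)[OF assms(1)] lorentz_coord(2-7)[OF assms(2)] unfolding x y by auto
  note z = lorentz_mult_coord[where R = R and x = x and y = y, unfolded x y]
  have cs: "(x3, x4) \<in> carrier (bar R)" "(x1 \<ominus> x5, x6 \<ominus> x2) \<in> carrier (bar R)"
    "(x1 \<oplus> x5, x6 \<oplus> x2) \<in> carrier (bar R)" "(\<ominus> x3, \<ominus> x4) \<in> carrier (bar R)"
    "(y3, y4) \<in> carrier (bar R)" "(y1 \<ominus> y5, y6 \<ominus> y2) \<in> carrier (bar R)"
    "(y1 \<oplus> y5, y6 \<oplus> y2) \<in> carrier (bar R)" "(\<ominus> y3, \<ominus> y4) \<in> carrier (bar R)"
    using c by simp_all
  have bm: "(p, q) \<ominus>\<^bsub>bar R\<^esub> (r, s) = (p \<ominus> r, q \<ominus> s)"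
    if "p \<in> carrier R" "q \<in> carrier R" "r \<in> carrier R" "s \<in> carrier R" for p q r s
    using that by (simp add: a_minus_def)
  have m: "(\<ominus> x3, \<ominus> x4) = \<ominus>\<^bsub>bar R\<^esub> (x3, x4)" "(\<ominus> y3, \<ominus> y4) = \<ominus>\<^bsub>bar R\<^esub> (y3, y4)" using c by simp_all
  let ?p = "x1 \<otimes> y5 \<ominus> x5 \<otimes> y1 \<oplus> (x2 \<otimes> y6 \<ominus> x6 \<otimes> y2)"
  let ?q = "x1 \<otimes> y2 \<ominus> x2 \<otimes> y1 \<ominus> (x5 \<otimes> y6 \<ominus> x6 \<otimes> y5)"
  \<comment> \<open>Upper left entry: \<open>?p\<close> and \<open>?q\<close> are the coordinates 3
    and 4 of the bracket.\<close>
  have 1: "(x1 \<ominus> x5, x6 \<ominus> x2) \<otimes>\<^bsub>bar R\<^esub> (y1 \<oplus> y5, y6 \<oplus> y2) \<ominus>\<^bsub>bar R\<^esub> (y1 \<ominus> y5, y6 \<ominus> y2) \<otimes>\<^bsub>bar R\<^esub> (x1 \<oplus> x5, x6 \<oplus> x2)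
      = (?p \<oplus> ?p, ?q \<oplus> ?q)"
  proof -
    have "((x1 \<ominus> x5) \<otimes> (y1 \<oplus> y5) \<ominus> (x6 \<ominus> x2) \<otimes> (y6 \<oplus> y2)) \<ominus> ((y1 \<ominus> y5) \<otimes> (x1 \<oplus> x5) \<ominus> (y6 \<ominus> y2) \<otimes> (x6 \<oplus> x2)) = ?p \<oplus> ?p"
      using c by algebra
    moreover have "((x1 \<ominus> x5) \<otimes> (y6 \<oplus> y2) \<oplus> (x6 \<ominus> x2) \<otimes> (y1 \<oplus> y5)) \<ominus> ((y1 \<ominus> y5) \<otimes> (x6 \<oplus> x2) \<oplus> (y6 \<ominus> y2) \<otimes> (x1 \<oplus> x5)) = ?q \<oplus> ?q"
      using c by algebra
    ultimately show ?thesis using c by (simp add: bm)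
  qed
  \<comment> \<open>Upper right entry before doubling: coordinate 1 minus 5, and coordinate 6 minus
    2. The lower left entry has sums instead.\<close>
  have 2: "(x3, x4) \<otimes>\<^bsub>bar R\<^esub> (y1 \<ominus> y5, y6 \<ominus> y2) \<ominus>\<^bsub>bar R\<^esub> (y3, y4) \<otimes>\<^bsub>bar R\<^esub> (x1 \<ominus> x5, x6 \<ominus> x2) =
    (\<ominus> (x2 \<otimes> y4 \<ominus> x4 \<otimes> y2) \<ominus> (x3 \<otimes> y5 \<ominus> x5 \<otimes> y3) \<ominus> (x1 \<otimes> y3 \<ominus> x3 \<otimes> y1 \<oplus> (x4 \<otimes> y6 \<ominus> x6 \<otimes> y4)),
     x2 \<otimes> y3 \<ominus> x3 \<otimes> y2 \<ominus> (x4 \<otimes> y5 \<ominus> x5 \<otimes> y4) \<ominus> (x1 \<otimes> y4 \<ominus> x4 \<otimes> y1 \<ominus> (x3 \<otimes> y6 \<ominus> x6 \<otimes> y3)))" (is "_ = (?r, ?s)")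
  proof -
    have "(x3 \<otimes> (y1 \<ominus> y5) \<ominus> x4 \<otimes> (y6 \<ominus> y2)) \<ominus> (y3 \<otimes> (x1 \<ominus> x5) \<ominus> y4 \<otimes> (x6 \<ominus> x2)) = ?r"
      using c by algebra
    moreover have "(x3 \<otimes> (y6 \<ominus> y2) \<oplus> x4 \<otimes> (y1 \<ominus> y5)) \<ominus> (y3 \<otimes> (x6 \<ominus> x2) \<oplus> y4 \<otimes> (x1 \<ominus> x5)) = ?s"
      using c by algebra
    ultimately show ?thesis using c by (simp add: bm)
  qed
  have 3: "(x1 \<oplus> x5, x6 \<oplus> x2) \<otimes>\<^bsub>bar R\<^esub> (y3, y4) \<ominus>\<^bsub>bar R\<^esub> (y1 \<oplus> y5, y6 \<oplus> y2) \<otimes>\<^bsub>bar R\<^esub> (x3, x4) =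
    (\<ominus> (x2 \<otimes> y4 \<ominus> x4 \<otimes> y2) \<ominus> (x3 \<otimes> y5 \<ominus> x5 \<otimes> y3) \<oplus> (x1 \<otimes> y3 \<ominus> x3 \<otimes> y1 \<oplus> (x4 \<otimes> y6 \<ominus> x6 \<otimes> y4)),
     x2 \<otimes> y3 \<ominus> x3 \<otimes> y2 \<ominus> (x4 \<otimes> y5 \<ominus> x5 \<otimes> y4) \<oplus> (x1 \<otimes> y4 \<ominus> x4 \<otimes> y1 \<ominus> (x3 \<otimes> y6 \<ominus> x6 \<otimes> y3)))" (is "_ = (?t, ?u)")
  proof -
    have "((x1 \<oplus> x5) \<otimes> y3 \<ominus> (x6 \<oplus> x2) \<otimes> y4) \<ominus> ((y1 \<oplus> y5) \<otimes> x3 \<ominus> (y6 \<oplus> y2) \<otimes> x4) = ?t"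
      using c by algebra
    moreover have "((x1 \<oplus> x5) \<otimes> y4 \<oplus> (x6 \<oplus> x2) \<otimes> y3) \<ominus> ((y1 \<oplus> y5) \<otimes> x4 \<oplus> (y6 \<oplus> y2) \<otimes> x3) = ?u"
      using c by algebra
    ultimately show ?thesis using c by (simp add: bm)
  qed
  have "(?p \<oplus> ?p, ?q \<oplus> ?q) = (?p, ?q) \<oplus>\<^bsub>bar R\<^esub> (?p, ?q)" by simp
  moreover have "\<ominus>\<^bsub>bar R\<^esub> (?p \<oplus> ?p, ?q \<oplus> ?q) = (\<ominus> ?p, \<ominus> ?q) \<oplus>\<^bsub>bar R\<^esub> (\<ominus> ?p, \<ominus> ?q)" using c by (simp add: minus_add)
  ultimately show ?thesis
    unfolding lor_mat_def x y z m B.comm2_sl2[OF cs(1-3) cs(5-7)] 1 2 3 B.Mat2_add_simp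
    by simp
qed

lemma lor_vec_closed: "V \<in> sl2 (bar R) \<Longrightarrow> lor_vec V \<in> carrier (lorentz R)"
  by (auto simp: lor_vec_def lorentz_def sl2_def)

lemma lor_mat_vec:
  assumes "V \<in> sl2 (bar R)"
  shows "lor_mat R (lor_vec V) = V"
proof -
  interpret B: cring "bar R" by (rule bar_cring)
  obtain a a' b b' c c' where V: "V = ((a, a'), (b, b'), (c, c'), \<ominus>\<^bsub>bar R\<^esub> (a, a'))"
    "a \<in> carrier R" "a' \<in> carrier R" "b \<in> carrier R" "b' \<in> carrier R" "c \<in> carrier R" "c' \<in> carrier R"
    using assms by (auto elim!: B.sl2_cases)
  have h: "half \<otimes> (p \<oplus> q) \<ominus> half \<otimes> (q \<ominus> p) = p" "half \<otimes> (p \<oplus> q) \<oplus> half \<otimes> (q \<ominus> p) = q"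
    if "p \<in> carrier R" "q \<in> carrier R" for p q
  proof -
    have "half \<otimes> (p \<oplus> q) \<ominus> half \<otimes> (q \<ominus> p) = half \<otimes> (p \<oplus> p)"
      "half \<otimes> (p \<oplus> q) \<oplus> half \<otimes> (q \<ominus> p) = half \<otimes> (q \<oplus> q)"
      using that half_closed by algebra+
    then show "half \<otimes> (p \<oplus> q) \<ominus> half \<otimes> (q \<ominus> p) = p" "half \<otimes> (p \<oplus> q) \<oplus> half \<otimes> (q \<ominus> p) = q"
      using that half_double by simp_all
  qed
  show ?thesis
    unfolding V(1) using V(2-) by (simp add: lor_mat_def lor_vec_def h)
qed

lemma lor_vec_mat:
  assumes "x \<in> carrier (lorentz R)"
  shows "lor_vec (lor_mat R x) = x"
proof (rule lorentz_eqI)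
  note c = lorentz_coord(2-7)[OF assms]
  show "lor_vec (lor_mat R x) \<in> carrier (lorentz R)"
    using lor_vec_closed lor_mat_sl2 assms by blast
  have h: "half \<otimes> ((p \<ominus> q) \<oplus> (p \<oplus> q)) = p" "half \<otimes> ((p \<oplus> q) \<ominus> (p \<ominus> q)) = q"
    if "p \<in> carrier R" "q \<in> carrier R" for p q
  proof -
    have "(p \<ominus> q) \<oplus> (p \<oplus> q) = p \<oplus> p" "(p \<oplus> q) \<ominus> (p \<ominus> q) = q \<oplus> q" using that by algebra+
    then show "half \<otimes> ((p \<ominus> q) \<oplus> (p \<oplus> q)) = p" "half \<otimes> ((p \<oplus> q) \<ominus> (p \<ominus> q)) = q"
      using that half_double by simp_all
  qed
  show "lor_vec (lor_mat R x) 1 = x 1" "lor_vec (lor_mat R x) 2 = x 2" "lor_vec (lor_mat R x) 3 = x 3"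
    "lor_vec (lor_mat R x) 4 = x 4" "lor_vec (lor_mat R x) 5 = x 5" "lor_vec (lor_mat R x) 6 = x 6"
    unfolding lor_vec_def lor_mat_def using c h by simp_all
qed (fact assms)

lemma lor_mat_bij: "bij_betw (lor_mat R) (carrier (lorentz R)) (sl2 (bar R))"
  by (rule bij_betw_byWitness[where f' = lor_vec])
    (auto simp: lor_vec_mat lor_mat_vec lor_mat_sl2 lor_vec_closed)

end

section \<open>Automorphism groups of Lie algebras\<close>

lemma lie_aut_iff:
  "\<alpha> \<in> carrier (lie_aut R L) \<longleftrightarrow> \<alpha> \<in> extensional (carrier L) \<and> bij_betw \<alpha> (carrier L) (carrier L) \<and>
     (\<forall>x\<in>carrier L. \<forall>y\<in>carrier L. \<alpha> (x \<oplus>\<^bsub>L\<^esub> y) = \<alpha> x \<oplus>\<^bsub>L\<^esub> \<alpha> y) \<and>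
     (\<forall>r\<in>carrier R. \<forall>x\<in>carrier L. \<alpha> (r \<odot>\<^bsub>L\<^esub> x) = r \<odot>\<^bsub>L\<^esub> \<alpha> x) \<and>
     (\<forall>x\<in>carrier L. \<forall>y\<in>carrier L. \<alpha> (x \<otimes>\<^bsub>L\<^esub> y) = \<alpha> x \<otimes>\<^bsub>L\<^esub> \<alpha> y)"
  by (auto simp: lie_aut_def lie_iso_def Bij_def)

lemma lie_aut_one: "\<one>\<^bsub>lie_aut R L\<^esub> = (\<lambda>x\<in>carrier L. x)"
  by (simp add: lie_aut_def BijGroup_def)

lemma lie_aut_mult:
  "\<alpha> \<in> carrier (lie_aut R L) \<Longrightarrow> \<beta> \<in> carrier (lie_aut R L) \<Longrightarrow>
   \<alpha> \<otimes>\<^bsub>lie_aut R L\<^esub> \<beta> = compose (carrier L) \<alpha> \<beta>"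
  by (simp add: lie_aut_def BijGroup_def)

text \<open>The automorphisms form a subgroup of all bijections of the carrier; the inverse of
  \<open>f\<close> preserves each operation because \<open>f\<close> is injective.\<close>

lemma lie_aut_group:
  assumes add: "\<And>x y. x \<in> carrier L \<Longrightarrow> y \<in> carrier L \<Longrightarrow> x \<oplus>\<^bsub>L\<^esub> y \<in> carrier L"
    and smult: "\<And>r x. r \<in> carrier R \<Longrightarrow> x \<in> carrier L \<Longrightarrow> r \<odot>\<^bsub>L\<^esub> x \<in> carrier L"
    and mult: "\<And>x y. x \<in> carrier L \<Longrightarrow> y \<in> carrier L \<Longrightarrow> x \<otimes>\<^bsub>L\<^esub> y \<in> carrier L"
  shows "group (lie_aut R L)"
proof -
  interpret G: group "BijGroup (carrier L)" by (rule group_BijGroup)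
  have "subgroup (Bij (carrier L) \<inter> lie_iso R L L) (BijGroup (carrier L))"
  proof (rule G.subgroupI)
    show "Bij (carrier L) \<inter> lie_iso R L L \<subseteq> carrier (BijGroup (carrier L))"
      by (auto simp: BijGroup_def)
    have "(\<lambda>x\<in>carrier L. x) \<in> Bij (carrier L) \<inter> lie_iso R L L"
      using id_Bij[of "carrier L"] assms by (auto simp: lie_iso_def Bij_def)
    then show "Bij (carrier L) \<inter> lie_iso R L L \<noteq> {}" by blast
  next
    fix f assume f: "f \<in> Bij (carrier L) \<inter> lie_iso R L L"
    then have bij: "bij_betw f (carrier L) (carrier L)" by (auto simp: Bij_def)
    define g where "g = inv_into (carrier L) f"
    have g: "g x \<in> carrier L" "f (g x) = x" if "x \<in> carrier L" for x
      using that bij unfolding g_def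
      by (auto simp: bij_betw_inv_into_right intro: bij_betwE[OF bij_betw_inv_into, rule_format])
    have inj: "x = y" if "x \<in> carrier L" "y \<in> carrier L" "f x = f y" for x y
      using that bij by (auto simp: bij_betw_def dest: inj_onD)
    have f': "f (x \<oplus>\<^bsub>L\<^esub> y) = f x \<oplus>\<^bsub>L\<^esub> f y" "f (x \<otimes>\<^bsub>L\<^esub> y) = f x \<otimes>\<^bsub>L\<^esub> f y" if "x \<in> carrier L" "y \<in> carrier L" for x y
      using f that by (auto simp: lie_iso_def)
    have f'': "f (r \<odot>\<^bsub>L\<^esub> x) = r \<odot>\<^bsub>L\<^esub> f x" if "r \<in> carrier R" "x \<in> carrier L" for r x
      using f that by (auto simp: lie_iso_def)
    have "g (x \<oplus>\<^bsub>L\<^esub> y) = g x \<oplus>\<^bsub>L\<^esub> g y" "g (x \<otimes>\<^bsub>L\<^esub> y) = g x \<otimes>\<^bsub>L\<^esub> g y" if "x \<in> carrier L" "y \<in> carrier L" for x y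
      by (rule inj; simp add: g add mult f' that)+
    moreover have "g (r \<odot>\<^bsub>L\<^esub> x) = r \<odot>\<^bsub>L\<^esub> g x" if "r \<in> carrier R" "x \<in> carrier L" for r x
      by (rule inj; simp add: g smult f'' that)
    moreover have "(\<lambda>x\<in>carrier L. g x) \<in> Bij (carrier L)"
      unfolding g_def by (rule restrict_inv_into_Bij) (use f in blast)
    ultimately show "inv\<^bsub>BijGroup (carrier L)\<^esub> f \<in> Bij (carrier L) \<inter> lie_iso R L L"
      using f assms unfolding lie_iso_def g_def[symmetric]
      by (simp add: inv_BijGroup g_def[symmetric]) (simp add: Bij_def)
  next
    fix f g assume fg: "f \<in> Bij (carrier L) \<inter> lie_iso R L L" "g \<in> Bij (carrier L) \<inter> lie_iso R L L"
    then have "f \<in> Bij (carrier L)" "g \<in> Bij (carrier L)" by auto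
    then have "compose (carrier L) f g \<in> Bij (carrier L)" by (rule compose_Bij)
    moreover have "g x \<in> carrier L" if "x \<in> carrier L" for x
      using fg(2) that by (auto simp: Bij_def dest: bij_betwE)
    ultimately have "compose (carrier L) f g \<in> Bij (carrier L) \<inter> lie_iso R L L"
      using fg assms by (simp add: lie_iso_def compose_def) (simp add: Bij_def)
    then show "f \<otimes>\<^bsub>BijGroup (carrier L)\<^esub> g \<in> Bij (carrier L) \<inter> lie_iso R L L"
      using fg by (simp add: BijGroup_def)
  qed
  then show ?thesis unfolding lie_aut_def by (rule G.subgroup_imp_group)
qed


section \<open>The isomorphism over a fixed algebra\<close>

text \<open>This is how the matrix side becomes a group. That units correspond is a hypothesis,
  because a multiplicative bijection does not control which element the record \<open>H\<close>
  stores as its unit.\<close>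

lemma iso_imp_group:
  assumes "group G" "f \<in> iso G H" "f \<one>\<^bsub>G\<^esub> = \<one>\<^bsub>H\<^esub>"
  shows "group H"
proof -
  have "f ` carrier G = carrier H" using assms(2) by (auto simp: iso_def bij_betw_def)
  moreover have "f \<in> hom G H" using assms(2) by (simp add: iso_def)
  ultimately show ?thesis
    using group.hom_imp_img_group[OF assms(1), of f H] assms(3) by simp
qed

context half_cring
begin

lemma Mat2_double_eq:
  assumes "V \<in> carrier (Mat2 R)" "W \<in> carrier (Mat2 R)" "V \<boxplus> V = W \<boxplus> W"
  shows "V = W"
proof -
  have "half \<boxdot> (P \<boxplus> P) = P" if "P \<in> carrier (Mat2 R)" for P
    using that by (simp add: Md.smult_r_distr half_sum flip: Md.smult_l_distr)
  then show ?thesis using assms by metis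
qed

definition lor_conj :: "((nat \<Rightarrow> 'a) \<Rightarrow> (nat \<Rightarrow> 'a)) \<Rightarrow> ('a \<times> 'a) mat2 \<Rightarrow> ('a \<times> 'a) mat2" where
  "lor_conj \<alpha> V = lor_mat R (\<alpha> (lor_vec V))"

text \<open>The description is unique because b is determined by the value at i H; see
  \<open>lor_signI\<close>.\<close>

definition lor_sign :: "((nat \<Rightarrow> 'a) \<Rightarrow> (nat \<Rightarrow> 'a)) \<Rightarrow> 'a" where
  "lor_sign \<alpha> = (THE b. b \<in> carrier (mu2 R) \<and> sl2_semi (bar R) (bar_aut R b) (lor_conj \<alpha>))"

definition lor_pgl :: "((nat \<Rightarrow> 'a) \<Rightarrow> (nat \<Rightarrow> 'a)) \<Rightarrow> ('a \<times> 'a) mat2 set" where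
  "lor_pgl \<alpha> = intertwiners (bar R) (bar_aut R (lor_sign \<alpha>)) (lor_conj \<alpha>)"

lemma lor_conj_mat: "x \<in> carrier (lorentz R) \<Longrightarrow> lor_conj \<alpha> (lor_mat R x) = lor_mat R (\<alpha> x)"
  by (simp add: lor_conj_def lor_vec_mat)

lemma sl2_lor_cases:
  assumes "V \<in> sl2 (bar R)"
  obtains x where "x \<in> carrier (lorentz R)" "V = lor_mat R x"
  using assms lor_mat_vec lor_vec_closed by metis

lemma lorentz_closed:
  "x \<in> carrier (lorentz R) \<Longrightarrow> y \<in> carrier (lorentz R) \<Longrightarrow> x \<oplus>\<^bsub>lorentz R\<^esub> y \<in> carrier (lorentz R)"
  "r \<in> carrier R \<Longrightarrow> x \<in> carrier (lorentz R) \<Longrightarrow> r \<odot>\<^bsub>lorentz R\<^esub> x \<in> carrier (lorentz R)"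
  "x \<in> carrier (lorentz R) \<Longrightarrow> y \<in> carrier (lorentz R) \<Longrightarrow> x \<otimes>\<^bsub>lorentz R\<^esub> y \<in> carrier (lorentz R)"
  by (simp_all add: lorentz_add_closed lorentz_smult_closed lorentz_mult_closed)

lemma lie_autD:
  assumes "\<alpha> \<in> carrier (lie_aut R (lorentz R))"
  shows "bij_betw \<alpha> (carrier (lorentz R)) (carrier (lorentz R))"
    "\<alpha> \<in> extensional (carrier (lorentz R))"
    "x \<in> carrier (lorentz R) \<Longrightarrow> \<alpha> x \<in> carrier (lorentz R)"
    "x \<in> carrier (lorentz R) \<Longrightarrow> y \<in> carrier (lorentz R) \<Longrightarrow> \<alpha> (x \<oplus>\<^bsub>lorentz R\<^esub> y) = \<alpha> x \<oplus>\<^bsub>lorentz R\<^esub> \<alpha> y"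
    "r \<in> carrier R \<Longrightarrow> x \<in> carrier (lorentz R) \<Longrightarrow> \<alpha> (r \<odot>\<^bsub>lorentz R\<^esub> x) = r \<odot>\<^bsub>lorentz R\<^esub> \<alpha> x"
    "x \<in> carrier (lorentz R) \<Longrightarrow> y \<in> carrier (lorentz R) \<Longrightarrow> \<alpha> (x \<otimes>\<^bsub>lorentz R\<^esub> y) = \<alpha> x \<otimes>\<^bsub>lorentz R\<^esub> \<alpha> y"
  using assms unfolding lie_aut_iff by (blast dest: bij_betwE)+

lemma lor_conj_semi:
  assumes \<alpha>: "\<alpha> \<in> carrier (lie_aut R (lorentz R))"
  shows "\<exists>b\<in>carrier (mu2 R). sl2_semi (bar R) (bar_aut R b) (lor_conj \<alpha>)"
proof (rule linear_sl2_semi)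
  note a = lie_autD[OF \<alpha>]
  have "bij_betw lor_vec (sl2 (bar R)) (carrier (lorentz R))"
    by (rule bij_betw_byWitness[where f' = "lor_mat R"])
      (auto simp: lor_vec_mat lor_mat_vec lor_mat_sl2 lor_vec_closed)
  from bij_betw_trans[OF bij_betw_trans[OF this a(1)] lor_mat_bij]
  show "bij_betw (lor_conj \<alpha>) (sl2 (bar R)) (sl2 (bar R))"
    by (simp add: lor_conj_def[abs_def] comp_def)
  show "lor_conj \<alpha> (V \<boxplus>\<^bsub>bar R\<^esub> W) = lor_conj \<alpha> V \<boxplus>\<^bsub>bar R\<^esub> lor_conj \<alpha> W"
    if V: "V \<in> sl2 (bar R)" and W: "W \<in> sl2 (bar R)" for V W
  proof -
    obtain x where x: "x \<in> carrier (lorentz R)" "V = lor_mat R x" using V by (rule sl2_lor_cases)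
    obtain y where y: "y \<in> carrier (lorentz R)" "W = lor_mat R y" using W by (rule sl2_lor_cases)
    show ?thesis unfolding x(2) y(2) using x(1) y(1)
      by (simp add: lor_conj_mat a(3,4) lorentz_closed flip: lor_mat_add)
  qed
  show "lor_conj \<alpha> ((r, \<zero>) \<boxdot>\<^bsub>bar R\<^esub> V) = (r, \<zero>) \<boxdot>\<^bsub>bar R\<^esub> lor_conj \<alpha> V"
    if r: "r \<in> carrier R" and V: "V \<in> sl2 (bar R)" for r V
  proof -
    obtain x where x: "x \<in> carrier (lorentz R)" "V = lor_mat R x" using V by (rule sl2_lor_cases)
    show ?thesis unfolding x(2) using x(1) r
      by (simp add: lor_conj_mat a(3,5) lorentz_closed flip: lor_mat_smult)
  qed
  show "lor_conj \<alpha> (comm2 (bar R) V W) = comm2 (bar R) (lor_conj \<alpha> V) (lor_conj \<alpha> W)"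
    if V: "V \<in> sl2 (bar R)" and W: "W \<in> sl2 (bar R)" for V W
  proof -
    obtain x where x: "x \<in> carrier (lorentz R)" "V = lor_mat R x" using V by (rule sl2_lor_cases)
    obtain y where y: "y \<in> carrier (lorentz R)" "W = lor_mat R y" using W by (rule sl2_lor_cases)
    \<comment> \<open>The commutator is the image of the doubled bracket, so additivity of \<alpha>
      carries the factor 2 across.\<close>
    show ?thesis unfolding x(2) y(2) using x(1) y(1)
      by (simp add: lor_conj_mat lor_mat_mult a(3,4,6) lorentz_closed flip: lor_mat_add)
  qed
qed

lemma lor_signI:
  assumes "b \<in> carrier (mu2 R)" "sl2_semi (bar R) (bar_aut R b) (lor_conj \<alpha>)"
  shows "lor_sign \<alpha> = b"
  unfolding lor_sign_def
proof (rule the_equality)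
  fix c assume c: "c \<in> carrier (mu2 R) \<and> sl2_semi (bar R) (bar_aut R c) (lor_conj \<alpha>)"
  interpret B: cring "bar R" by (rule bar_cring)
  have cc: "c \<in> carrier R" using c by (simp add: mu2_iff)
  have "lor_conj \<alpha> ((\<zero>, \<one>) \<boxdot>\<^bsub>bar R\<^esub> matH (bar R)) = bar_aut R c (\<zero>, \<one>) \<boxdot>\<^bsub>bar R\<^esub> lor_conj \<alpha> (matH (bar R))"
    using c by (intro sl2_semiD(5)[of "bar R" "bar_aut R c"]) auto
  then show "c = b" using cc by (intro bar_semi_unique[OF assms]) auto
qed (use assms in auto)

lemma lor_sign:
  assumes "\<alpha> \<in> carrier (lie_aut R (lorentz R))"
  shows "lor_sign \<alpha> \<in> carrier (mu2 R)" "sl2_semi (bar R) (bar_aut R (lor_sign \<alpha>)) (lor_conj \<alpha>)"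
  using lor_conj_semi[OF assms] lor_signI by auto

lemma lor_pgl_points:
  assumes "\<alpha> \<in> carrier (lie_aut R (lorentz R))"
  shows "lor_pgl \<alpha> \<in> PGL2_points (bar R)"
  unfolding lor_pgl_def
  by (rule half_cring_invol.intertwiners_in_points[OF bar_half_cring_invol])
    (fact lor_sign[OF assms])+

lemma lie_aut_lorentz_group: "group (lie_aut R (lorentz R))"
  by (rule lie_aut_group) (fact lorentz_closed)+

lemma lor_mult:
  assumes \<alpha>: "\<alpha> \<in> carrier (lie_aut R (lorentz R))" and \<beta>: "\<beta> \<in> carrier (lie_aut R (lorentz R))"
  defines "\<gamma> \<equiv> \<alpha> \<otimes>\<^bsub>lie_aut R (lorentz R)\<^esub> \<beta>"
  shows "lor_sign \<gamma> = lor_sign \<alpha> \<otimes> lor_sign \<beta>"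
    and "lor_pgl \<gamma> = span2 (bar R) (set_mult (Mat2 (bar R)) (lor_pgl \<alpha>)
      (map_mat2 (bar_aut R (lor_sign \<alpha>)) ` lor_pgl \<beta>))"
proof -
  have conj: "lor_conj \<gamma> V = lor_conj \<alpha> (lor_conj \<beta> V)" if "V \<in> sl2 (bar R)" for V
    using that by (elim sl2_lor_cases)
      (simp add: \<gamma>_def lie_aut_mult[OF \<alpha> \<beta>] compose_def lor_conj_mat lie_autD(3)[OF \<alpha>] lie_autD(3)[OF \<beta>])
  note a = lor_sign[OF \<alpha>] and b = lor_sign[OF \<beta>]
  interpret mu: comm_group "mu2 R" by (rule mu2_comm_group)
  have ab: "lor_sign \<alpha> \<otimes> lor_sign \<beta> \<in> carrier (mu2 R)" using mu.m_closed[OF a(1) b(1)] by simp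
  have eq: "bar_aut R (lor_sign \<alpha> \<otimes> lor_sign \<beta>) s = bar_aut R (lor_sign \<alpha>) (bar_aut R (lor_sign \<beta>) s)"
    if "s \<in> carrier (bar R)" for s
    using that a(1) b(1) by (simp add: bar_aut_mult mu2_iff)
  note i = bar_half_cring_invol[OF a(1)] bar_half_cring_invol[OF b(1)] bar_half_cring_invol[OF ab]
  have "sl2_semi (bar R) (bar_aut R (lor_sign \<alpha> \<otimes> lor_sign \<beta>)) (lor_conj \<gamma>)"
    by (rule sl2_semi_compose[OF i(1,2) eq a(2) b(2) conj])
  then show s: "lor_sign \<gamma> = lor_sign \<alpha> \<otimes> lor_sign \<beta>" by (rule lor_signI[OF ab])
  show "lor_pgl \<gamma> = span2 (bar R) (set_mult (Mat2 (bar R)) (lor_pgl \<alpha>)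
      (map_mat2 (bar_aut R (lor_sign \<alpha>)) ` lor_pgl \<beta>))"
    unfolding lor_pgl_def s by (rule intertwiners_compose[OF i eq a(2) b(2) conj])
qed

lemma lor_one:
  shows "lor_sign \<one>\<^bsub>lie_aut R (lorentz R)\<^esub> = \<one>"
    and "lor_pgl \<one>\<^bsub>lie_aut R (lorentz R)\<^esub> = span2 (bar R) {\<one>\<^bsub>Mat2 (bar R)\<^esub>}"
proof -
  interpret G: group "lie_aut R (lorentz R)" by (rule lie_aut_lorentz_group)
  interpret B: cring "bar R" by (rule bar_cring)
  have conj: "lor_conj \<one>\<^bsub>lie_aut R (lorentz R)\<^esub> V = V" if "V \<in> sl2 (bar R)" for V
    using that by (elim sl2_lor_cases) (simp add: lie_aut_one lor_conj_mat)
  have one: "\<one> \<in> carrier (mu2 R)" by (simp add: mu2_iff)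
  note s = lor_sign[OF G.one_closed]
  \<comment> \<open>By multiplicativity the sign is idempotent, and its square is 1.\<close>
  have "lor_sign \<one>\<^bsub>lie_aut R (lorentz R)\<^esub> \<otimes> lor_sign \<one>\<^bsub>lie_aut R (lorentz R)\<^esub> = lor_sign \<one>\<^bsub>lie_aut R (lorentz R)\<^esub>"
    using lor_mult(1)[OF G.one_closed G.one_closed] by simp
  then show 1: "lor_sign \<one>\<^bsub>lie_aut R (lorentz R)\<^esub> = \<one>" using s(1) by (simp add: mu2_iff)
  show "lor_pgl \<one>\<^bsub>lie_aut R (lorentz R)\<^esub> = span2 (bar R) {\<one>\<^bsub>Mat2 (bar R)\<^esub>}"
    unfolding lor_pgl_def
    by (rule half_cring_invol.intertwiners_id[OF bar_half_cring_invol[OF s(1)] _ conj s(2)])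
      (auto simp: 1 elim!: bar_cases)
qed

lemma lor_inj:
  assumes \<alpha>: "\<alpha> \<in> carrier (lie_aut R (lorentz R))" and \<beta>: "\<beta> \<in> carrier (lie_aut R (lorentz R))"
    and eq: "lor_sign \<alpha> = lor_sign \<beta>" "lor_pgl \<alpha> = lor_pgl \<beta>"
  shows "\<alpha> = \<beta>"
proof (rule extensionalityI)
  show "\<alpha> \<in> extensional (carrier (lorentz R))" "\<beta> \<in> extensional (carrier (lorentz R))"
    using lie_autD(2) \<alpha> \<beta> by auto
  fix x assume x: "x \<in> carrier (lorentz R)"
  have "lor_conj \<alpha> (lor_mat R x) = lor_conj \<beta> (lor_mat R x)"
    by (rule half_cring_invol.intertwiners_inj[OF bar_half_cring_invol[OF lor_sign(1)[OF \<alpha>]]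
          lor_sign(2)[OF \<alpha>] lor_sign(2)[OF \<beta>, folded eq(1)] eq(2)[unfolded lor_pgl_def eq(1)[symmetric]]])
      (rule lor_mat_sl2[OF x])
  then have "lor_mat R (\<alpha> x) = lor_mat R (\<beta> x)" using x by (simp add: lor_conj_mat)
  then show "\<alpha> x = \<beta> x"
    using lor_vec_mat lie_autD(3)[OF \<alpha> x] lie_autD(3)[OF \<beta> x] by metis
qed

lemma lor_surj:
  assumes L: "L \<in> PGL2_points (bar R)" and b: "b \<in> carrier (mu2 R)"
  obtains \<alpha> where "\<alpha> \<in> carrier (lie_aut R (lorentz R))" "lor_pgl \<alpha> = L" "lor_sign \<alpha> = b"
proof -
  interpret B: half_cring_invol "bar R" "bar_aut R b" by (rule bar_half_cring_invol[OF b])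
  obtain A where A: "sl2_semi (bar R) (bar_aut R b) A" "intertwiners (bar R) (bar_aut R b) A = L"
    using B.points_are_intertwiners[OF L] by blast
  note a = sl2_semiD[OF A(1)]
  have bc: "b \<in> carrier R" using b by (simp add: mu2_iff)
  define \<alpha> where "\<alpha> = (\<lambda>x\<in>carrier (lorentz R). lor_vec (A (lor_mat R x)))"
  have \<alpha>c: "\<alpha> x \<in> carrier (lorentz R)" if "x \<in> carrier (lorentz R)" for x
    using that a(2) lor_mat_sl2 lor_vec_closed by (simp add: \<alpha>_def)
  have m\<alpha>: "lor_mat R (\<alpha> x) = A (lor_mat R x)" if "x \<in> carrier (lorentz R)" for x
    using that a(2) lor_mat_sl2 by (simp add: \<alpha>_def lor_mat_vec)
  have inj: "x = y" if "x \<in> carrier (lorentz R)" "y \<in> carrier (lorentz R)" "lor_mat R x = lor_mat R y" for x y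
    using that lor_vec_mat by metis
  have conj: "lor_conj \<alpha> V = A V" if "V \<in> sl2 (bar R)" for V
    using that by (elim sl2_lor_cases) (simp add: lor_conj_mat m\<alpha>)
  have mult: "\<alpha> (x \<otimes>\<^bsub>lorentz R\<^esub> y) = \<alpha> x \<otimes>\<^bsub>lorentz R\<^esub> \<alpha> y"
    if xy: "x \<in> carrier (lorentz R)" "y \<in> carrier (lorentz R)" for x y
  proof (rule inj)
    note c = xy lorentz_closed(3)[OF xy] \<alpha>c[OF xy(1)] \<alpha>c[OF xy(2)]
    show "lor_mat R (\<alpha> (x \<otimes>\<^bsub>lorentz R\<^esub> y)) = lor_mat R (\<alpha> x \<otimes>\<^bsub>lorentz R\<^esub> \<alpha> y)"
    \<comment> \<open>The commutator sees only the doubled bracket, so equality is shown for doubles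
      and then 2 is cancelled.\<close>
    proof (rule B.Mat2_double_eq)
      have "lor_mat R (\<alpha> (x \<otimes>\<^bsub>lorentz R\<^esub> y)) \<boxplus>\<^bsub>bar R\<^esub> lor_mat R (\<alpha> (x \<otimes>\<^bsub>lorentz R\<^esub> y))
        = A (lor_mat R (x \<otimes>\<^bsub>lorentz R\<^esub> y) \<boxplus>\<^bsub>bar R\<^esub> lor_mat R (x \<otimes>\<^bsub>lorentz R\<^esub> y))"
        using c by (simp add: m\<alpha> a(4) lor_mat_sl2)
      also have "\<dots> = A (comm2 (bar R) (lor_mat R x) (lor_mat R y))" by (simp add: lor_mat_mult[OF xy])
      also have "\<dots> = comm2 (bar R) (lor_mat R (\<alpha> x)) (lor_mat R (\<alpha> y))"
        using c by (simp add: m\<alpha> a(6) lor_mat_sl2)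
      also have "\<dots> = lor_mat R (\<alpha> x \<otimes>\<^bsub>lorentz R\<^esub> \<alpha> y) \<boxplus>\<^bsub>bar R\<^esub> lor_mat R (\<alpha> x \<otimes>\<^bsub>lorentz R\<^esub> \<alpha> y)"
        by (rule lor_mat_mult) (use c in auto)
      finally show "lor_mat R (\<alpha> (x \<otimes>\<^bsub>lorentz R\<^esub> y)) \<boxplus>\<^bsub>bar R\<^esub> lor_mat R (\<alpha> (x \<otimes>\<^bsub>lorentz R\<^esub> y)) =
        lor_mat R (\<alpha> x \<otimes>\<^bsub>lorentz R\<^esub> \<alpha> y) \<boxplus>\<^bsub>bar R\<^esub> lor_mat R (\<alpha> x \<otimes>\<^bsub>lorentz R\<^esub> \<alpha> y)" .
    qed (use c \<alpha>c lorentz_closed lor_mat_sl2 B.sl2_carrier in auto)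
  qed (use xy \<alpha>c lorentz_closed in auto)
  have "\<alpha> \<in> carrier (lie_aut R (lorentz R))"
    unfolding lie_aut_iff
  proof (intro conjI ballI)
    show "\<alpha> \<in> extensional (carrier (lorentz R))" by (simp add: \<alpha>_def)
    have "bij_betw lor_vec (sl2 (bar R)) (carrier (lorentz R))"
      by (rule bij_betw_byWitness[where f' = "lor_mat R"])
        (auto simp: lor_vec_mat lor_mat_vec lor_mat_sl2 lor_vec_closed)
    from bij_betw_trans[OF bij_betw_trans[OF lor_mat_bij a(1)] this]
    have "bij_betw (\<lambda>x. lor_vec (A (lor_mat R x))) (carrier (lorentz R)) (carrier (lorentz R))"
      by (simp add: comp_def)
    then show "bij_betw \<alpha> (carrier (lorentz R)) (carrier (lorentz R))"
      by (rule bij_betw_cong[THEN iffD1, rotated]) (simp add: \<alpha>_def)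
    show "\<alpha> (x \<oplus>\<^bsub>lorentz R\<^esub> y) = \<alpha> x \<oplus>\<^bsub>lorentz R\<^esub> \<alpha> y"
      if xy: "x \<in> carrier (lorentz R)" "y \<in> carrier (lorentz R)" for x y
      by (rule inj) (use xy \<alpha>c in \<open>simp_all add: lorentz_closed m\<alpha> lor_mat_add a(4) lor_mat_sl2\<close>)
    show "\<alpha> (r \<odot>\<^bsub>lorentz R\<^esub> x) = r \<odot>\<^bsub>lorentz R\<^esub> \<alpha> x"
      if x: "r \<in> carrier R" "x \<in> carrier (lorentz R)" for r x
      by (rule inj) (use x \<alpha>c bc in \<open>simp_all add: lorentz_closed m\<alpha> lor_mat_smult a(5) lor_mat_sl2\<close>)
  qed (rule mult)
  moreover have semi: "sl2_semi (bar R) (bar_aut R b) (lor_conj \<alpha>)"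
  proof -
    have "bij_betw (lor_conj \<alpha>) (sl2 (bar R)) (sl2 (bar R)) \<longleftrightarrow> bij_betw A (sl2 (bar R)) (sl2 (bar R))"
      by (rule bij_betw_cong) (rule conj)
    then show ?thesis
      using a by (simp add: sl2_semi_def conj B.comm2_closed)
  qed
  ultimately have s: "lor_sign \<alpha> = b" by (intro lor_signI[OF b])
  have "lor_pgl \<alpha> = L"
    unfolding lor_pgl_def s A(2)[symmetric] intertwiners_def using conj by simp
  with s \<open>\<alpha> \<in> carrier (lie_aut R (lorentz R))\<close> show thesis using that by blast
qed

text \<open>The target is so far a bare record with a multiplication; \<open>iso\<close> asks for a
  multiplicative bijection, from which its group laws are deduced later.\<close>

theorem lorentz_aut_iso:
  "(\<lambda>\<alpha>. (lor_pgl \<alpha>, lor_sign \<alpha>)) \<in> iso (lie_aut R (lorentz R))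
     (semidirect (PGL2_sheaf (bar R)) (mu2 R) (\<lambda>b L. map_mat2 (bar_aut R b) ` L))"
proof (rule isoI)
  let ?f = "\<lambda>\<alpha>. (lor_pgl \<alpha>, lor_sign \<alpha>)"
  show "?f \<in> hom (lie_aut R (lorentz R))
     (semidirect (PGL2_sheaf (bar R)) (mu2 R) (\<lambda>b L. map_mat2 (bar_aut R b) ` L))"
    by (rule homI)
      (simp_all add: semidirect_def PGL2_sheaf_def lor_pgl_points lor_sign lor_mult)
  show "bij_betw ?f (carrier (lie_aut R (lorentz R))) (carrier
     (semidirect (PGL2_sheaf (bar R)) (mu2 R) (\<lambda>b L. map_mat2 (bar_aut R b) ` L)))"
    unfolding bij_betw_def
  proof
    show "inj_on ?f (carrier (lie_aut R (lorentz R)))" by (rule inj_onI) (auto intro: lor_inj)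
    show "?f ` carrier (lie_aut R (lorentz R)) = carrier
       (semidirect (PGL2_sheaf (bar R)) (mu2 R) (\<lambda>b L. map_mat2 (bar_aut R b) ` L))"
    proof
      show "?f ` carrier (lie_aut R (lorentz R)) \<subseteq> carrier
         (semidirect (PGL2_sheaf (bar R)) (mu2 R) (\<lambda>b L. map_mat2 (bar_aut R b) ` L))"
        using lor_pgl_points lor_sign by (auto simp: semidirect_def PGL2_sheaf_def)
      show "carrier (semidirect (PGL2_sheaf (bar R)) (mu2 R) (\<lambda>b L. map_mat2 (bar_aut R b) ` L))
         \<subseteq> ?f ` carrier (lie_aut R (lorentz R))"
      proof
        fix z assume "z \<in> carrier (semidirect (PGL2_sheaf (bar R)) (mu2 R) (\<lambda>b L. map_mat2 (bar_aut R b) ` L))"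
        then obtain L b where z: "z = (L, b)" "L \<in> PGL2_points (bar R)" "b \<in> carrier (mu2 R)"
          by (auto simp: semidirect_def PGL2_sheaf_def)
        obtain \<alpha> where "\<alpha> \<in> carrier (lie_aut R (lorentz R))" "lor_pgl \<alpha> = L" "lor_sign \<alpha> = b"
          using lor_surj[OF z(2,3)] .
        then show "z \<in> ?f ` carrier (lie_aut R (lorentz R))" unfolding z(1) by blast
      qed
    qed
  qed
qed

end


section \<open>Base change\<close>

text \<open>Base change is treated for all linear maps, so that identities between base changes can
  be compared on basis vectors before brackets and bijectivity come in.\<close>

definition lorentz_linear :: "('r, 'm) ring_scheme \<Rightarrow> ((nat \<Rightarrow> 'r) \<Rightarrow> (nat \<Rightarrow> 'r)) \<Rightarrow> bool" where
  "lorentz_linear R f \<longleftrightarrow> f \<in> carrier (lorentz R) \<rightarrow> carrier (lorentz R) \<and>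
     (\<forall>x\<in>carrier (lorentz R). \<forall>y\<in>carrier (lorentz R). f (x \<oplus>\<^bsub>lorentz R\<^esub> y) = f x \<oplus>\<^bsub>lorentz R\<^esub> f y) \<and>
     (\<forall>r\<in>carrier R. \<forall>x\<in>carrier (lorentz R). f (r \<odot>\<^bsub>lorentz R\<^esub> x) = r \<odot>\<^bsub>lorentz R\<^esub> f x)"

text \<open>The \<open>mor\<close> field of \<open>Aut_lorentz\<close>, freed from the restriction
  that both rings have elements of the same type.\<close>

definition lorentz_base_change ::
    "('r, 'm) ring_scheme \<Rightarrow> ('s, 'n) ring_scheme \<Rightarrow> ('r \<Rightarrow> 's) \<Rightarrow>
     ((nat \<Rightarrow> 'r) \<Rightarrow> (nat \<Rightarrow> 'r)) \<Rightarrow> (nat \<Rightarrow> 's) \<Rightarrow> (nat \<Rightarrow> 's)" where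
  "lorentz_base_change R S h \<alpha> = (\<lambda>y\<in>carrier (lorentz S). \<lambda>i\<in>{1..6}.
     finsum S (\<lambda>j. y j \<otimes>\<^bsub>S\<^esub> h (\<alpha> (lorentz_basis R j) i)) {1..6})"

definition lorentz_map :: "('r \<Rightarrow> 's) \<Rightarrow> (nat \<Rightarrow> 'r) \<Rightarrow> nat \<Rightarrow> 's" where
  "lorentz_map h x = (\<lambda>i\<in>{1..6}. h (x i))"

lemma lorentz_map_apply [simp]: "i \<in> {1..6} \<Longrightarrow> lorentz_map h x i = h (x i)"
  by (simp add: lorentz_map_def)

lemma lorentz_extI:
  assumes "x \<in> carrier (lorentz R)" "y \<in> carrier (lorentz R)" "\<And>i. i \<in> {1..6} \<Longrightarrow> x i = y i"
  shows "x = y"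
  by (rule PiE_ext[of _ "{1..6}" "\<lambda>_. carrier R"]) (use assms in \<open>simp_all add: lorentz_def\<close>)

lemma lorentz_base_change_apply:
  "y \<in> carrier (lorentz S) \<Longrightarrow> i \<in> {1..6} \<Longrightarrow>
   lorentz_base_change R S h \<alpha> y i = finsum S (\<lambda>j. y j \<otimes>\<^bsub>S\<^esub> h (\<alpha> (lorentz_basis R j) i)) {1..6}"
  by (simp add: lorentz_base_change_def)

context cring
begin

lemma lorentz_basis_closed: "lorentz_basis R j \<in> carrier (lorentz R)"
  by (auto simp: lorentz_basis_def lorentz_def)

lemma lorentz_basis_apply: "i \<in> {1..6} \<Longrightarrow> lorentz_basis R j i = (if i = j then \<one> else \<zero>)"
  by (simp add: lorentz_basis_def)

lemma lorentz_expand: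
  assumes x: "x \<in> carrier (lorentz R)"
  shows "x = (x 1 \<odot>\<^bsub>lorentz R\<^esub> lorentz_basis R 1) \<oplus>\<^bsub>lorentz R\<^esub> ((x 2 \<odot>\<^bsub>lorentz R\<^esub> lorentz_basis R 2) \<oplus>\<^bsub>lorentz R\<^esub>
    ((x 3 \<odot>\<^bsub>lorentz R\<^esub> lorentz_basis R 3) \<oplus>\<^bsub>lorentz R\<^esub> ((x 4 \<odot>\<^bsub>lorentz R\<^esub> lorentz_basis R 4) \<oplus>\<^bsub>lorentz R\<^esub>
    ((x 5 \<odot>\<^bsub>lorentz R\<^esub> lorentz_basis R 5) \<oplus>\<^bsub>lorentz R\<^esub> (x 6 \<odot>\<^bsub>lorentz R\<^esub> lorentz_basis R 6)))))" (is "x = ?y")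
proof (rule lorentz_eqI)
  note c = lorentz_coord(2-7)[OF x]
  show "?y \<in> carrier (lorentz R)"
    using c by (intro lorentz_add_closed lorentz_smult_closed lorentz_basis_closed)
  show "x 1 = ?y 1" "x 2 = ?y 2" "x 3 = ?y 3" "x 4 = ?y 4" "x 5 = ?y 5" "x 6 = ?y 6"
    using c by (simp_all add: lorentz_add_apply lorentz_smult_apply lorentz_basis_apply)
qed (fact x)

lemma lorentz_induct:
  assumes x: "x \<in> carrier (lorentz R)"
    and basis: "\<And>j. j \<in> {1..6} \<Longrightarrow> Q (lorentz_basis R j)"
    and add: "\<And>x y. x \<in> carrier (lorentz R) \<Longrightarrow> y \<in> carrier (lorentz R) \<Longrightarrow> Q x \<Longrightarrow> Q y \<Longrightarrow> Q (x \<oplus>\<^bsub>lorentz R\<^esub> y)"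
    and smult: "\<And>r x. r \<in> carrier R \<Longrightarrow> x \<in> carrier (lorentz R) \<Longrightarrow> Q x \<Longrightarrow> Q (r \<odot>\<^bsub>lorentz R\<^esub> x)"
  shows "Q x"
proof -
  note c = lorentz_coord(2-7)[OF x]
  have s: "Q (r \<odot>\<^bsub>lorentz R\<^esub> lorentz_basis R j)" "r \<odot>\<^bsub>lorentz R\<^esub> lorentz_basis R j \<in> carrier (lorentz R)"
    if "r \<in> carrier R" "j \<in> {1..6}" for r j
    by (rule smult[OF that(1) lorentz_basis_closed basis[OF that(2)]],
      rule lorentz_smult_closed[OF that(1) lorentz_basis_closed])
  show ?thesis
    by (subst lorentz_expand[OF x]) (intro add lorentz_add_closed s c; simp)
qed

lemma lorentz_linearD:
  assumes "lorentz_linear R f"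
  shows "x \<in> carrier (lorentz R) \<Longrightarrow> f x \<in> carrier (lorentz R)"
    "x \<in> carrier (lorentz R) \<Longrightarrow> y \<in> carrier (lorentz R) \<Longrightarrow> f (x \<oplus>\<^bsub>lorentz R\<^esub> y) = f x \<oplus>\<^bsub>lorentz R\<^esub> f y"
    "r \<in> carrier R \<Longrightarrow> x \<in> carrier (lorentz R) \<Longrightarrow> f (r \<odot>\<^bsub>lorentz R\<^esub> x) = r \<odot>\<^bsub>lorentz R\<^esub> f x"
  using assms by (auto simp: lorentz_linear_def)

lemma lorentz_linear_eqI:
  assumes "lorentz_linear R f" "lorentz_linear R g" "x \<in> carrier (lorentz R)"
    and "\<And>j. j \<in> {1..6} \<Longrightarrow> f (lorentz_basis R j) = g (lorentz_basis R j)"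
  shows "f x = g x"
  using assms(3)
  by (rule lorentz_induct) (simp_all add: assms(4) lorentz_linearD[OF assms(1)] lorentz_linearD[OF assms(2)])

lemma lorentz_linear_comp:
  "lorentz_linear R f \<Longrightarrow> lorentz_linear R g \<Longrightarrow> lorentz_linear R (\<lambda>x. f (g x))"
  by (auto simp: lorentz_linear_def Pi_iff)

lemma lie_aut_linear: "\<alpha> \<in> carrier (lie_aut R (lorentz R)) \<Longrightarrow> lorentz_linear R \<alpha>"
  unfolding lie_aut_iff lorentz_linear_def by (blast dest: bij_betwE)

lemma lorentz_mult_add:
  assumes "x \<in> carrier (lorentz R)" "y \<in> carrier (lorentz R)" "z \<in> carrier (lorentz R)"
  shows "(x \<oplus>\<^bsub>lorentz R\<^esub> y) \<otimes>\<^bsub>lorentz R\<^esub> z = (x \<otimes>\<^bsub>lorentz R\<^esub> z) \<oplus>\<^bsub>lorentz R\<^esub> (y \<otimes>\<^bsub>lorentz R\<^esub> z)"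
    and "z \<otimes>\<^bsub>lorentz R\<^esub> (x \<oplus>\<^bsub>lorentz R\<^esub> y) = (z \<otimes>\<^bsub>lorentz R\<^esub> x) \<oplus>\<^bsub>lorentz R\<^esub> (z \<otimes>\<^bsub>lorentz R\<^esub> y)"
proof -
  note c = lorentz_coord(2-7)[OF assms(1)] lorentz_coord(2-7)[OF assms(2)] lorentz_coord(2-7)[OF assms(3)]
  show "(x \<oplus>\<^bsub>lorentz R\<^esub> y) \<otimes>\<^bsub>lorentz R\<^esub> z = (x \<otimes>\<^bsub>lorentz R\<^esub> z) \<oplus>\<^bsub>lorentz R\<^esub> (y \<otimes>\<^bsub>lorentz R\<^esub> z)"
  proof (rule lorentz_eqI)
    show "(x \<oplus>\<^bsub>lorentz R\<^esub> y) \<otimes>\<^bsub>lorentz R\<^esub> z \<in> carrier (lorentz R)" "(x \<otimes>\<^bsub>lorentz R\<^esub> z) \<oplus>\<^bsub>lorentz R\<^esub> (y \<otimes>\<^bsub>lorentz R\<^esub> z) \<in> carrier (lorentz R)"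
      using assms by (simp_all add: lorentz_add_closed lorentz_mult_closed)
  qed (use c in \<open>simp_all only: lorentz_add_coord lorentz_mult_coord, simp_all add: a_minus_def l_distr r_distr minus_add minus_minus a_ac\<close>)
  show "z \<otimes>\<^bsub>lorentz R\<^esub> (x \<oplus>\<^bsub>lorentz R\<^esub> y) = (z \<otimes>\<^bsub>lorentz R\<^esub> x) \<oplus>\<^bsub>lorentz R\<^esub> (z \<otimes>\<^bsub>lorentz R\<^esub> y)"
  proof (rule lorentz_eqI)
    show "z \<otimes>\<^bsub>lorentz R\<^esub> (x \<oplus>\<^bsub>lorentz R\<^esub> y) \<in> carrier (lorentz R)" "(z \<otimes>\<^bsub>lorentz R\<^esub> x) \<oplus>\<^bsub>lorentz R\<^esub> (z \<otimes>\<^bsub>lorentz R\<^esub> y) \<in> carrier (lorentz R)"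
      using assms by (simp_all add: lorentz_add_closed lorentz_mult_closed)
  qed (use c in \<open>simp_all only: lorentz_add_coord lorentz_mult_coord, simp_all add: a_minus_def l_distr r_distr minus_add minus_minus a_ac\<close>)
qed

lemma lorentz_mult_smult:
  assumes "r \<in> carrier R" "x \<in> carrier (lorentz R)" "z \<in> carrier (lorentz R)"
  shows "(r \<odot>\<^bsub>lorentz R\<^esub> x) \<otimes>\<^bsub>lorentz R\<^esub> z = r \<odot>\<^bsub>lorentz R\<^esub> (x \<otimes>\<^bsub>lorentz R\<^esub> z)"
    and "z \<otimes>\<^bsub>lorentz R\<^esub> (r \<odot>\<^bsub>lorentz R\<^esub> x) = r \<odot>\<^bsub>lorentz R\<^esub> (z \<otimes>\<^bsub>lorentz R\<^esub> x)"
proof -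
  note c = lorentz_coord(2-7)[OF assms(2)] lorentz_coord(2-7)[OF assms(3)] assms(1)
  show "(r \<odot>\<^bsub>lorentz R\<^esub> x) \<otimes>\<^bsub>lorentz R\<^esub> z = r \<odot>\<^bsub>lorentz R\<^esub> (x \<otimes>\<^bsub>lorentz R\<^esub> z)"
  proof (rule lorentz_eqI)
    show "(r \<odot>\<^bsub>lorentz R\<^esub> x) \<otimes>\<^bsub>lorentz R\<^esub> z \<in> carrier (lorentz R)" "r \<odot>\<^bsub>lorentz R\<^esub> (x \<otimes>\<^bsub>lorentz R\<^esub> z) \<in> carrier (lorentz R)"
      using assms by (simp_all add: lorentz_smult_closed lorentz_mult_closed)
  qed (use c in \<open>simp_all only: lorentz_smult_coord lorentz_mult_coord, simp_all add: a_minus_def r_distr r_minus m_ac\<close>)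
  show "z \<otimes>\<^bsub>lorentz R\<^esub> (r \<odot>\<^bsub>lorentz R\<^esub> x) = r \<odot>\<^bsub>lorentz R\<^esub> (z \<otimes>\<^bsub>lorentz R\<^esub> x)"
  proof (rule lorentz_eqI)
    show "z \<otimes>\<^bsub>lorentz R\<^esub> (r \<odot>\<^bsub>lorentz R\<^esub> x) \<in> carrier (lorentz R)" "r \<odot>\<^bsub>lorentz R\<^esub> (z \<otimes>\<^bsub>lorentz R\<^esub> x) \<in> carrier (lorentz R)"
      using assms by (simp_all add: lorentz_smult_closed lorentz_mult_closed)
  qed (use c in \<open>simp_all only: lorentz_smult_coord lorentz_mult_coord, simp_all add: a_minus_def r_distr r_minus m_ac\<close>)
qed

end

section \<open>Base change of linear maps along a ring homomorphism\<close>

context ring_hom_cring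
begin

lemma lorentz_map_closed:
  "x \<in> carrier (lorentz R) \<Longrightarrow> lorentz_map h x \<in> carrier (lorentz S)"
  by (auto simp: lorentz_map_def lorentz_def)

lemma lorentz_map_add:
  assumes "x \<in> carrier (lorentz R)" "y \<in> carrier (lorentz R)"
  shows "lorentz_map h (x \<oplus>\<^bsub>lorentz R\<^esub> y) = lorentz_map h x \<oplus>\<^bsub>lorentz S\<^esub> lorentz_map h y"
  using lorentz_coord(1)[OF assms(1)] lorentz_coord(1)[OF assms(2)]
  by (auto simp: lorentz_map_def lorentz_def fun_eq_iff)

lemma lorentz_map_smult:
  assumes "r \<in> carrier R" "x \<in> carrier (lorentz R)"
  shows "lorentz_map h (r \<odot>\<^bsub>lorentz R\<^esub> x) = h r \<odot>\<^bsub>lorentz S\<^esub> lorentz_map h x"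
  using lorentz_coord(1)[OF assms(2)] assms(1)
  by (auto simp: lorentz_map_def lorentz_def fun_eq_iff)

lemma lorentz_map_basis: "lorentz_map h (lorentz_basis R j) = lorentz_basis S j"
  by (auto simp: lorentz_map_def lorentz_basis_def fun_eq_iff)

lemma lorentz_map_mult:
  assumes "x \<in> carrier (lorentz R)" "y \<in> carrier (lorentz R)"
  shows "lorentz_map h (x \<otimes>\<^bsub>lorentz R\<^esub> y) = lorentz_map h x \<otimes>\<^bsub>lorentz S\<^esub> lorentz_map h y"
proof (rule lorentz_eqI)
  note c = lorentz_coord(2-7)[OF assms(1)] lorentz_coord(2-7)[OF assms(2)]
  show "lorentz_map h (x \<otimes>\<^bsub>lorentz R\<^esub> y) \<in> carrier (lorentz S)"
    "lorentz_map h x \<otimes>\<^bsub>lorentz S\<^esub> lorentz_map h y \<in> carrier (lorentz S)"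
    using assms by (auto intro: lorentz_map_closed R.lorentz_mult_closed S.lorentz_mult_closed)
  show "lorentz_map h (x \<otimes>\<^bsub>lorentz R\<^esub> y) 1 = (lorentz_map h x \<otimes>\<^bsub>lorentz S\<^esub> lorentz_map h y) 1"
    "lorentz_map h (x \<otimes>\<^bsub>lorentz R\<^esub> y) 2 = (lorentz_map h x \<otimes>\<^bsub>lorentz S\<^esub> lorentz_map h y) 2"
    "lorentz_map h (x \<otimes>\<^bsub>lorentz R\<^esub> y) 3 = (lorentz_map h x \<otimes>\<^bsub>lorentz S\<^esub> lorentz_map h y) 3"
    "lorentz_map h (x \<otimes>\<^bsub>lorentz R\<^esub> y) 4 = (lorentz_map h x \<otimes>\<^bsub>lorentz S\<^esub> lorentz_map h y) 4"
    "lorentz_map h (x \<otimes>\<^bsub>lorentz R\<^esub> y) 5 = (lorentz_map h x \<otimes>\<^bsub>lorentz S\<^esub> lorentz_map h y) 5"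
    "lorentz_map h (x \<otimes>\<^bsub>lorentz R\<^esub> y) 6 = (lorentz_map h x \<otimes>\<^bsub>lorentz S\<^esub> lorentz_map h y) 6"
    using c by (simp_all add: lorentz_mult_coord[unfolded One_nat_def] a_minus_def)
qed

lemma lor_mat_map:
  assumes "x \<in> carrier (lorentz R)"
  shows "map_mat2 (map_prod h h) (lor_mat R x) = lor_mat S (lorentz_map h x)"
  using lorentz_coord(2-7)[OF assms] by (simp add: lor_mat_def map_mat2_def a_minus_def)

lemma bar_hom: "ring_hom_cring (bar R) (bar S) (map_prod h h)"
proof -
  interpret BR: cring "bar R" by (rule R.bar_cring)
  interpret BS: cring "bar S" by (rule S.bar_cring)
  have "map_prod h h \<in> ring_hom (bar R) (bar S)"
    by (rule ring_hom_memI) (auto elim!: R.bar_cases simp: a_minus_def)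
  then show ?thesis by unfold_locales
qed

abbreviation "bc \<equiv> lorentz_base_change R S h"

lemma base_change_linear:
  assumes "lorentz_linear R \<alpha>"
  shows "lorentz_linear S (bc \<alpha>)"
proof -
  have c: "h (\<alpha> (lorentz_basis R j) i) \<in> carrier S" if "i \<in> {1..6}" for i j
    using lorentz_coord(1)[OF R.lorentz_linearD(1)[OF assms R.lorentz_basis_closed] that] by simp
  have fin: "finite {1..6::nat}" by simp
  have cl: "bc \<alpha> y \<in> carrier (lorentz S)" if y: "y \<in> carrier (lorentz S)" for y
    using c lorentz_coord(1)[OF y] y
    by (auto simp: lorentz_base_change_def lorentz_def intro!: S.finsum_closed)
  show ?thesis
    unfolding lorentz_linear_def
  proof (intro conjI ballI)
    show "bc \<alpha> \<in> carrier (lorentz S) \<rightarrow> carrier (lorentz S)" using cl by blast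
    fix y z assume yz: "y \<in> carrier (lorentz S)" "z \<in> carrier (lorentz S)"
    note cy = lorentz_coord(1)[OF yz(1)] lorentz_coord(1)[OF yz(2)]
    show "bc \<alpha> (y \<oplus>\<^bsub>lorentz S\<^esub> z) = bc \<alpha> y \<oplus>\<^bsub>lorentz S\<^esub> bc \<alpha> z"
    proof (rule lorentz_extI[where R = S])
      fix i :: nat assume i: "i \<in> {1..6}"
      have "bc \<alpha> (y \<oplus>\<^bsub>lorentz S\<^esub> z) i =
        finsum S (\<lambda>j. y j \<otimes>\<^bsub>S\<^esub> h (\<alpha> (lorentz_basis R j) i) \<oplus>\<^bsub>S\<^esub> z j \<otimes>\<^bsub>S\<^esub> h (\<alpha> (lorentz_basis R j) i)) {1..6}"
        unfolding lorentz_base_change_apply[OF S.lorentz_add_closed[OF yz] i]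
        using c[OF i] cy by (intro S.finsum_cong') (auto simp: lorentz_add_apply S.l_distr)
      also have "\<dots> = bc \<alpha> y i \<oplus>\<^bsub>S\<^esub> bc \<alpha> z i"
        unfolding lorentz_base_change_apply[OF yz(1) i] lorentz_base_change_apply[OF yz(2) i]
        using c[OF i] cy by (intro S.finsum_addf) auto
      finally show "bc \<alpha> (y \<oplus>\<^bsub>lorentz S\<^esub> z) i = (bc \<alpha> y \<oplus>\<^bsub>lorentz S\<^esub> bc \<alpha> z) i"
        by (simp only: lorentz_add_apply[OF i])
    qed (use yz cl in \<open>simp_all add: S.lorentz_add_closed\<close>)
  next
    fix r y assume r: "r \<in> carrier S" and y: "y \<in> carrier (lorentz S)"
    note cy = lorentz_coord(1)[OF y]
    show "bc \<alpha> (r \<odot>\<^bsub>lorentz S\<^esub> y) = r \<odot>\<^bsub>lorentz S\<^esub> bc \<alpha> y"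
    proof (rule lorentz_extI[where R = S])
      fix i :: nat assume i: "i \<in> {1..6}"
      have "bc \<alpha> (r \<odot>\<^bsub>lorentz S\<^esub> y) i =
        finsum S (\<lambda>j. r \<otimes>\<^bsub>S\<^esub> (y j \<otimes>\<^bsub>S\<^esub> h (\<alpha> (lorentz_basis R j) i))) {1..6}"
        unfolding lorentz_base_change_apply[OF S.lorentz_smult_closed[OF r y] i]
        using c[OF i] cy r by (intro S.finsum_cong') (auto simp: lorentz_smult_apply S.m_assoc)
      also have "\<dots> = r \<otimes>\<^bsub>S\<^esub> bc \<alpha> y i"
        unfolding lorentz_base_change_apply[OF y i]
        using c[OF i] cy r fin by (intro S.finsum_rdistr[symmetric]) auto
      finally show "bc \<alpha> (r \<odot>\<^bsub>lorentz S\<^esub> y) i = (r \<odot>\<^bsub>lorentz S\<^esub> bc \<alpha> y) i"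
        by (simp only: lorentz_smult_apply[OF i])
    qed (use r y cl in \<open>simp_all add: S.lorentz_smult_closed\<close>)
  qed
qed

lemma base_change_basis:
  assumes "lorentz_linear R \<alpha>" "k \<in> {1..6}"
  shows "bc \<alpha> (lorentz_basis S k) = lorentz_map h (\<alpha> (lorentz_basis R k))"
proof
  fix i
  have "finsum S (\<lambda>j. lorentz_basis S k j \<otimes>\<^bsub>S\<^esub> h (\<alpha> (lorentz_basis R j) i)) {1..6} = h (\<alpha> (lorentz_basis R k) i)"
    if i: "i \<in> {1..6}"
  proof -
    have c: "h (\<alpha> (lorentz_basis R j) i) \<in> carrier S" for j
      using lorentz_coord(1)[OF R.lorentz_linearD(1)[OF assms(1) R.lorentz_basis_closed] i] by simp
    have "finsum S (\<lambda>j. lorentz_basis S k j \<otimes>\<^bsub>S\<^esub> h (\<alpha> (lorentz_basis R j) i)) {1..6} =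
      finsum S (\<lambda>j. if k = j then h (\<alpha> (lorentz_basis R j) i) else \<zero>\<^bsub>S\<^esub>) {1..6}"
      using c by (intro S.finsum_cong') (auto simp: S.lorentz_basis_apply)
    also have "\<dots> = h (\<alpha> (lorentz_basis R k) i)"
      by (rule S.add.finprod_singleton) (use assms(2) c in auto)
    finally show ?thesis .
  qed
  then show "bc \<alpha> (lorentz_basis S k) i = lorentz_map h (\<alpha> (lorentz_basis R k)) i"
    using S.lorentz_basis_closed by (simp add: lorentz_base_change_def lorentz_map_def restrict_def)
qed

text \<open>Both sides are additive and semilinear along \<open>h\<close> in \<open>x\<close>, so
  the equation spreads from the basis vectors.\<close>

lemma base_change_map:
  assumes \<alpha>: "lorentz_linear R \<alpha>" and x: "x \<in> carrier (lorentz R)"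
  shows "bc \<alpha> (lorentz_map h x) = lorentz_map h (\<alpha> x)"
  using x
proof (rule R.lorentz_induct)
  show "bc \<alpha> (lorentz_map h (lorentz_basis R j)) = lorentz_map h (\<alpha> (lorentz_basis R j))" if "j \<in> {1..6}" for j
    using base_change_basis[OF \<alpha> that] by (simp add: lorentz_map_basis)
qed (simp_all add: S.lorentz_linearD[OF base_change_linear[OF \<alpha>]] R.lorentz_linearD[OF \<alpha>]
      lorentz_map_add lorentz_map_smult lorentz_map_closed)

text \<open>The bracket is bilinear over \<open>S\<close>, which reduces the claim to basis vectors.
  These are images of basis vectors over \<open>R\<close>, where \<alpha> preserves
  brackets.\<close>

lemma base_change_mult:
  assumes \<alpha>: "\<alpha> \<in> carrier (lie_aut R (lorentz R))"
    and y: "y \<in> carrier (lorentz S)" and z: "z \<in> carrier (lorentz S)"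
  shows "bc \<alpha> (y \<otimes>\<^bsub>lorentz S\<^esub> z) = bc \<alpha> y \<otimes>\<^bsub>lorentz S\<^esub> bc \<alpha> z"
proof -
  note lin = R.lie_aut_linear[OF \<alpha>]
  note S = S.lorentz_linearD[OF base_change_linear[OF lin]]
  have basis: "bc \<alpha> (lorentz_basis S j \<otimes>\<^bsub>lorentz S\<^esub> lorentz_basis S k) =
      bc \<alpha> (lorentz_basis S j) \<otimes>\<^bsub>lorentz S\<^esub> bc \<alpha> (lorentz_basis S k)" for j k
  proof -
    note b = R.lorentz_basis_closed[of j] R.lorentz_basis_closed[of k]
    have "bc \<alpha> (lorentz_map h (lorentz_basis R j \<otimes>\<^bsub>lorentz R\<^esub> lorentz_basis R k)) =
      lorentz_map h (\<alpha> (lorentz_basis R j) \<otimes>\<^bsub>lorentz R\<^esub> \<alpha> (lorentz_basis R k))"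
      using \<alpha> b by (simp add: base_change_map[OF lin] R.lorentz_mult_closed lie_aut_iff)
    then show ?thesis
      using b R.lorentz_linearD(1)[OF lin]
      by (simp add: lorentz_map_mult lorentz_map_basis flip: base_change_map[OF lin])
  qed
  have left: "bc \<alpha> (y \<otimes>\<^bsub>lorentz S\<^esub> lorentz_basis S k) = bc \<alpha> y \<otimes>\<^bsub>lorentz S\<^esub> bc \<alpha> (lorentz_basis S k)" for k
    using y
    by (rule S.lorentz_induct)
      (simp_all add: basis S S.lorentz_mult_add S.lorentz_mult_smult S.lorentz_basis_closed S.lorentz_mult_closed)
  show ?thesis
    using z
    by (rule S.lorentz_induct)
      (simp_all add: left S S.lorentz_mult_add S.lorentz_mult_smult y S.lorentz_basis_closed S.lorentz_mult_closed)
qed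

lemma base_change_compose:
  assumes "lorentz_linear R \<alpha>" "lorentz_linear R \<beta>" "y \<in> carrier (lorentz S)"
  shows "bc (compose (carrier (lorentz R)) \<alpha> \<beta>) y = bc \<alpha> (bc \<beta> y)"
proof -
  have ab: "lorentz_linear R (compose (carrier (lorentz R)) \<alpha> \<beta>)"
    using R.lorentz_linear_comp[OF assms(1,2)]
    by (auto simp: lorentz_linear_def compose_def R.lorentz_add_closed R.lorentz_smult_closed)
  have "bc (compose (carrier (lorentz R)) \<alpha> \<beta>) (lorentz_basis S j) = bc \<alpha> (bc \<beta> (lorentz_basis S j))"
    if "j \<in> {1..6}" for j
    unfolding base_change_basis[OF ab that] base_change_basis[OF assms(2) that]
      base_change_map[OF assms(1) R.lorentz_linearD(1)[OF assms(2) R.lorentz_basis_closed]]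
    by (simp add: compose_def R.lorentz_basis_closed)
  then show ?thesis
    by (rule S.lorentz_linear_eqI[OF base_change_linear[OF ab] S.lorentz_linear_comp[OF
          base_change_linear[OF assms(1)] base_change_linear[OF assms(2)]] assms(3)])
qed

lemma base_change_one:
  assumes "y \<in> carrier (lorentz S)"
  shows "bc (\<lambda>x\<in>carrier (lorentz R). x) y = y"
proof (rule S.lorentz_linear_eqI[of _ "\<lambda>y. y", OF _ _ assms])
  have id: "lorentz_linear R (\<lambda>x\<in>carrier (lorentz R). x)"
    by (auto simp: lorentz_linear_def R.lorentz_add_closed R.lorentz_smult_closed)
  show "lorentz_linear S (bc (\<lambda>x\<in>carrier (lorentz R). x))" by (rule base_change_linear[OF id])
  show "lorentz_linear S (\<lambda>y. y)" by (simp add: lorentz_linear_def)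
  show "bc (\<lambda>x\<in>carrier (lorentz R). x) (lorentz_basis S j) = lorentz_basis S j" if "j \<in> {1..6}" for j
    unfolding base_change_basis[OF id that] by (simp add: R.lorentz_basis_closed lorentz_map_basis)
qed

text \<open>Bijectivity is a consequence of functoriality: the base change of the inverse
  automorphism is a two-sided inverse.\<close>

lemma base_change_lie_aut:
  assumes \<alpha>: "\<alpha> \<in> carrier (lie_aut R (lorentz R))"
  shows "bc \<alpha> \<in> carrier (lie_aut S (lorentz S))"
proof -
  interpret G: group "lie_aut R (lorentz R)"
    by (rule lie_aut_group) (simp_all add: R.lorentz_add_closed R.lorentz_smult_closed R.lorentz_mult_closed)
  define \<beta> where "\<beta> = inv\<^bsub>lie_aut R (lorentz R)\<^esub> \<alpha>"
  have \<beta>: "\<beta> \<in> carrier (lie_aut R (lorentz R))" using \<alpha> by (simp add: \<beta>_def)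
  have "\<alpha> \<otimes>\<^bsub>lie_aut R (lorentz R)\<^esub> \<beta> = \<one>\<^bsub>lie_aut R (lorentz R)\<^esub>"
    "\<beta> \<otimes>\<^bsub>lie_aut R (lorentz R)\<^esub> \<alpha> = \<one>\<^bsub>lie_aut R (lorentz R)\<^esub>"
    using \<alpha> by (simp_all add: \<beta>_def)
  then have ab: "compose (carrier (lorentz R)) \<alpha> \<beta> = (\<lambda>x\<in>carrier (lorentz R). x)"
    "compose (carrier (lorentz R)) \<beta> \<alpha> = (\<lambda>x\<in>carrier (lorentz R). x)"
    unfolding lie_aut_mult[OF \<alpha> \<beta>] lie_aut_mult[OF \<beta> \<alpha>] lie_aut_one by auto
  note lin = R.lie_aut_linear[OF \<alpha>] R.lie_aut_linear[OF \<beta>]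
  note S = S.lorentz_linearD[OF base_change_linear[OF lin(1)]] S.lorentz_linearD[OF base_change_linear[OF lin(2)]]
  have "bij_betw (bc \<alpha>) (carrier (lorentz S)) (carrier (lorentz S))"
    by (rule bij_betw_byWitness[where f' = "bc \<beta>"])
      (use S(1,4) in \<open>auto simp: base_change_one ab
        simp flip: base_change_compose[OF lin(1,2)] base_change_compose[OF lin(2,1)]\<close>)
  moreover have "bc \<alpha> \<in> extensional (carrier (lorentz S))" by (simp add: lorentz_base_change_def)
  ultimately show ?thesis unfolding lie_aut_iff using S(2,3) base_change_mult[OF \<alpha>] by blast
qed

lemma base_change_hom: "bc \<in> hom (lie_aut R (lorentz R)) (lie_aut S (lorentz S))"
proof (rule homI)
  show *: "bc \<alpha> \<in> carrier (lie_aut S (lorentz S))" if "\<alpha> \<in> carrier (lie_aut R (lorentz R))" for \<alpha>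
    by (rule base_change_lie_aut[OF that])
  fix \<alpha> \<beta> assume ab: "\<alpha> \<in> carrier (lie_aut R (lorentz R))" "\<beta> \<in> carrier (lie_aut R (lorentz R))"
  show "bc (\<alpha> \<otimes>\<^bsub>lie_aut R (lorentz R)\<^esub> \<beta>) = bc \<alpha> \<otimes>\<^bsub>lie_aut S (lorentz S)\<^esub> bc \<beta>"
    unfolding lie_aut_mult[OF ab] lie_aut_mult[OF *[OF ab(1)] *[OF ab(2)]]
  proof (rule extensionalityI)
    show "bc (compose (carrier (lorentz R)) \<alpha> \<beta>) \<in> extensional (carrier (lorentz S))"
      by (simp add: lorentz_base_change_def)
    show "bc (compose (carrier (lorentz R)) \<alpha> \<beta>) y = compose (carrier (lorentz S)) (bc \<alpha>) (bc \<beta>) y"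
      if "y \<in> carrier (lorentz S)" for y
      unfolding base_change_compose[OF ab[THEN R.lie_aut_linear] that] using that by (simp add: compose_def)
  qed simp
qed

end

lemma base_change_trans:
  assumes "ring_hom_cring R S h" "ring_hom_cring S T k" "lorentz_linear R \<alpha>" "y \<in> carrier (lorentz T)"
  shows "lorentz_base_change R T (\<lambda>r. k (h r)) \<alpha> y =
    lorentz_base_change S T k (lorentz_base_change R S h \<alpha>) y"
proof -
  interpret h: ring_hom_cring R S h by fact
  interpret k: ring_hom_cring S T k by fact
  have "(\<lambda>r. k (h r)) \<in> ring_hom R T" by (rule ring_hom_memI) simp_all
  then interpret kh: ring_hom_cring R T "\<lambda>r. k (h r)" by unfold_locales
  note lin = h.base_change_linear[OF assms(3)]
  show ?thesis
  proof (rule k.S.lorentz_linear_eqI[OF kh.base_change_linear[OF assms(3)] k.base_change_linear[OF lin] assms(4)])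
    fix j :: nat assume j: "j \<in> {1..6}"
    show "lorentz_base_change R T (\<lambda>r. k (h r)) \<alpha> (lorentz_basis T j) =
      lorentz_base_change S T k (lorentz_base_change R S h \<alpha>) (lorentz_basis T j)"
      unfolding kh.base_change_basis[OF assms(3) j] k.base_change_basis[OF lin j] h.base_change_basis[OF assms(3) j]
      by (auto simp: lorentz_map_def)
  qed
qed

lemma (in cring) base_change_id:
  assumes "\<alpha> \<in> carrier (lie_aut R (lorentz R))"
  shows "lorentz_base_change R R (\<lambda>r. r) \<alpha> = \<alpha>"
proof (rule extensionalityI)
  have "(\<lambda>r. r) \<in> ring_hom R R" by (rule ring_hom_memI) simp_all
  then interpret h: ring_hom_cring R R "\<lambda>r. r" by unfold_locales
  note lin = lie_aut_linear[OF assms]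
  show "lorentz_base_change R R (\<lambda>r. r) \<alpha> \<in> extensional (carrier (lorentz R))"
    by (simp add: lorentz_base_change_def)
  show "\<alpha> \<in> extensional (carrier (lorentz R))" using assms by (simp add: lie_aut_iff)
  have id: "lorentz_map (\<lambda>r. r) x = x" if "x \<in> carrier (lorentz R)" for x
    by (rule lorentz_extI[OF h.lorentz_map_closed[OF that] that]) simp
  fix x assume x: "x \<in> carrier (lorentz R)"
  then show "lorentz_base_change R R (\<lambda>r. r) \<alpha> x = \<alpha> x"
    using h.base_change_map[OF lin x] lorentz_linearD(1)[OF lin x] by (simp add: id)
qed

section \<open>Naturality of the point and of the sign\<close>

context
  fixes R :: "('r, 'm) ring_scheme" and S :: "('s, 'n) ring_scheme" and h \<alpha>
  assumes R: "half_cring R" and S: "half_cring S" and h: "ring_hom_cring R S h"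
    and \<alpha>: "\<alpha> \<in> carrier (lie_aut R (lorentz R))"
begin

interpretation R: half_cring R by (fact R)
interpretation S: half_cring S by (fact S)
interpretation h: ring_hom_cring R S h by (fact h)
interpretation B: ring_hom_cring "bar R" "bar S" "map_prod h h" by (rule h.bar_hom)

lemma lor_conj_base_change:
  assumes "V \<in> sl2 (bar R)"
  shows "half_cring.lor_conj S (lorentz_base_change R S h \<alpha>) (map_mat2 (map_prod h h) V) =
    map_mat2 (map_prod h h) (half_cring.lor_conj R \<alpha> V)"
  using assms
proof (rule R.sl2_lor_cases)
  fix x assume x: "x \<in> carrier (lorentz R)" "V = lor_mat R x"
  show ?thesis
    unfolding x(2) h.lor_mat_map[OF x(1)] R.lor_conj_mat[OF x(1)]
      S.lor_conj_mat[OF h.lorentz_map_closed[OF x(1)]] h.lor_mat_map[OF R.lie_autD(3)[OF \<alpha> x(1)]]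
      h.base_change_map[OF R.lie_aut_linear[OF \<alpha>] x(1)] ..
qed

text \<open>The element i H over \<open>S\<close> is the image of i H over \<open>R\<close>, so the
  base-changed map multiplies it by the image of the old sign; \<open>bar_semi_unique\<close>
  concludes.\<close>

lemma lor_sign_base_change:
  "half_cring.lor_sign S (lorentz_base_change R S h \<alpha>) = h (half_cring.lor_sign R \<alpha>)"
proof (rule S.bar_semi_unique[symmetric])
  note s = S.lor_sign[OF h.base_change_lie_aut[OF \<alpha>]]
  note r = R.lor_sign[OF \<alpha>]
  show "S.lor_sign (lorentz_base_change R S h \<alpha>) \<in> carrier (mu2 S)" by (rule s)
  show "sl2_semi (bar S) (bar_aut S (S.lor_sign (lorentz_base_change R S h \<alpha>)))
     (S.lor_conj (lorentz_base_change R S h \<alpha>))" by (rule s)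
  have b: "R.lor_sign \<alpha> \<in> carrier R" using r by (simp add: R.mu2_iff)
  then show "h (R.lor_sign \<alpha>) \<in> carrier S" by simp
  have i: "(\<zero>\<^bsub>R\<^esub>, \<one>\<^bsub>R\<^esub>) \<in> carrier (bar R)" by simp
  have H: "matH (bar R) \<in> sl2 (bar R)" "R.lor_conj \<alpha> (matH (bar R)) \<in> carrier (Mat2 (bar R))"
    using B.R.sl2_carrier[OF sl2_semiD(2)[OF r(2)]] by auto
  have "S.lor_conj (lorentz_base_change R S h \<alpha>) ((\<zero>\<^bsub>S\<^esub>, \<one>\<^bsub>S\<^esub>) \<boxdot>\<^bsub>bar S\<^esub> matH (bar S)) =
    S.lor_conj (lorentz_base_change R S h \<alpha>) (map_mat2 (map_prod h h) ((\<zero>\<^bsub>R\<^esub>, \<one>\<^bsub>R\<^esub>) \<boxdot>\<^bsub>bar R\<^esub> matH (bar R)))"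
    using H i B.R.sl2_carrier[OF H(1)] by (simp only: B.map_mat2_smult B.map_mat2_EFH map_prod_simp h.hom_zero h.hom_one)
  also have "\<dots> = map_mat2 (map_prod h h) (R.lor_conj \<alpha> ((\<zero>\<^bsub>R\<^esub>, \<one>\<^bsub>R\<^esub>) \<boxdot>\<^bsub>bar R\<^esub> matH (bar R)))"
    by (rule lor_conj_base_change) (use H i in auto)
  also have "\<dots> = map_mat2 (map_prod h h) ((\<zero>\<^bsub>R\<^esub>, R.lor_sign \<alpha>) \<boxdot>\<^bsub>bar R\<^esub> R.lor_conj \<alpha> (matH (bar R)))"
    using sl2_semiD(5)[OF r(2) i H(1)] b by simp
  also have "\<dots> = (\<zero>\<^bsub>S\<^esub>, h (R.lor_sign \<alpha>)) \<boxdot>\<^bsub>bar S\<^esub> map_mat2 (map_prod h h) (R.lor_conj \<alpha> (matH (bar R)))"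
    using b H by (subst B.map_mat2_smult) auto
  also have "\<dots> = (\<zero>\<^bsub>S\<^esub>, h (R.lor_sign \<alpha>)) \<boxdot>\<^bsub>bar S\<^esub> S.lor_conj (lorentz_base_change R S h \<alpha>) (matH (bar S))"
    using lor_conj_base_change[OF H(1)] by (simp only: B.map_mat2_EFH)
  finally show "S.lor_conj (lorentz_base_change R S h \<alpha>) ((\<zero>\<^bsub>S\<^esub>, \<one>\<^bsub>S\<^esub>) \<boxdot>\<^bsub>bar S\<^esub> matH (bar S)) =
    (\<zero>\<^bsub>S\<^esub>, h (R.lor_sign \<alpha>)) \<boxdot>\<^bsub>bar S\<^esub> S.lor_conj (lorentz_base_change R S h \<alpha>) (matH (bar S))" .
qed

lemma lor_pgl_base_change:
  "half_cring.lor_pgl S (lorentz_base_change R S h \<alpha>) =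
   span2 (bar S) (map_mat2 (map_prod h h) ` half_cring.lor_pgl R \<alpha>)"
proof -
  note s = S.lor_sign[OF h.base_change_lie_aut[OF \<alpha>]]
  note r = R.lor_sign[OF \<alpha>]
  have b: "R.lor_sign \<alpha> \<in> carrier R" using r by (simp add: R.mu2_iff)
  show ?thesis
    unfolding S.lor_pgl_def R.lor_pgl_def
  proof (rule intertwiners_base_change[OF h.bar_hom R.bar_half_cring_invol[OF r(1)]
        S.bar_half_cring_invol[OF s(1)] _ r(2) s(2) lor_conj_base_change])
    show "map_prod h h (bar_aut R (R.lor_sign \<alpha>) x) =
      bar_aut S (S.lor_sign (lorentz_base_change R S h \<alpha>)) (map_prod h h x)" if "x \<in> carrier (bar R)" for x
      using that b by (auto elim!: R.bar_cases simp: lor_sign_base_change)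
  qed
qed

end


section \<open>The isomorphism of functors\<close>

lemma is_grp_functorD:
  assumes "is_grp_functor \<Phi> F"
  shows "algebra \<Phi> R \<Longrightarrow> group (obj F R)"
    "algebra \<Phi> R \<Longrightarrow> algebra \<Phi> R' \<Longrightarrow> \<phi> \<in> alg_hom \<Phi> R R' \<Longrightarrow>
      mor F R R' \<phi> \<in> hom (obj F R) (obj F R')"
    "algebra \<Phi> R \<Longrightarrow> x \<in> carrier (obj F R) \<Longrightarrow> mor F R R (\<lambda>r. r) x = x"
    "algebra \<Phi> R \<Longrightarrow> algebra \<Phi> R' \<Longrightarrow> algebra \<Phi> R'' \<Longrightarrow> \<phi> \<in> alg_hom \<Phi> R R' \<Longrightarrow>
      \<psi> \<in> alg_hom \<Phi> R' R'' \<Longrightarrow> x \<in> carrier (obj F R) \<Longrightarrow>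
      mor F R R'' (\<lambda>r. \<psi> (\<phi> r)) x = mor F R' R'' \<psi> (mor F R R' \<phi> x)"
  using assms unfolding is_grp_functor_def by blast+

lemma alg_hom_id: "(\<lambda>r. r) \<in> alg_hom \<Phi> R R"
  by (auto simp: alg_hom_def ring_hom_def)

lemma alg_hom_comp:
  "\<phi> \<in> alg_hom \<Phi> R R' \<Longrightarrow> \<psi> \<in> alg_hom \<Phi> R' R'' \<Longrightarrow> (\<lambda>r. \<psi> (\<phi> r)) \<in> alg_hom \<Phi> R R''"
  by (auto simp: alg_hom_def ring_hom_def Pi_iff)

text \<open>Every element of \<open>obj G R\<close> is a value of \<eta>, so each law of
  \<open>G\<close> is read off from the law of \<open>F\<close>. In this way the functor laws of
  \<open>PGL2_bar_Z2\<close> need no computation with spans.\<close>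

lemma grp_functors_isomorphicI:
  assumes F: "is_grp_functor \<Phi> F"
    and iso: "\<And>R. algebra \<Phi> R \<Longrightarrow> \<eta> R \<in> iso (obj F R) (obj G R)"
    and one: "\<And>R. algebra \<Phi> R \<Longrightarrow> \<eta> R \<one>\<^bsub>obj F R\<^esub> = \<one>\<^bsub>obj G R\<^esub>"
    and nat: "\<And>R R' \<phi> x. algebra \<Phi> R \<Longrightarrow> algebra \<Phi> R' \<Longrightarrow> \<phi> \<in> alg_hom \<Phi> R R' \<Longrightarrow>
      x \<in> carrier (obj F R) \<Longrightarrow> \<eta> R' (mor F R R' \<phi> x) = mor G R R' \<phi> (\<eta> R x)"
  shows "grp_functors_isomorphic \<Phi> F G"
proof -
  note F = is_grp_functorD[OF F]
  have grp: "group (obj G R)" if R: "algebra \<Phi> R" for R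
    by (rule iso_imp_group[OF F(1)[OF R] iso[OF R] one[OF R]])
  have closed: "\<eta> R x \<in> carrier (obj G R)" if "algebra \<Phi> R" "x \<in> carrier (obj F R)" for R x
    using iso[OF that(1)] that(2) by (auto simp: iso_def dest: bij_betwE)
  have ex: "\<exists>y\<in>carrier (obj F R). x = \<eta> R y" if "algebra \<Phi> R" "x \<in> carrier (obj G R)" for R x
    using iso[OF that(1)] that(2) by (auto simp: iso_def bij_betw_def)
  have mult: "\<eta> R (x \<otimes>\<^bsub>obj F R\<^esub> y) = \<eta> R x \<otimes>\<^bsub>obj G R\<^esub> \<eta> R y"
    if "algebra \<Phi> R" "x \<in> carrier (obj F R)" "y \<in> carrier (obj F R)" for R x y
    using iso[OF that(1)] that by (auto simp: iso_def hom_def)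
  have hom: "mor G R R' \<phi> \<in> hom (obj G R) (obj G R')"
    if R: "algebra \<Phi> R" "algebra \<Phi> R'" "\<phi> \<in> alg_hom \<Phi> R R'" for R R' \<phi>
  proof (rule homI)
    note h = hom_in_carrier[OF F(2)[OF R]] hom_mult[OF F(2)[OF R]]
    fix x assume "x \<in> carrier (obj G R)"
    then obtain a where a: "a \<in> carrier (obj F R)" "x = \<eta> R a" using ex[OF R(1)] by blast
    show "mor G R R' \<phi> x \<in> carrier (obj G R')"
      unfolding a(2) nat[OF R a(1), symmetric] by (rule closed[OF R(2) h(1)[OF a(1)]])
    fix y assume "y \<in> carrier (obj G R)"
    then obtain b where b: "b \<in> carrier (obj F R)" "y = \<eta> R b" using ex[OF R(1)] by blast
    have ab: "a \<otimes>\<^bsub>obj F R\<^esub> b \<in> carrier (obj F R)"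
      using a(1) b(1) group.is_monoid[OF F(1)[OF R(1)]] by (simp add: monoid.m_closed)
    show "mor G R R' \<phi> (x \<otimes>\<^bsub>obj G R\<^esub> y) = mor G R R' \<phi> x \<otimes>\<^bsub>obj G R'\<^esub> mor G R R' \<phi> y"
      unfolding a(2) b(2) mult[OF R(1) a(1) b(1), symmetric] nat[OF R a(1), symmetric]
        nat[OF R b(1), symmetric] nat[OF R ab, symmetric] h(2)[OF a(1) b(1)]
      by (rule mult[OF R(2) h(1)[OF a(1)] h(1)[OF b(1)]])
  qed
  have id: "mor G R R (\<lambda>r. r) x = x" if R: "algebra \<Phi> R" and x: "x \<in> carrier (obj G R)" for R x
  proof -
    obtain a where a: "a \<in> carrier (obj F R)" "x = \<eta> R a" using ex[OF R x] by blast
    show ?thesis unfolding a(2) nat[OF R R alg_hom_id a(1), symmetric] F(3)[OF R a(1)] ..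
  qed
  have comp: "mor G R R'' (\<lambda>r. \<psi> (\<phi> r)) x = mor G R' R'' \<psi> (mor G R R' \<phi> x)"
    if R: "algebra \<Phi> R" "algebra \<Phi> R'" "algebra \<Phi> R''"
      and h: "\<phi> \<in> alg_hom \<Phi> R R'" "\<psi> \<in> alg_hom \<Phi> R' R''" and x: "x \<in> carrier (obj G R)"
    for R R' R'' \<phi> \<psi> x
  proof -
    obtain a where a: "a \<in> carrier (obj F R)" "x = \<eta> R a" using ex[OF R(1) x] by blast
    show ?thesis
      unfolding a(2) nat[OF R(1,2) h(1) a(1), symmetric] nat[OF R(1,3) alg_hom_comp[OF h] a(1), symmetric]
        nat[OF R(2,3) h(2) hom_in_carrier[OF F(2)[OF R(1,2) h(1)] a(1)], symmetric] F(4)[OF R h a(1)] ..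
  qed
  have "is_grp_functor \<Phi> G"
    unfolding is_grp_functor_def using grp hom id comp by blast
  then show ?thesis
    unfolding grp_functors_isomorphic_def using assms(1) iso nat by blast
qed

text \<open>The hypothesis \<open>act\<close> concerns the whole product and not the action alone,
  because closure of \<open>N\<close> under the action is not presupposed.\<close>

lemma semidirect_isoI:
  assumes f: "f \<in> iso N N'" and g: "g \<in> iso H H'"
    and act: "\<And>n h n'. n \<in> carrier N \<Longrightarrow> h \<in> carrier H \<Longrightarrow> n' \<in> carrier N \<Longrightarrow>
      f (n \<otimes>\<^bsub>N\<^esub> act h n') = f n \<otimes>\<^bsub>N'\<^esub> act' (g h) (f n')"
  shows "map_prod f g \<in> iso (semidirect N H act) (semidirect N' H' act')"
proof (rule isoI)
  show "map_prod f g \<in> hom (semidirect N H act) (semidirect N' H' act')"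
    by (rule homI) (use f g act in \<open>auto simp: semidirect_def iso_def hom_def Pi_iff\<close>)
  show "bij_betw (map_prod f g) (carrier (semidirect N H act)) (carrier (semidirect N' H' act'))"
    using bij_betw_map_prod[of f "carrier N" "carrier N'" g "carrier H" "carrier H'"] f g
    by (simp add: semidirect_def iso_def)
qed

section \<open>Complementary idempotents from square roots of 1\<close>

context half_cring
begin

definition pos_part where "pos_part b = half \<otimes> (\<one> \<oplus> b)"
definition neg_part where "neg_part b = half \<otimes> (\<one> \<ominus> b)"

lemma parts_closed [simp]:
  "b \<in> carrier R \<Longrightarrow> pos_part b \<in> carrier R" "b \<in> carrier R \<Longrightarrow> neg_part b \<in> carrier R"
  by (simp_all add: pos_part_def neg_part_def)

lemma parts_sum: "b \<in> carrier R \<Longrightarrow> pos_part b \<oplus> neg_part b = \<one>"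
proof -
  assume b: "b \<in> carrier R"
  have "pos_part b \<oplus> neg_part b = half \<otimes> (\<one> \<oplus> \<one>)"
    unfolding pos_part_def neg_part_def using b half_closed by algebra
  then show ?thesis using half_double[of \<one>] by simp
qed

lemma parts_diff: "b \<in> carrier R \<Longrightarrow> pos_part b \<ominus> neg_part b = b"
proof -
  assume b: "b \<in> carrier R"
  have "pos_part b \<ominus> neg_part b = half \<otimes> (b \<oplus> b)"
    unfolding pos_part_def neg_part_def using b half_closed by algebra
  then show ?thesis using half_double[OF b] by simp
qed

text \<open>These formulas match the comultiplication behind \<open>Z2_points\<close> with
  multiplication of signs. Each product contains \<open>half\<close> twice, and one copy cancels
  against a doubling.\<close>

lemma parts_mult:
  assumes "b \<in> carrier R" "c \<in> carrier R"
  shows "(pos_part b \<otimes> pos_part c) \<oplus> (neg_part b \<otimes> neg_part c) = pos_part (b \<otimes> c)"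
    and "(pos_part b \<otimes> neg_part c) \<oplus> (neg_part b \<otimes> pos_part c) = neg_part (b \<otimes> c)"
proof -
  have *: "half \<otimes> (x \<oplus> x) = x" if "x \<in> carrier R" for x using half_double that .
  have "(pos_part b \<otimes> pos_part c) \<oplus> (neg_part b \<otimes> neg_part c) =
    half \<otimes> (half \<otimes> ((\<one> \<oplus> b \<otimes> c) \<oplus> (\<one> \<oplus> b \<otimes> c)))"
    unfolding pos_part_def neg_part_def using assms half_closed by algebra
  then show "(pos_part b \<otimes> pos_part c) \<oplus> (neg_part b \<otimes> neg_part c) = pos_part (b \<otimes> c)"
    using assms by (simp add: * pos_part_def)
  have "(pos_part b \<otimes> neg_part c) \<oplus> (neg_part b \<otimes> pos_part c) =
    half \<otimes> (half \<otimes> ((\<one> \<ominus> b \<otimes> c) \<oplus> (\<one> \<ominus> b \<otimes> c)))"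
    unfolding pos_part_def neg_part_def using assms half_closed by algebra
  then show "(pos_part b \<otimes> neg_part c) \<oplus> (neg_part b \<otimes> pos_part c) = neg_part (b \<otimes> c)"
    using assms by (simp add: * neg_part_def)
qed

lemma parts_one: "pos_part \<one> = \<one>" "neg_part \<one> = \<zero>"
  using half_double[of \<one>] by (simp_all add: pos_part_def neg_part_def a_minus_def r_neg)

lemma parts_idem:
  assumes "b \<in> carrier (mu2 R)"
  shows "pos_part b \<otimes> neg_part b = \<zero>" "neg_part b \<otimes> pos_part b = \<zero>"
    "pos_part b \<otimes> pos_part b = pos_part b" "neg_part b \<otimes> neg_part b = neg_part b"
proof -
  have b: "b \<in> carrier R" "b \<otimes> b = \<one>" using assms by (auto simp: mu2_iff)
  \<comment> \<open>The negative part of b b = 1 vanishes, and it equals twice the mixed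
    product.\<close>
  have "(pos_part b \<otimes> neg_part b) \<oplus> (pos_part b \<otimes> neg_part b) = \<zero>"
    using parts_mult(2)[OF b(1,1)] b by (simp add: parts_one m_comm)
  then show 0: "pos_part b \<otimes> neg_part b = \<zero>" using b by (simp add: double_zero)
  then show 1: "neg_part b \<otimes> pos_part b = \<zero>" using b by (simp add: m_comm)
  have "pos_part b \<otimes> (pos_part b \<oplus> neg_part b) = pos_part b" using b by (simp add: parts_sum)
  then show "pos_part b \<otimes> pos_part b = pos_part b" using b 0 by (simp add: r_distr)
  have "neg_part b \<otimes> (pos_part b \<oplus> neg_part b) = neg_part b" using b by (simp add: parts_sum)
  then show "neg_part b \<otimes> neg_part b = neg_part b" using b 1 by (simp add: r_distr)
qed

end

text \<open>The linear map taking the idempotents (1,0) and (0,1) to (1 + b)/2 and (1 - b)/2; it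
  inverts \<open>Z2_sign\<close>.\<close>

definition Z2_of :: "('k, 'm) ring_scheme \<Rightarrow> ('k, 'r) module \<Rightarrow> 'r \<Rightarrow> 'k \<times> 'k \<Rightarrow> 'r" where
  "Z2_of \<Phi> R b = (\<lambda>z\<in>carrier (Z2_alg \<Phi>).
     (fst z \<odot>\<^bsub>R\<^esub> half_cring.pos_part R b) \<oplus>\<^bsub>R\<^esub> (snd z \<odot>\<^bsub>R\<^esub> half_cring.neg_part R b))"

lemma (in cring) unit_of_inverse:
  "x \<in> carrier R \<Longrightarrow> y \<in> carrier R \<Longrightarrow> x \<otimes> y = \<one> \<Longrightarrow> y \<in> Units R"
  unfolding Units_def using m_comm by auto

text \<open>The inverse of 2 in \<Phi> is carried to \<open>R\<close> by the scalar action on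
  1.\<close>

lemma algebra_half_cring:
  assumes "field \<Phi>" "\<one>\<^bsub>\<Phi>\<^esub> \<oplus>\<^bsub>\<Phi>\<^esub> \<one>\<^bsub>\<Phi>\<^esub> \<noteq> \<zero>\<^bsub>\<Phi>\<^esub>" "algebra \<Phi> R"
  shows "half_cring R"
proof -
  interpret K: field \<Phi> by fact
  interpret A: algebra \<Phi> R by fact
  define t where "t = inv\<^bsub>\<Phi>\<^esub> (\<one>\<^bsub>\<Phi>\<^esub> \<oplus>\<^bsub>\<Phi>\<^esub> \<one>\<^bsub>\<Phi>\<^esub>)"
  have u: "\<one>\<^bsub>\<Phi>\<^esub> \<oplus>\<^bsub>\<Phi>\<^esub> \<one>\<^bsub>\<Phi>\<^esub> \<in> Units \<Phi>" using assms(2) by (simp add: K.field_Units)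
  then have t: "t \<in> carrier \<Phi>" "t \<otimes>\<^bsub>\<Phi>\<^esub> (\<one>\<^bsub>\<Phi>\<^esub> \<oplus>\<^bsub>\<Phi>\<^esub> \<one>\<^bsub>\<Phi>\<^esub>) = \<one>\<^bsub>\<Phi>\<^esub>" by (auto simp: t_def)
  have "(t \<odot>\<^bsub>R\<^esub> \<one>\<^bsub>R\<^esub>) \<otimes>\<^bsub>R\<^esub> (\<one>\<^bsub>R\<^esub> \<oplus>\<^bsub>R\<^esub> \<one>\<^bsub>R\<^esub>) = (t \<otimes>\<^bsub>\<Phi>\<^esub> (\<one>\<^bsub>\<Phi>\<^esub> \<oplus>\<^bsub>\<Phi>\<^esub> \<one>\<^bsub>\<Phi>\<^esub>)) \<odot>\<^bsub>R\<^esub> \<one>\<^bsub>R\<^esub>"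
    using t(1) by (simp add: A.smult_assoc2 A.smult_r_distr A.smult_l_distr K.r_distr)
  then have "(t \<odot>\<^bsub>R\<^esub> \<one>\<^bsub>R\<^esub>) \<otimes>\<^bsub>R\<^esub> (\<one>\<^bsub>R\<^esub> \<oplus>\<^bsub>R\<^esub> \<one>\<^bsub>R\<^esub>) = \<one>\<^bsub>R\<^esub>" using t by simp
  then have "\<one>\<^bsub>R\<^esub> \<oplus>\<^bsub>R\<^esub> \<one>\<^bsub>R\<^esub> \<in> Units R"
    using t(1) by (intro cring.unit_of_inverse[OF A.M_cring, of "t \<odot>\<^bsub>R\<^esub> \<one>\<^bsub>R\<^esub>"]) auto
  then show ?thesis by (intro half_cring.intro A.M_cring half_cring_axioms.intro)
qed

lemma alg_hom_ring_hom_cring: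
  assumes "algebra \<Phi> R" "algebra \<Phi> R'" "\<phi> \<in> alg_hom \<Phi> R R'"
  shows "ring_hom_cring R R' \<phi>"
  using assms(3) algebra.M_cring[OF assms(1)] algebra.M_cring[OF assms(2)]
  by (intro ring_hom_cring.intro ring_hom_cring_axioms.intro) (auto simp: alg_hom_def)

section \<open>Points of the constant group scheme of order two\<close>

context
  fixes \<Phi> :: "('k, 'm) ring_scheme" and R :: "('k, 'r) module"
  assumes K: "cring \<Phi>" and A: "algebra \<Phi> R" and H: "half_cring R"
begin

interpretation K: cring \<Phi> by (fact K)
interpretation H: half_cring R by (fact H)
interpretation A: algebra \<Phi> R by (fact A)

lemma smult_mult_smult:
  assumes "a \<in> carrier \<Phi>" "b \<in> carrier \<Phi>" "x \<in> carrier R" "y \<in> carrier R"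
  shows "(a \<odot>\<^bsub>R\<^esub> x) \<otimes>\<^bsub>R\<^esub> (b \<odot>\<^bsub>R\<^esub> y) = (a \<otimes>\<^bsub>\<Phi>\<^esub> b) \<odot>\<^bsub>R\<^esub> (x \<otimes>\<^bsub>R\<^esub> y)"
  using assms A.smult_assoc2[of a x "b \<odot>\<^bsub>R\<^esub> y"] A.smult_assoc2[of b y x]
  by (simp add: A.smult_assoc1 H.m_comm[of x])

lemma Z2_alg_carrier: "z \<in> carrier (Z2_alg \<Phi>) \<longleftrightarrow> fst z \<in> carrier \<Phi> \<and> snd z \<in> carrier \<Phi>"
  by (cases z) (simp add: Z2_alg_def)

lemma Z2_of_apply:
  "x \<in> carrier \<Phi> \<Longrightarrow> y \<in> carrier \<Phi> \<Longrightarrow>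
   Z2_of \<Phi> R b (x, y) = (x \<odot>\<^bsub>R\<^esub> H.pos_part b) \<oplus>\<^bsub>R\<^esub> (y \<odot>\<^bsub>R\<^esub> H.neg_part b)"
  by (simp add: Z2_of_def Z2_alg_carrier)

lemma Z2_of_idem:
  assumes "b \<in> carrier R"
  shows "Z2_of \<Phi> R b (\<one>\<^bsub>\<Phi>\<^esub>, \<zero>\<^bsub>\<Phi>\<^esub>) = H.pos_part b" "Z2_of \<Phi> R b (\<zero>\<^bsub>\<Phi>\<^esub>, \<one>\<^bsub>\<Phi>\<^esub>) = H.neg_part b"
  using assms by (simp_all add: Z2_of_apply)

lemma Z2_sign_of: "b \<in> carrier R \<Longrightarrow> Z2_sign \<Phi> R (Z2_of \<Phi> R b) = b"
  by (simp add: Z2_sign_def Z2_of_idem H.parts_diff)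

lemma Z2_of_closed:
  assumes b: "b \<in> carrier (mu2 R)"
  shows "Z2_of \<Phi> R b \<in> carrier (Z2_points \<Phi> R)"
proof -
  have bc: "b \<in> carrier R" using b by (simp add: H.mu2_iff)
  note pc = H.parts_closed[OF bc]
  have "Z2_of \<Phi> R b \<in> ring_hom (Z2_alg \<Phi>) R"
  proof (rule ring_hom_memI)
    fix z assume z: "z \<in> carrier (Z2_alg \<Phi>)"
    then obtain x y where z: "z = (x, y)" "x \<in> carrier \<Phi>" "y \<in> carrier \<Phi>"
      by (cases z) (auto simp: Z2_alg_carrier)
    show "Z2_of \<Phi> R b z \<in> carrier R" unfolding z(1) using z pc by (simp add: Z2_of_apply)
    fix w assume w: "w \<in> carrier (Z2_alg \<Phi>)"
    then obtain u v where w: "w = (u, v)" "u \<in> carrier \<Phi>" "v \<in> carrier \<Phi>"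
      by (cases w) (auto simp: Z2_alg_carrier)
    have "Z2_of \<Phi> R b z \<otimes>\<^bsub>R\<^esub> Z2_of \<Phi> R b w =
      ((x \<otimes>\<^bsub>\<Phi>\<^esub> u) \<odot>\<^bsub>R\<^esub> H.pos_part b) \<oplus>\<^bsub>R\<^esub> ((y \<otimes>\<^bsub>\<Phi>\<^esub> v) \<odot>\<^bsub>R\<^esub> H.neg_part b)"
      unfolding z(1) w(1) using z(2,3) w(2,3) pc
      by (simp add: Z2_of_apply H.l_distr H.r_distr smult_mult_smult H.parts_idem[OF b])
    then show "Z2_of \<Phi> R b (z \<otimes>\<^bsub>Z2_alg \<Phi>\<^esub> w) = Z2_of \<Phi> R b z \<otimes>\<^bsub>R\<^esub> Z2_of \<Phi> R b w"
      using z w by (simp add: Z2_of_apply) (simp add: Z2_alg_def Z2_of_apply)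
    have "Z2_of \<Phi> R b (x \<oplus>\<^bsub>\<Phi>\<^esub> u, y \<oplus>\<^bsub>\<Phi>\<^esub> v) = Z2_of \<Phi> R b z \<oplus>\<^bsub>R\<^esub> Z2_of \<Phi> R b w"
      unfolding z(1) w(1) using z(2,3) w(2,3) pc
      by (simp add: Z2_of_apply A.smult_l_distr H.a_ac)
    then show "Z2_of \<Phi> R b (z \<oplus>\<^bsub>Z2_alg \<Phi>\<^esub> w) = Z2_of \<Phi> R b z \<oplus>\<^bsub>R\<^esub> Z2_of \<Phi> R b w"
      using z(1) w(1) by (simp add: Z2_alg_def)
  next
    show "Z2_of \<Phi> R b \<one>\<^bsub>Z2_alg \<Phi>\<^esub> = \<one>\<^bsub>R\<^esub>"
      using H.parts_sum[OF bc] pc by (simp add: Z2_alg_def Z2_of_apply)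
  qed
  moreover have "Z2_of \<Phi> R b (c \<odot>\<^bsub>Z2_alg \<Phi>\<^esub> z) = c \<odot>\<^bsub>R\<^esub> Z2_of \<Phi> R b z"
    if "c \<in> carrier \<Phi>" "z \<in> carrier (Z2_alg \<Phi>)" for c z
    using that pc
    by (cases z) (simp add: Z2_alg_carrier Z2_of_apply A.smult_r_distr A.smult_assoc1, simp add: Z2_alg_def Z2_of_apply A.smult_assoc1)
  moreover have "Z2_of \<Phi> R b \<in> extensional (carrier (Z2_alg \<Phi>))" by (simp add: Z2_of_def)
  ultimately show ?thesis unfolding Z2_points_def Let_def alg_hom_def by simp
qed

lemma Z2_of_mult:
  assumes b: "b \<in> carrier (mu2 R)" and c: "c \<in> carrier (mu2 R)"
  shows "Z2_of \<Phi> R (b \<otimes>\<^bsub>R\<^esub> c) = Z2_of \<Phi> R b \<otimes>\<^bsub>Z2_points \<Phi> R\<^esub> Z2_of \<Phi> R c"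
proof -
  have "b \<in> carrier R" "c \<in> carrier R" using b c by (auto simp: H.mu2_iff)
  then show ?thesis
    by (simp add: Z2_points_def Let_def Z2_of_idem H.parts_mult) (simp add: Z2_of_def)
qed

lemma Z2_of_one: "Z2_of \<Phi> R \<one>\<^bsub>R\<^esub> = \<one>\<^bsub>Z2_points \<Phi> R\<^esub>"
  by (auto simp: Z2_of_def Z2_points_def Let_def H.parts_one Z2_alg_carrier fun_eq_iff)

text \<open>The values of a point at (1,0) and (0,1) are orthogonal idempotents with sum 1. Their
  difference therefore squares to 1, and half of 1 plus or minus the difference gives them
  back.\<close>

lemma Z2_of_surj:
  assumes p: "p \<in> carrier (Z2_points \<Phi> R)"
  shows "\<exists>b\<in>carrier (mu2 R). p = Z2_of \<Phi> R b"
proof (intro bexI)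
  have hom: "p \<in> ring_hom (Z2_alg \<Phi>) R" and ext: "p \<in> extensional (carrier (Z2_alg \<Phi>))"
    and sm: "\<And>c z. c \<in> carrier \<Phi> \<Longrightarrow> z \<in> carrier (Z2_alg \<Phi>) \<Longrightarrow> p (c \<odot>\<^bsub>Z2_alg \<Phi>\<^esub> z) = c \<odot>\<^bsub>R\<^esub> p z"
    using p by (auto simp: Z2_points_def Let_def alg_hom_def)
  let ?e = "(\<one>\<^bsub>\<Phi>\<^esub>, \<zero>\<^bsub>\<Phi>\<^esub>)" and ?f = "(\<zero>\<^bsub>\<Phi>\<^esub>, \<one>\<^bsub>\<Phi>\<^esub>)"
  have ef: "?e \<in> carrier (Z2_alg \<Phi>)" "?f \<in> carrier (Z2_alg \<Phi>)" by (simp_all add: Z2_alg_carrier)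
  note c = ring_hom_closed[OF hom ef(1)] ring_hom_closed[OF hom ef(2)]
  have sum: "p ?e \<oplus>\<^bsub>R\<^esub> p ?f = \<one>\<^bsub>R\<^esub>"
    using ring_hom_add[OF hom ef] ring_hom_one[OF hom] by (simp add: Z2_alg_def)
  \<comment> \<open>The product of the two idempotents is zero; writing it as a zero multiple lets
    linearity of \<open>p\<close> evaluate it.\<close>
  have "p ?e \<otimes>\<^bsub>R\<^esub> p ?f = p (\<zero>\<^bsub>\<Phi>\<^esub> \<odot>\<^bsub>Z2_alg \<Phi>\<^esub> ?e)"
    using ring_hom_mult[OF hom ef] by (simp add: Z2_alg_def)
  then have prod: "p ?e \<otimes>\<^bsub>R\<^esub> p ?f = \<zero>\<^bsub>R\<^esub>" using sm[OF _ ef(1)] c by simp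
  have "p ?e \<otimes>\<^bsub>R\<^esub> p ?e = p ?e" "p ?f \<otimes>\<^bsub>R\<^esub> p ?f = p ?f"
    using ring_hom_mult[OF hom ef(1,1)] ring_hom_mult[OF hom ef(2,2)] by (simp_all add: Z2_alg_def)
  moreover have "(p ?e \<ominus>\<^bsub>R\<^esub> p ?f) \<otimes>\<^bsub>R\<^esub> (p ?e \<ominus>\<^bsub>R\<^esub> p ?f) =
    (p ?e \<otimes>\<^bsub>R\<^esub> p ?e \<oplus>\<^bsub>R\<^esub> p ?f \<otimes>\<^bsub>R\<^esub> p ?f) \<ominus>\<^bsub>R\<^esub> (p ?e \<otimes>\<^bsub>R\<^esub> p ?f \<oplus>\<^bsub>R\<^esub> p ?e \<otimes>\<^bsub>R\<^esub> p ?f)"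
    using c by algebra
  ultimately have sq: "Z2_sign \<Phi> R p \<otimes>\<^bsub>R\<^esub> Z2_sign \<Phi> R p = \<one>\<^bsub>R\<^esub>"
    using c by (simp add: Z2_sign_def prod sum a_minus_def)
  then show "Z2_sign \<Phi> R p \<in> carrier (mu2 R)" using c by (simp add: H.mu2_iff Z2_sign_def)
  have "\<one>\<^bsub>R\<^esub> \<oplus>\<^bsub>R\<^esub> (p ?e \<ominus>\<^bsub>R\<^esub> p ?f) = p ?e \<oplus>\<^bsub>R\<^esub> p ?e" "\<one>\<^bsub>R\<^esub> \<ominus>\<^bsub>R\<^esub> (p ?e \<ominus>\<^bsub>R\<^esub> p ?f) = p ?f \<oplus>\<^bsub>R\<^esub> p ?f"
    unfolding sum[symmetric] using c by algebra+
  then have parts: "H.pos_part (Z2_sign \<Phi> R p) = p ?e" "H.neg_part (Z2_sign \<Phi> R p) = p ?f"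
    using c by (simp_all add: H.pos_part_def H.neg_part_def Z2_sign_def H.half_double)
  show "p = Z2_of \<Phi> R (Z2_sign \<Phi> R p)"
  proof (rule extensionalityI[OF ext])
    show "Z2_of \<Phi> R (Z2_sign \<Phi> R p) \<in> extensional (carrier (Z2_alg \<Phi>))" by (simp add: Z2_of_def)
    fix z assume "z \<in> carrier (Z2_alg \<Phi>)"
    then obtain x y where z: "z = (x, y)" "x \<in> carrier \<Phi>" "y \<in> carrier \<Phi>"
      by (cases z) (auto simp: Z2_alg_carrier)
    have "z = (x \<odot>\<^bsub>Z2_alg \<Phi>\<^esub> ?e) \<oplus>\<^bsub>Z2_alg \<Phi>\<^esub> (y \<odot>\<^bsub>Z2_alg \<Phi>\<^esub> ?f)"
      using z by (simp add: Z2_alg_def)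
    moreover have "x \<odot>\<^bsub>Z2_alg \<Phi>\<^esub> ?e \<in> carrier (Z2_alg \<Phi>)" "y \<odot>\<^bsub>Z2_alg \<Phi>\<^esub> ?f \<in> carrier (Z2_alg \<Phi>)"
      using z by (simp_all add: Z2_alg_def)
    ultimately have "p z = (x \<odot>\<^bsub>R\<^esub> p ?e) \<oplus>\<^bsub>R\<^esub> (y \<odot>\<^bsub>R\<^esub> p ?f)"
      using ring_hom_add[OF hom] sm ef z by metis
    then show "p z = Z2_of \<Phi> R (Z2_sign \<Phi> R p) z"
      unfolding z(1) using z by (simp add: Z2_of_apply parts)
  qed
qed

lemma Z2_of_iso: "Z2_of \<Phi> R \<in> iso (mu2 R) (Z2_points \<Phi> R)"
proof (rule isoI)
  show "Z2_of \<Phi> R \<in> hom (mu2 R) (Z2_points \<Phi> R)"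
    by (rule homI) (simp_all add: Z2_of_closed Z2_of_mult)
  show "bij_betw (Z2_of \<Phi> R) (carrier (mu2 R)) (carrier (Z2_points \<Phi> R))"
    unfolding bij_betw_def
  proof
    show "inj_on (Z2_of \<Phi> R) (carrier (mu2 R))"
      using Z2_sign_of by (intro inj_on_inverseI[of _ "Z2_sign \<Phi> R"]) (simp add: H.mu2_iff)
    show "Z2_of \<Phi> R ` carrier (mu2 R) = carrier (Z2_points \<Phi> R)"
      using Z2_of_closed Z2_of_surj by blast
  qed
qed

end

lemma Z2_of_base_change:
  assumes K: "cring \<Phi>" and A: "algebra \<Phi> R" "algebra \<Phi> R'" and H: "half_cring R" "half_cring R'"
    and \<phi>: "\<phi> \<in> alg_hom \<Phi> R R'" and b: "b \<in> carrier R"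
  shows "(\<lambda>z\<in>carrier (Z2_alg \<Phi>). \<phi> (Z2_of \<Phi> R b z)) = Z2_of \<Phi> R' (\<phi> b)"
proof -
  interpret H: half_cring R by fact
  interpret A: algebra \<Phi> R by fact
  interpret H': half_cring R' by fact
  interpret h: ring_hom_cring R R' \<phi> by (rule alg_hom_ring_hom_cring[OF A \<phi>])
  have sm: "\<phi> (c \<odot>\<^bsub>R\<^esub> x) = c \<odot>\<^bsub>R'\<^esub> \<phi> x" if "c \<in> carrier \<Phi>" "x \<in> carrier R" for c x
    using \<phi> that by (simp add: alg_hom_def)
  \<comment> \<open>A ring homomorphism preserves \<open>half\<close> because 2 can be cancelled in
    the target.\<close>
  have "\<phi> H.half \<oplus>\<^bsub>R'\<^esub> \<phi> H.half = H'.half \<oplus>\<^bsub>R'\<^esub> H'.half"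
    using H.half_sum H'.half_sum by (simp flip: h.hom_add)
  then have half: "\<phi> H.half = H'.half" by (simp add: H'.double_eq_iff)
  have parts: "\<phi> (H.pos_part b) = H'.pos_part (\<phi> b)" "\<phi> (H.neg_part b) = H'.neg_part (\<phi> b)"
    using b by (simp_all add: H.pos_part_def H'.pos_part_def H.neg_part_def H'.neg_part_def half a_minus_def)
  show ?thesis
    unfolding Z2_of_def
    using b by (auto simp: fun_eq_iff Z2_alg_carrier[OF K A(1) H(1)] sm parts)
qed

section \<open>The automorphism functor and the natural isomorphism\<close>

lemma Aut_lorentz_functor:
  fixes \<Phi> :: "('k, 'm) ring_scheme"
  assumes half: "\<And>R :: ('k, 'r) module. algebra \<Phi> R \<Longrightarrow> half_cring R"
  shows "is_grp_functor \<Phi> (Aut_lorentz :: ('k, 'r, (nat \<Rightarrow> 'r) \<Rightarrow> (nat \<Rightarrow> 'r)) grp_functor)"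
proof -
  have mor: "mor Aut_lorentz R R' \<phi> = lorentz_base_change R R' \<phi>" for R R' :: "('k, 'r) module" and \<phi>
    unfolding Aut_lorentz_def by (simp add: fun_eq_iff lorentz_base_change_def)
  have obj: "obj Aut_lorentz R = lie_aut R (lorentz R)" for R :: "('k, 'r) module"
    unfolding Aut_lorentz_def by simp
  have comp: "lorentz_base_change R R'' (\<lambda>r. \<psi> (\<phi> r)) x =
      lorentz_base_change R' R'' \<psi> (lorentz_base_change R R' \<phi> x)"
    if R: "algebra \<Phi> R" "algebra \<Phi> R'" "algebra \<Phi> R''"
      and h: "\<phi> \<in> alg_hom \<Phi> R R'" "\<psi> \<in> alg_hom \<Phi> R' R''" and x: "x \<in> carrier (lie_aut R (lorentz R))"
    for R R' R'' :: "('k, 'r) module" and \<phi> \<psi> x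
  proof (rule extensionalityI)
    fix y assume "y \<in> carrier (lorentz R'')"
    then show "lorentz_base_change R R'' (\<lambda>r. \<psi> (\<phi> r)) x y =
      lorentz_base_change R' R'' \<psi> (lorentz_base_change R R' \<phi> x) y"
      by (rule base_change_trans[OF alg_hom_ring_hom_cring[OF R(1,2) h(1)]
            alg_hom_ring_hom_cring[OF R(2,3) h(2)] cring.lie_aut_linear[OF algebra.M_cring[OF R(1)] x]])
  qed (simp_all add: lorentz_base_change_def)
  show ?thesis
    unfolding is_grp_functor_def obj mor
  proof (intro conjI allI impI ballI)
    fix R :: "('k, 'r) module" assume R: "algebra \<Phi> R"
    show "group (lie_aut R (lorentz R))" by (rule half_cring.lie_aut_lorentz_group[OF half[OF R]])
    show "lorentz_base_change R R (\<lambda>r. r) x = x" if "x \<in> carrier (lie_aut R (lorentz R))" for x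
      by (rule cring.base_change_id[OF algebra.M_cring[OF R] that])
  next
    fix R R' :: "('k, 'r) module" and \<phi>
    assume "algebra \<Phi> R \<and> algebra \<Phi> R' \<and> \<phi> \<in> alg_hom \<Phi> R R'"
    then show "lorentz_base_change R R' \<phi> \<in> hom (lie_aut R (lorentz R)) (lie_aut R' (lorentz R'))"
      by (intro ring_hom_cring.base_change_hom alg_hom_ring_hom_cring) auto
  qed (elim conjE, rule comp)
qed

theorem Aut_lorentz_isomorphic:
  fixes \<Phi> :: "('k, 'm) ring_scheme"
  assumes "field \<Phi>" and "\<one>\<^bsub>\<Phi>\<^esub> \<oplus>\<^bsub>\<Phi>\<^esub> \<one>\<^bsub>\<Phi>\<^esub> \<noteq> \<zero>\<^bsub>\<Phi>\<^esub>"
  shows "grp_functors_isomorphic \<Phi>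
    (Aut_lorentz :: ('k, 'r, (nat \<Rightarrow> 'r) \<Rightarrow> (nat \<Rightarrow> 'r)) grp_functor) (PGL2_bar_Z2 \<Phi>)"
proof (rule grp_functors_isomorphicI)
  have K: "cring \<Phi>" using assms(1) by (simp add: field_def domain_def)
  note half = algebra_half_cring[OF assms]
  show "is_grp_functor \<Phi> (Aut_lorentz :: ('k, 'r, (nat \<Rightarrow> 'r) \<Rightarrow> (nat \<Rightarrow> 'r)) grp_functor)"
    by (rule Aut_lorentz_functor[OF half])
  let ?\<eta> = "\<lambda>(R :: ('k, 'r) module) \<alpha>. (half_cring.lor_pgl R \<alpha>, Z2_of \<Phi> R (half_cring.lor_sign R \<alpha>))"
  have obj: "obj Aut_lorentz R = lie_aut R (lorentz R)" "obj (PGL2_bar_Z2 \<Phi>) R =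
      semidirect (PGL2_sheaf (bar R)) (Z2_points \<Phi> R) (\<lambda>p L. map_mat2 (bar_aut R (Z2_sign \<Phi> R p)) ` L)"
    for R :: "('k, 'r) module"
    by (simp_all add: Aut_lorentz_def PGL2_bar_Z2_def)
  fix R :: "('k, 'r) module" assume R: "algebra \<Phi> R"
  interpret H: half_cring R by (rule half[OF R])
  \<comment> \<open>Signs are exchanged for points of the constant group scheme; the action is
    unchanged because \<open>Z2_sign\<close> undoes \<open>Z2_of\<close>.\<close>
  have "map_prod (\<lambda>L. L) (Z2_of \<Phi> R) \<in>
    iso (semidirect (PGL2_sheaf (bar R)) (mu2 R) (\<lambda>b L. map_mat2 (bar_aut R b) ` L))
      (semidirect (PGL2_sheaf (bar R)) (Z2_points \<Phi> R) (\<lambda>p L. map_mat2 (bar_aut R (Z2_sign \<Phi> R p)) ` L))"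
    by (rule semidirect_isoI[OF _ Z2_of_iso[OF K R H.half_cring_axioms]])
      (simp_all add: iso_def hom_def bij_betw_def H.mu2_iff Z2_sign_of[OF K R H.half_cring_axioms])
  from iso_set_trans[OF H.lorentz_aut_iso this]
  show "?\<eta> R \<in> iso (obj Aut_lorentz R) (obj (PGL2_bar_Z2 \<Phi>) R)"
    unfolding obj by (simp add: compose_def comp_def)
  show "?\<eta> R \<one>\<^bsub>obj Aut_lorentz R\<^esub> = \<one>\<^bsub>obj (PGL2_bar_Z2 \<Phi>) R\<^esub>"
    unfolding obj by (simp add: H.lor_one semidirect_def PGL2_sheaf_def Z2_of_one[OF K R H.half_cring_axioms])
  fix R' :: "('k, 'r) module" and \<phi> \<alpha>
  assume R': "algebra \<Phi> R'" and \<phi>: "\<phi> \<in> alg_hom \<Phi> R R'" and "\<alpha> \<in> carrier (obj Aut_lorentz R)"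
  then have \<alpha>: "\<alpha> \<in> carrier (lie_aut R (lorentz R))" unfolding obj by simp
  note h = alg_hom_ring_hom_cring[OF R R' \<phi>]
  have b: "H.lor_sign \<alpha> \<in> carrier R" using H.lor_sign(1)[OF \<alpha>] by (simp add: H.mu2_iff)
  have mor: "mor Aut_lorentz R R' \<phi> \<alpha> = lorentz_base_change R R' \<phi> \<alpha>"
    unfolding Aut_lorentz_def by (simp add: lorentz_base_change_def)
  have "Z2_of \<Phi> R' (\<phi> (H.lor_sign \<alpha>)) = (\<lambda>z\<in>carrier (Z2_alg \<Phi>). \<phi> (Z2_of \<Phi> R (H.lor_sign \<alpha>) z))"
    by (rule Z2_of_base_change[OF K R R' half[OF R] half[OF R'] \<phi> b, symmetric])
  then show "?\<eta> R' (mor Aut_lorentz R R' \<phi> \<alpha>) = mor (PGL2_bar_Z2 \<Phi>) R R' \<phi> (?\<eta> R \<alpha>)"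
    unfolding mor
    by (simp add: PGL2_bar_Z2_def lor_pgl_base_change[OF half[OF R] half[OF R'] h \<alpha>]
        lor_sign_base_change[OF half[OF R] half[OF R'] h \<alpha>])
qed


section \<open>The real case\<close>

text \<open>Closure is assumed in place of a group structure, since the lemma is applied to a
  semidirect product for which closure is what has been checked.\<close>

lemma iso_inv_into:
  assumes h: "h \<in> iso G H" and closed: "\<And>x y. x \<in> carrier G \<Longrightarrow> y \<in> carrier G \<Longrightarrow> x \<otimes>\<^bsub>G\<^esub> y \<in> carrier G"
  shows "inv_into (carrier G) h \<in> iso H G"
proof (rule isoI)
  have bij: "bij_betw h (carrier G) (carrier H)" and hom: "h \<in> hom G H" using h by (auto simp: iso_def)
  define k where "k = inv_into (carrier G) h"
  have k: "k y \<in> carrier G" "h (k y) = y" if "y \<in> carrier H" for y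
    using bij_betwE[OF bij_betw_inv_into[OF bij]] bij_betw_inv_into_right[OF bij] that
    by (auto simp: k_def)
  have kh: "k (h x) = x" if "x \<in> carrier G" for x
    using bij_betw_inv_into_left[OF bij that] by (simp add: k_def)
  show "inv_into (carrier G) h \<in> hom H G"
    unfolding k_def[symmetric]
  proof (rule homI)
    fix x y assume xy: "x \<in> carrier H" "y \<in> carrier H"
    have "x \<otimes>\<^bsub>H\<^esub> y = h (k x \<otimes>\<^bsub>G\<^esub> k y)" using xy k hom by (simp add: hom_mult)
    then show "k (x \<otimes>\<^bsub>H\<^esub> y) = k x \<otimes>\<^bsub>G\<^esub> k y" using kh closed k xy by simp
  qed (rule k)
  show "bij_betw (inv_into (carrier G) h) (carrier H) (carrier G)" by (rule bij_betw_inv_into[OF bij])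
qed

section \<open>Projective linear groups and ring isomorphisms\<close>

context cring
begin

text \<open>Cosets as sets of unit multiples of one matrix, a form in which entrywise maps can be
  evaluated.\<close>

lemma PGL2_carrier: "C \<in> carrier (PGL2 R) \<longleftrightarrow> (\<exists>g\<in>Units (Mat2 R). C = (\<lambda>c. c \<boxdot> g) ` Units R)"
proof -
  have "carrier (PGL2 R) = {scalars2 R #>\<^bsub>GL2 R\<^esub> g | g. g \<in> Units (Mat2 R)}"
    by (auto simp: PGL2_def FactGroup_def RCOSETS_def units_of_carrier)
  then have "C \<in> carrier (PGL2 R) \<longleftrightarrow> (\<exists>g\<in>Units (Mat2 R). C = scalars2 R #>\<^bsub>GL2 R\<^esub> g)" by blast
  then show ?thesis by (simp only: scalars2_coset cong: bex_cong)
qed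

lemma PGL2_group: "group (PGL2 R)"
  unfolding PGL2_def by (rule normal.factorgroup_is_group[OF scalars2_normal])

lemma PGL2_mult:
  assumes g: "g \<in> Units (Mat2 R)" and h: "h \<in> Units (Mat2 R)"
  shows "((\<lambda>c. c \<boxdot> g) ` Units R) \<otimes>\<^bsub>PGL2 R\<^esub> ((\<lambda>c. c \<boxdot> h) ` Units R) = (\<lambda>c. c \<boxdot> (g \<boxtimes> h)) ` Units R"
proof -
  interpret Mt: ring "Mat2 R" by (rule Mat2_ring)
  interpret N: normal "scalars2 R" "GL2 R" by (rule scalars2_normal)
  have gh: "g \<boxtimes> h \<in> Units (Mat2 R)" using g h by simp
  have "(scalars2 R #>\<^bsub>GL2 R\<^esub> g) \<otimes>\<^bsub>PGL2 R\<^esub> (scalars2 R #>\<^bsub>GL2 R\<^esub> h) = scalars2 R #>\<^bsub>GL2 R\<^esub> (g \<boxtimes> h)"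
    using g h N.rcos_sum[of g h] by (simp add: PGL2_def FactGroup_def units_of_carrier units_of_mult)
  then show ?thesis by (simp add: scalars2_coset g h gh)
qed

end

lemma (in ring_hom_cring) hom_unit: "u \<in> Units R \<Longrightarrow> h u \<in> Units S"
proof -
  assume u: "u \<in> Units R"
  then have "h (inv\<^bsub>R\<^esub> u) \<otimes>\<^bsub>S\<^esub> h u = \<one>\<^bsub>S\<^esub>" using hom_mult[of "inv\<^bsub>R\<^esub> u" u] R.Units_closed by simp
  then show ?thesis using u by (intro S.unit_of_inverse) auto
qed

text \<open>Serves twice: for the identification of complex numbers with real pairs, and for the
  action of a sign on complex matrices.\<close>

lemma PGL2_ring_iso:
  assumes "ring_hom_cring R S h" and bij: "bij_betw h (carrier R) (carrier S)"
  shows "(`) (map_mat2 h) \<in> iso (PGL2 R) (PGL2 S)"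
    and "g \<in> Units (Mat2 R) \<Longrightarrow> map_mat2 h g \<in> Units (Mat2 S)"
    and "g \<in> Units (Mat2 R) \<Longrightarrow> map_mat2 h ` (\<lambda>c. c \<boxdot>\<^bsub>R\<^esub> g) ` Units R = (\<lambda>c. c \<boxdot>\<^bsub>S\<^esub> map_mat2 h g) ` Units S"
proof -
  interpret ring_hom_cring R S h by fact
  interpret MR: ring "Mat2 R" by (rule R.Mat2_ring)
  have inj: "x = y" if "x \<in> carrier R" "y \<in> carrier R" "h x = h y" for x y
    using bij that by (auto simp: bij_betw_def dest: inj_onD)
  have surj: "\<exists>x\<in>carrier R. y = h x" if "y \<in> carrier S" for y
    using bij that by (auto simp: bij_betw_def)
  \<comment> \<open>Units are reflected because the inverse of \<open>h u\<close> has a preimage,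
    and injectivity turns that preimage into an inverse of \<open>u\<close>.\<close>
  have unit_iff: "u \<in> Units R" if u: "u \<in> carrier R" "h u \<in> Units S" for u
  proof -
    obtain v where v: "v \<in> carrier R" "inv\<^bsub>S\<^esub> (h u) = h v" using surj[of "inv\<^bsub>S\<^esub> (h u)"] u by auto
    have "h (v \<otimes>\<^bsub>R\<^esub> u) = h \<one>\<^bsub>R\<^esub>" using u v by (simp flip: v(2))
    then have "v \<otimes>\<^bsub>R\<^esub> u = \<one>\<^bsub>R\<^esub>" using u v by (intro inj) auto
    then show ?thesis using u v by (intro R.unit_of_inverse)
  qed
  have units: "h ` Units R = Units S"
  proof
    show "h ` Units R \<subseteq> Units S" using hom_unit by blast
    show "Units S \<subseteq> h ` Units R"
      using surj unit_iff by (metis S.Units_closed image_eqI subsetI)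
  qed
  have U: "map_mat2 h g \<in> Units (Mat2 S)" if "g \<in> Units (Mat2 R)" for g
    using that by (auto simp: R.Mat2_Units_iff S.Mat2_Units_iff map_mat2_det2 hom_unit)
  then show "g \<in> Units (Mat2 R) \<Longrightarrow> map_mat2 h g \<in> Units (Mat2 S)" .
  have coset: "map_mat2 h ` (\<lambda>c. c \<boxdot>\<^bsub>R\<^esub> g) ` Units R = (\<lambda>c. c \<boxdot>\<^bsub>S\<^esub> map_mat2 h g) ` Units S"
    if g: "g \<in> Units (Mat2 R)" for g
  proof -
    have "map_mat2 h ` (\<lambda>c. c \<boxdot>\<^bsub>R\<^esub> g) ` Units R = (\<lambda>c. h c \<boxdot>\<^bsub>S\<^esub> map_mat2 h g) ` Units R"
      unfolding image_image using MR.Units_closed[OF g] by (intro image_cong) (auto simp: map_mat2_smult)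
    also have "\<dots> = (\<lambda>c. c \<boxdot>\<^bsub>S\<^esub> map_mat2 h g) ` Units S"
      unfolding units[symmetric] by (simp add: image_image)
    finally show ?thesis .
  qed
  then show "g \<in> Units (Mat2 R) \<Longrightarrow> map_mat2 h ` (\<lambda>c. c \<boxdot>\<^bsub>R\<^esub> g) ` Units R = (\<lambda>c. c \<boxdot>\<^bsub>S\<^esub> map_mat2 h g) ` Units S" .
  show "(`) (map_mat2 h) \<in> iso (PGL2 R) (PGL2 S)"
  proof (rule isoI)
    show "(`) (map_mat2 h) \<in> hom (PGL2 R) (PGL2 S)"
    proof (rule homI)
      fix C assume "C \<in> carrier (PGL2 R)"
      then obtain g where g: "g \<in> Units (Mat2 R)" "C = (\<lambda>c. c \<boxdot>\<^bsub>R\<^esub> g) ` Units R"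
        unfolding R.PGL2_carrier by blast
      show "map_mat2 h ` C \<in> carrier (PGL2 S)"
        unfolding g(2) coset[OF g(1)] S.PGL2_carrier using U[OF g(1)] by blast
      fix D assume "D \<in> carrier (PGL2 R)"
      then obtain k where k: "k \<in> Units (Mat2 R)" "D = (\<lambda>c. c \<boxdot>\<^bsub>R\<^esub> k) ` Units R"
        unfolding R.PGL2_carrier by blast
      have gk: "g \<boxtimes>\<^bsub>R\<^esub> k \<in> Units (Mat2 R)" using g k by simp
      show "map_mat2 h ` (C \<otimes>\<^bsub>PGL2 R\<^esub> D) = map_mat2 h ` C \<otimes>\<^bsub>PGL2 S\<^esub> map_mat2 h ` D"
        unfolding g(2) k(2) R.PGL2_mult[OF g(1) k(1)] coset[OF g(1)] coset[OF k(1)] coset[OF gk]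
          S.PGL2_mult[OF U[OF g(1)] U[OF k(1)]] map_mat2_mult[OF MR.Units_closed[OF g(1)] MR.Units_closed[OF k(1)]] ..
    qed
    have inj_mat: "inj_on (map_mat2 h) (carrier (Mat2 R))"
      by (rule inj_onI) (auto elim!: R.Mat2_cases intro: inj)
    show "bij_betw ((`) (map_mat2 h)) (carrier (PGL2 R)) (carrier (PGL2 S))"
      unfolding bij_betw_def
    proof
      show "inj_on ((`) (map_mat2 h)) (carrier (PGL2 R))"
      proof (rule inj_on_image_Pow[THEN inj_on_subset, OF inj_mat])
        show "carrier (PGL2 R) \<subseteq> Pow (carrier (Mat2 R))"
        proof
          fix C assume "C \<in> carrier (PGL2 R)"
          then obtain g where g: "g \<in> Units (Mat2 R)" "C = (\<lambda>c. c \<boxdot>\<^bsub>R\<^esub> g) ` Units R"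
            unfolding R.PGL2_carrier by blast
          have "c \<boxdot>\<^bsub>R\<^esub> g \<in> carrier (Mat2 R)" if "c \<in> Units R" for c
            by (rule module.smult_closed[OF R.Mat2_module R.Units_closed[OF that] MR.Units_closed[OF g(1)]])
          then show "C \<in> Pow (carrier (Mat2 R))" unfolding g(2) by blast
        qed
      qed
      show "(`) (map_mat2 h) ` carrier (PGL2 R) = carrier (PGL2 S)"
      proof
        show "(`) (map_mat2 h) ` carrier (PGL2 R) \<subseteq> carrier (PGL2 S)"
        proof clarify
          fix C assume "C \<in> carrier (PGL2 R)"
          then obtain g where g: "g \<in> Units (Mat2 R)" "C = (\<lambda>c. c \<boxdot>\<^bsub>R\<^esub> g) ` Units R"
            unfolding R.PGL2_carrier by blast
          show "map_mat2 h ` C \<in> carrier (PGL2 S)"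
            unfolding g(2) coset[OF g(1)] S.PGL2_carrier using U[OF g(1)] by blast
        qed
        show "carrier (PGL2 S) \<subseteq> (`) (map_mat2 h) ` carrier (PGL2 R)"
        proof
          fix D assume "D \<in> carrier (PGL2 S)"
          then obtain k where k: "k \<in> Units (Mat2 S)" "D = (\<lambda>c. c \<boxdot>\<^bsub>S\<^esub> k) ` Units S"
            unfolding S.PGL2_carrier by blast
          then have kc: "k \<in> carrier (Mat2 S)" "det2 S k \<in> Units S" by (auto simp: S.Mat2_Units_iff)
          obtain g where g: "g \<in> carrier (Mat2 R)" "k = map_mat2 h g"
          proof -
            obtain a b c d where abcd: "k = (a, b, c, d)" "a \<in> carrier S" "b \<in> carrier S" "c \<in> carrier S" "d \<in> carrier S"
              using kc(1) by (rule S.Mat2_cases)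
            then obtain a' b' c' d' where "a' \<in> carrier R" "b' \<in> carrier R" "c' \<in> carrier R" "d' \<in> carrier R"
              "a = h a'" "b = h b'" "c = h c'" "d = h d'" using surj by metis
            then show thesis using abcd by (intro that[of "(a', b', c', d')"]) simp_all
          qed
          have gU: "g \<in> Units (Mat2 R)"
            using kc(2) g unit_iff R.det2_closed by (simp add: R.Mat2_Units_iff map_mat2_det2)
          then have "(\<lambda>c. c \<boxdot>\<^bsub>R\<^esub> g) ` Units R \<in> carrier (PGL2 R)" unfolding R.PGL2_carrier by blast
          moreover have "D = map_mat2 h ` (\<lambda>c. c \<boxdot>\<^bsub>R\<^esub> g) ` Units R"
            unfolding coset[OF gU] k(2) g(2) ..
          ultimately show "D \<in> (`) (map_mat2 h) ` carrier (PGL2 R)" by blast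
        qed
      qed
    qed
  qed
qed

section \<open>Complex numbers as pairs of reals\<close>

abbreviation real_ring :: "real ring" where "real_ring \<equiv> ring_of_type_algebra"
abbreviation complex_ring :: "complex ring" where "complex_ring \<equiv> ring_of_type_algebra"

lemma type_ring_simps [simp]:
  "carrier ring_of_type_algebra = UNIV" "x \<otimes>\<^bsub>ring_of_type_algebra\<^esub> y = x * y"
  "x \<oplus>\<^bsub>ring_of_type_algebra\<^esub> y = x + y" "\<one>\<^bsub>ring_of_type_algebra\<^esub> = 1" "\<zero>\<^bsub>ring_of_type_algebra\<^esub> = 0"
  by (simp_all add: ring_of_type_algebra_def)

lemma type_ring_minus [simp]:
  fixes x y :: "'a :: comm_ring_1"
  shows "\<ominus>\<^bsub>ring_of_type_algebra\<^esub> x = - x" "x \<ominus>\<^bsub>ring_of_type_algebra\<^esub> y = x - y"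
proof -
  interpret cring "ring_of_type_algebra :: 'a ring" by (rule cring_from_type_algebra)
  show "\<ominus>\<^bsub>ring_of_type_algebra\<^esub> x = - x" for x :: 'a by (rule minus_equality) simp_all
  then show "x \<ominus>\<^bsub>ring_of_type_algebra\<^esub> y = x - y" by (simp add: a_minus_def)
qed

lemma real_ring_half: "half_cring real_ring"
proof (intro half_cring.intro half_cring_axioms.intro)
  show "cring real_ring" by (rule cring_from_type_algebra)
  have "(2 :: real) * (1 / 2) = 1" by simp
  then show "\<one>\<^bsub>real_ring\<^esub> \<oplus>\<^bsub>real_ring\<^esub> \<one>\<^bsub>real_ring\<^esub> \<in> Units real_ring"
    unfolding Units_def by (auto intro!: exI[of _ "1 / 2 :: real"])
qed

definition complex_pair :: "complex \<Rightarrow> real \<times> real" where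
  "complex_pair z = (Re z, Im z)"

lemma complex_pair_iso: "ring_hom_cring complex_ring (bar real_ring) complex_pair"
  and complex_pair_bij: "bij_betw complex_pair (carrier complex_ring) (carrier (bar real_ring))"
proof -
  interpret R: half_cring real_ring by (rule real_ring_half)
  have "complex_pair \<in> ring_hom complex_ring (bar real_ring)"
    by (rule ring_hom_memI) (simp_all add: complex_pair_def)
  then show "ring_hom_cring complex_ring (bar real_ring) complex_pair"
    by (intro ring_hom_cring.intro ring_hom_cring_axioms.intro cring_from_type_algebra R.bar_cring)
  show "bij_betw complex_pair (carrier complex_ring) (carrier (bar real_ring))"
    by (rule bij_betw_byWitness[where f' = "\<lambda>(x, y). Complex x y"]) (auto simp: complex_pair_def)
qed

text \<open>Pairs of reals form the field of complex numbers, so zero is the only nonunit. Being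
  local is what makes every point of the sheaf a coset.\<close>

lemma bar_real_local: "ideal (carrier (bar real_ring) - Units (bar real_ring)) (bar real_ring)"
proof -
  interpret R: half_cring real_ring by (rule real_ring_half)
  interpret B: half_cring "bar real_ring" by (rule R.bar_half_cring)
  interpret h: ring_hom_cring complex_ring "bar real_ring" complex_pair by (rule complex_pair_iso)
  have "z \<in> Units (bar real_ring) \<longleftrightarrow> z \<noteq> \<zero>\<^bsub>bar real_ring\<^esub>" for z
  proof
    assume z: "z \<noteq> \<zero>\<^bsub>bar real_ring\<^esub>"
    define w where "w = Complex (fst z) (snd z)"
    have w: "z = complex_pair w" "w \<noteq> 0"
      using z by (auto simp: w_def complex_pair_def prod_eq_iff complex_eq_iff)
    then have "inverse w * w = 1" by simp
    then have "w \<in> Units complex_ring" unfolding Units_def by (auto simp: mult.commute intro!: exI[of _ "inverse w"])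
    then show "z \<in> Units (bar real_ring)" using h.hom_unit w by blast
  next
    assume "z \<in> Units (bar real_ring)"
    then show "z \<noteq> \<zero>\<^bsub>bar real_ring\<^esub>"
      using B.Units_r_inv_ex[of z] by (auto simp: bar_def)
  qed
  then have "carrier (bar real_ring) - Units (bar real_ring) = {\<zero>\<^bsub>bar real_ring\<^esub>}"
    by (auto simp: bar_def)
  then show ?thesis using B.zeroideal by simp
qed

text \<open>Over the local ring of real pairs the sheaf is the naive quotient, so
  \<open>lorentz_aut_iso\<close> can be rewritten with cosets of complex matrices.\<close>

lemma lorentz_aut_real:
  "lie_aut real_ring (lorentz real_ring) \<cong> PGL2_complex_mu2_real"
proof -
  interpret R: half_cring real_ring by (rule real_ring_half)
  interpret B: half_cring "bar real_ring" by (rule R.bar_half_cring)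
  interpret C: cring complex_ring by (rule cring_from_type_algebra)
  interpret h: ring_hom_cring complex_ring "bar real_ring" complex_pair by (rule complex_pair_iso)
  note hiso = PGL2_ring_iso[OF complex_pair_iso complex_pair_bij]
  \<comment> \<open>\<kappa> composes the passage from complex numbers to real pairs with the
    passage from a coset to its span.\<close>
  define \<kappa> where "\<kappa> C = span2 (bar real_ring) (map_mat2 complex_pair ` C)" for C
  have \<kappa>: "\<kappa> \<in> iso (PGL2 complex_ring) (PGL2_sheaf (bar real_ring))"
    using iso_set_trans[OF hiso(1) B.PGL2_iso_local_ring[OF bar_real_local]]
    by (simp add: \<kappa>_def[abs_def] comp_def)
  \<comment> \<open>For a sign b this is the identity or complex conjugation, the complex form of
    \<open>bar_aut\<close>.\<close>
  define s where "s b = (\<lambda>z. Complex (Re z) (b * Im z))" for b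
  have b2: "b * b = 1" if "b \<in> carrier (mu2 real_ring)" for b
    using that by (simp add: R.mu2_iff)
  have s: "ring_hom_cring complex_ring complex_ring (s b)" "bij_betw (s b) (carrier complex_ring) (carrier complex_ring)"
    if b: "b \<in> carrier (mu2 real_ring)" for b
  proof -
    have *: "b * (b * x) = x" for x using b2[OF b] by (simp flip: mult.assoc)
    have "s b \<in> ring_hom complex_ring complex_ring"
      by (rule ring_hom_memI) (simp_all add: s_def complex_eq_iff b2[OF b] algebra_simps)
    then show "ring_hom_cring complex_ring complex_ring (s b)" by unfold_locales
    show "bij_betw (s b) (carrier complex_ring) (carrier complex_ring)"
      by (rule bij_betw_byWitness[where f' = "s b"]) (auto simp: s_def *)
  qed
  \<comment> \<open>Equivariance is checked on generators: \<kappa> sends a coset to all multiples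
    of one matrix, and \<open>bar_aut\<close> only permutes the scalars.\<close>
  have act: "map_mat2 (s b) ` n \<in> carrier (PGL2 complex_ring)"
    "\<kappa> (map_mat2 (s b) ` n) = map_mat2 (bar_aut real_ring b) ` \<kappa> n"
    if b: "b \<in> carrier (mu2 real_ring)" and n: "n \<in> carrier (PGL2 complex_ring)" for b n
  proof -
    note siso = PGL2_ring_iso[OF s[OF b]]
    interpret T: half_cring_invol "bar real_ring" "bar_aut real_ring b" by (rule R.bar_half_cring_invol[OF b])
    interpret CM: ring "Mat2 complex_ring" by (rule C.Mat2_ring)
    show "map_mat2 (s b) ` n \<in> carrier (PGL2 complex_ring)"
      using siso(1) n by (auto simp: iso_def hom_def)
    obtain g where g: "g \<in> Units (Mat2 complex_ring)" "n = (\<lambda>c. c \<odot>\<^bsub>Mat2 complex_ring\<^esub> g) ` Units complex_ring"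
      using n unfolding C.PGL2_carrier by blast
    have span: "\<kappa> ((\<lambda>c. c \<odot>\<^bsub>Mat2 complex_ring\<^esub> k) ` Units complex_ring) =
        (\<lambda>c. c \<boxdot>\<^bsub>bar real_ring\<^esub> map_mat2 complex_pair k) ` carrier (bar real_ring)"
      if k: "k \<in> Units (Mat2 complex_ring)" for k
    proof -
      have "\<kappa> ((\<lambda>c. c \<odot>\<^bsub>Mat2 complex_ring\<^esub> k) ` Units complex_ring) = span2 (bar real_ring) {map_mat2 complex_pair k}"
        unfolding \<kappa>_def hiso(3)[OF k] B.scalars2_coset[OF hiso(2)[OF k], symmetric]
        by (rule B.span2_scalars2_coset[OF hiso(2)[OF k]])
      then show ?thesis using B.span2_single(1)[of "map_mat2 complex_pair k"] hiso(2)[OF k] by auto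
    qed
    have comm: "map_mat2 complex_pair (map_mat2 (s b) g) = map_mat2 (bar_aut real_ring b) (map_mat2 complex_pair g)"
      by (cases g) (simp add: map_mat2_def s_def complex_pair_def)
    have surj: "bar_aut real_ring b ` carrier (bar real_ring) = carrier (bar real_ring)"
      using T.tau_tau T.T.hom_closed by (metis (no_types, opaque_lifting) image_eqI image_subsetI subsetI subset_antisym)
    have "\<kappa> (map_mat2 (s b) ` n) =
      (\<lambda>c. c \<boxdot>\<^bsub>bar real_ring\<^esub> map_mat2 (bar_aut real_ring b) (map_mat2 complex_pair g)) ` carrier (bar real_ring)"
      unfolding g(2) siso(3)[OF g(1)] span[OF siso(2)[OF g(1)]] comm ..
    also have "\<dots> = (\<lambda>c. bar_aut real_ring b c \<boxdot>\<^bsub>bar real_ring\<^esub> map_mat2 (bar_aut real_ring b) (map_mat2 complex_pair g))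
      ` carrier (bar real_ring)"
      by (subst (1) surj[symmetric]) (simp only: image_image)
    also have "\<dots> = map_mat2 (bar_aut real_ring b) ` \<kappa> n"
      unfolding g(2) span[OF g(1)] image_image
      using hiso(2)[OF g(1)] by (intro image_cong) (auto simp: T.T.map_mat2_smult)
    finally show "\<kappa> (map_mat2 (s b) ` n) = map_mat2 (bar_aut real_ring b) ` \<kappa> n" .
  qed
  have P: "PGL2_complex_mu2_real = semidirect (PGL2 complex_ring) (mu2 real_ring) (\<lambda>b C. map_mat2 (s b) ` C)"
    unfolding PGL2_complex_mu2_real_def s_def ..
  interpret G: group "PGL2 complex_ring" by (rule C.PGL2_group)
  interpret mu: comm_group "mu2 real_ring" by (rule R.mu2_comm_group)
  have "map_prod \<kappa> (\<lambda>b. b) \<in> iso PGL2_complex_mu2_real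
    (semidirect (PGL2_sheaf (bar real_ring)) (mu2 real_ring) (\<lambda>b L. map_mat2 (bar_aut real_ring b) ` L))"
    unfolding P
  proof (rule semidirect_isoI[OF \<kappa>])
    show "(\<lambda>b. b) \<in> iso (mu2 real_ring) (mu2 real_ring)" by (simp add: iso_def hom_def bij_betw_def)
    fix n b n' assume n: "n \<in> carrier (PGL2 complex_ring)" "b \<in> carrier (mu2 real_ring)"
      "n' \<in> carrier (PGL2 complex_ring)"
    have "\<kappa> \<in> hom (PGL2 complex_ring) (PGL2_sheaf (bar real_ring))" using \<kappa> by (simp add: iso_def)
    then show "\<kappa> (n \<otimes>\<^bsub>PGL2 complex_ring\<^esub> map_mat2 (s b) ` n') =
      \<kappa> n \<otimes>\<^bsub>PGL2_sheaf (bar real_ring)\<^esub> map_mat2 (bar_aut real_ring b) ` \<kappa> n'"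
      using act[OF n(2,3)] n by (simp add: hom_mult)
  qed
  \<comment> \<open>The map built so far leads from complex cosets to the sheaf; its inverse is what
    composes with \<open>lorentz_aut_iso\<close>.\<close>
  from iso_inv_into[OF this]
  have "inv_into (carrier PGL2_complex_mu2_real) (map_prod \<kappa> (\<lambda>b. b)) \<in>
    iso (semidirect (PGL2_sheaf (bar real_ring)) (mu2 real_ring) (\<lambda>b L. map_mat2 (bar_aut real_ring b) ` L))
      PGL2_complex_mu2_real"
    using act(1) mu.m_closed by (auto simp: P semidirect_def)
  from iso_set_trans[OF R.lorentz_aut_iso this] show ?thesis by (auto simp: is_iso_def)
qed

text \<open>The coordinates 1 to 3 are the boosts, symmetric entries that mix time with space; the
  coordinates 4 to 6 are the antisymmetric spatial rotations.\<close>

definition lorentz_to_o13 :: "(nat \<Rightarrow> real) \<Rightarrow> real^4^4" where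
  "lorentz_to_o13 x = vector [vector [0, x 1, x 2, x 3], vector [x 1, 0, x 4, x 5],
     vector [x 2, - x 4, 0, x 6], vector [x 3, - x 5, - x 6, 0]]"

lemma vector_4 [simp]:
  "vec_nth (vector [a, b, c, d] :: 'a::zero^4) 1 = a" "vec_nth (vector [a, b, c, d] :: 'a::zero^4) 2 = b"
  "vec_nth (vector [a, b, c, d] :: 'a::zero^4) 3 = c" "vec_nth (vector [a, b, c, d] :: 'a::zero^4) 4 = d"
  by (simp_all add: vector_def)

abbreviation entry :: "real^4^4 \<Rightarrow> 4 \<Rightarrow> 4 \<Rightarrow> real" where
  "entry A i j \<equiv> vec_nth (vec_nth A i) j"

text \<open>The form is diagonal with signs \<open>m\<close>, so the defining equation splits into
  one equation A_ji m_j + m_i A_ij = 0 for each pair of indices.\<close>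

lemma o13_carrier_iff:
  "A \<in> carrier o13 \<longleftrightarrow> entry A 1 1 = 0 \<and> entry A 2 2 = 0 \<and> entry A 3 3 = 0 \<and> entry A 4 4 = 0 \<and>
     entry A 2 1 = entry A 1 2 \<and> entry A 3 1 = entry A 1 3 \<and> entry A 4 1 = entry A 1 4 \<and>
     entry A 3 2 = - entry A 2 3 \<and> entry A 4 2 = - entry A 2 4 \<and> entry A 4 3 = - entry A 3 4"
proof -
  define m :: "4 \<Rightarrow> real" where "m i = (if i = 1 then 1 else - 1)" for i
  have mk: "entry minkowski i j = (if i = j then m i else 0)" for i j
    by (simp add: minkowski_def m_def)
  have "entry (transpose A ** minkowski + minkowski ** A) i j = entry A j i * m j + m i * entry A i j" for i j
    by (simp add: matrix_matrix_mult_def transpose_def mk if_distrib[of "\<lambda>x. x * _"] if_distrib[of "\<lambda>x. _ * x"]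
        cong: if_cong)
  then have "A \<in> carrier o13 \<longleftrightarrow> (\<forall>i j. entry A j i * m j + m i * entry A i j = 0)"
    by (simp add: o13_def vec_eq_iff)
  also have "\<dots> \<longleftrightarrow> (\<forall>i j. entry A j i * m j = - (m i * entry A i j))"
    by (simp add: eq_neg_iff_add_eq_0)
  also have "\<dots> \<longleftrightarrow> entry A 1 1 = 0 \<and> entry A 2 2 = 0 \<and> entry A 3 3 = 0 \<and> entry A 4 4 = 0 \<and>
     entry A 2 1 = entry A 1 2 \<and> entry A 3 1 = entry A 1 3 \<and> entry A 4 1 = entry A 1 4 \<and>
     entry A 3 2 = - entry A 2 3 \<and> entry A 4 2 = - entry A 2 4 \<and> entry A 4 3 = - entry A 3 4"
    unfolding forall_4 by (simp add: m_def) (safe; simp)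
  finally show ?thesis .
qed

lemma lorentz_to_o13_iso: "lorentz_to_o13 \<in> lie_iso real_ring (lorentz real_ring) o13"
  unfolding lie_iso_def
proof (intro CollectI conjI ballI)
  let ?x = "\<lambda>A :: real^4^4. (\<lambda>i\<in>{1..6}. if i = 1 then entry A 1 2 else if i = 2 then entry A 1 3 else if i = 3 then entry A 1 4
    else if i = 4 then entry A 2 3 else if i = 5 then entry A 2 4 else entry A 3 4) :: nat \<Rightarrow> real"
  show "bij_betw lorentz_to_o13 (carrier (lorentz real_ring)) (carrier o13)"
  proof (rule bij_betw_byWitness[where f' = ?x])
    show "\<forall>x\<in>carrier (lorentz real_ring). ?x (lorentz_to_o13 x) = x"
    proof
      fix x assume x: "x \<in> carrier (lorentz real_ring)"
      show "?x (lorentz_to_o13 x) = x"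
        by (rule lorentz_eqI[OF _ x]) (simp_all add: lorentz_carrier lorentz_to_o13_def)
    qed
    show "\<forall>A\<in>carrier o13. lorentz_to_o13 (?x A) = A"
      by (auto simp: o13_carrier_iff lorentz_to_o13_def vec_eq_iff forall_4)
    show "lorentz_to_o13 ` carrier (lorentz real_ring) \<subseteq> carrier o13"
      by (auto simp: o13_carrier_iff lorentz_to_o13_def)
    show "?x ` carrier o13 \<subseteq> carrier (lorentz real_ring)"
      by (auto simp: lorentz_carrier)
  qed
  fix x y
  show "lorentz_to_o13 (x \<oplus>\<^bsub>lorentz real_ring\<^esub> y) = lorentz_to_o13 x \<oplus>\<^bsub>o13\<^esub> lorentz_to_o13 y"
    by (simp add: lorentz_to_o13_def o13_def vec_eq_iff forall_4 lorentz_add_apply)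
  show "lorentz_to_o13 (x \<otimes>\<^bsub>lorentz real_ring\<^esub> y) = lorentz_to_o13 x \<otimes>\<^bsub>o13\<^esub> lorentz_to_o13 y"
    by (simp add: lorentz_to_o13_def o13_def vec_eq_iff forall_4 lorentz_mult_coord[unfolded One_nat_def]
        matrix_matrix_mult_def sum_4)
next
  fix r x
  show "lorentz_to_o13 (r \<odot>\<^bsub>lorentz real_ring\<^esub> x) = r \<odot>\<^bsub>o13\<^esub> lorentz_to_o13 x"
    by (simp add: lorentz_to_o13_def o13_def vec_eq_iff forall_4 lorentz_smult_apply)
qed

theorem theorem8:
  fixes \<Phi> :: "('k, 'm) ring_scheme"
  assumes "field \<Phi>"
    and "\<one>\<^bsub>\<Phi>\<^esub> \<oplus>\<^bsub>\<Phi>\<^esub> \<one>\<^bsub>\<Phi>\<^esub> \<noteq> \<zero>\<^bsub>\<Phi>\<^esub>"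
    and "\<not> (\<exists>x\<in>carrier \<Phi>. x \<otimes>\<^bsub>\<Phi>\<^esub> x = \<ominus>\<^bsub>\<Phi>\<^esub> \<one>\<^bsub>\<Phi>\<^esub>)"
  shows "grp_functors_isomorphic \<Phi>
           (Aut_lorentz :: ('k, 'r, (nat \<Rightarrow> 'r) \<Rightarrow> (nat \<Rightarrow> 'r)) grp_functor)
           (PGL2_bar_Z2 \<Phi>) \<and>
         lie_iso (ring_of_type_algebra :: real ring)
           (lorentz (ring_of_type_algebra :: real ring)) o13 \<noteq> {} \<and>
         lie_aut (ring_of_type_algebra :: real ring)
           (lorentz (ring_of_type_algebra :: real ring)) \<cong> PGL2_complex_mu2_real"
  using Aut_lorentz_isomorphic[OF assms(1,2)] lorentz_to_o13_iso lorentz_aut_real by blast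

end
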